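(* Let $X=\{x_1,x_2\}$ and consider the quotient algebras $(\Bbbk\langle x_1,x_2\rangle\#\Bbbk[\Gamma])/I$, where the ideal $I$ depends upon $(q_{ij})_{1\le i,j\le 2}$ as follows. (1) Let $q_{12}q_{21}=q_{11}^{-1}=q_{22}^{-1}$ (Cartan type $A_2$). (a) If $q_{11}=-1$, let $I$ be generated by $x_1^2-\mu_1(1-g_1^2)$, $\ [x_1x_2]^2-4\mu_1q_{21}x_2^2-\mu_{12}(1-g_{12}^2)$, $\ x_2^2-\mu_2(1-g_2^2)$. (b) If $\operatorname{ord}q_{11}=3$, let $I$ be generated by $[x_1x_1x_2]-\lambda_{112}(1-g_{112})$, $\ [x_1x_2x_2]-\lambda_{122}(1-g_{122})$, $\ x_1^3-\mu_1(1-g_1^3)$, $[x_1x_2]^3+(1-q_{11})q_{11}\lambda_{112}[x_1x_2x_2]-\mu_1(1-q_{11})^3x_2^3-\mu_{12}(1-g_{12}^3)$, $\ x_2^3-\mu_2(1-g_2^3)$. (c) If $N:=\operatorname{ord}q_{11}\ge4$, let $I$ be generated by $[x_1x_1x_2]$, $\ [x_1x_2x_2]$, $\ x_1^N-\mu_1(1-g_1^N)$, $[x_1x_2]^N-\mu_1(q_{11}-1)^Nq_{21}^{N(N-1)/2}x_2^N-\mu_{12}(1-g_{12}^N)$, $\ x_2^N-\mu_2(1-g_2^N)$. (2) Let $q_{12}q_{21}=q_{11}^{-1}$, $q_{22}=-1$. (a) If $4\ne N:=\operatorname{ord}q_{11}\ge3$, let $I$ be generated by $[x_1x_1x_2]$,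 $\ x_1^N-\mu_1(1-g_1^N)$, $\ x_2^2-\mu_2(1-g_2^2)$. (b) If $\operatorname{ord}q_{11}=4$, let $I$ be generated by $[x_1x_1x_2]-\lambda_{112}(1-g_{112})$, $\ x_1^4-\mu_1(1-g_1^4)$, $\ x_2^2-\mu_2(1-g_2^2)$. (3) Let $q_{11}=-1$, $q_{12}q_{21}=q_{22}^{-1}$. (a) If $4\ne N:=\operatorname{ord}q_{22}\ge3$, let $I$ be generated by $[x_1x_2x_2]$, $\ x_1^2-\mu_1(1-g_1^2)$, $\ x_2^N-\mu_2(1-g_2^N)$. (b) If $\operatorname{ord}q_{22}=4$, let $I$ be generated by $[x_1x_2x_2]-\lambda_{122}(1-g_{122})$, $\ x_1^2-\mu_1(1-g_1^2)$, $\ x_2^4-\mu_2(1-g_2^4)$. (4) Let $q_{11}=q_{22}=-1$ and $N:=\operatorname{ord}q_{12}q_{21}\ge3$. (a) If $q_{12}\ne\pm1$, let $I$ be generated by $x_1^2-\mu_1(1-g_1^2)$, $\ [x_1x_2]^N-\mu_{12}(1-g_{12}^N)$, $\ x_2^2$. (b) If $q_{12}=\pm1$, let $I$ be generated by $x_1^2$, $\ [x_1x_2]^N-\mu_{12}(1-g_{12}^N)$, $\ x_2^2-\mu_2(1-g_2^2)$. Then in each of these cases the (residue classes of the) elements $$x_2^{r_2}[x_1x_2]^{r_{12}}x_1^{r_1}g,\qquad 0\le r_1<N_1,\ 0\le r_{12}<N_{12},\ 0\le r_2<N_2,\ g\in\Gamma,$$ form a $\Bbbk$-basis of $(\Bbbk\langle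 x_1,x_2\rangle\#\Bbbk[\Gamma])/I$.
   Context: $\Bbbk$ is a field, $\Gamma$ an abelian group, $\widehat\Gamma$ its group of characters with values in $\Bbbk^\times$ (unit $\varepsilon$), $g_1,g_2\in\Gamma$, $\chi_1,\chi_2\in\widehat\Gamma$, $q_{ij}:=\chi_j(g_i)$. $\Bbbk\langle x_1,x_2\rangle\#\Bbbk[\Gamma]$ is the smash product of the free algebra with the group algebra for the action $g\cdot x_i=\chi_i(g)x_i$, i.e. $gx_i=\chi_i(g)x_ig$. For a word $i_1\cdots i_n$ in $\{1,2\}$ put $g_{i_1\cdots i_n}=g_{i_1}\cdots g_{i_n}$ and $\chi_{i_1\cdots i_n}=\chi_{i_1}\cdots\chi_{i_n}$ (so $g_{12}=g_1g_2$, $g_{112}=g_1^2g_2$, $g_{122}=g_1g_2^2$). Iterated $q$-commutators: $[x_1x_2]=x_1x_2-q_{12}x_2x_1$, $[x_1x_1x_2]=x_1[x_1x_2]-q_{11}q_{12}[x_1x_2]x_1$, $[x_1x_2x_2]=[x_1x_2]x_2-q_{12}q_{22}x_2[x_1x_2]$. $\operatorname{ord}$ denotes multiplicative order (possibly $\infty$). Put $N_1=\operatorname{ord}q_{11}$, $N_2=\operatorname{ord}q_{22}$, $N_{12}=\operatorname{ord}q_{12,12}$ with $q_{12,12}=\chi_{12}(g_{12})=q_{11}q_{12}q_{21}q_{22}$; it is assumed that $N_1,N_2,N_{12}\in\{2,3,\dots,\infty\}$. Generators of $I$ involving an infinite power are omitted. The coefficients $\mu_1,\mu_2,\mu_{12}$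 and $\lambda_{112},\lambda_{122}$ are elements of $\Bbbk$ subject to: for $u\in\{1,2,12\}$ (with $N_u<\infty$), $\mu_u=0$ if $g_u^{N_u}=1$ or $\chi_u^{N_u}\ne\varepsilon$; for $w\in\{112,122\}$, $\lambda_w=0$ if $g_w=1$ or $\chi_w\ne\varepsilon$; otherwise they are arbitrary. *)

theory Defs
  imports
    "HOL-Algebra.Module"
    "HOL-Algebra.QuotRing"
    "HOL-Library.Poly_Mapping"
    "HOL-Library.Extended_Nat"
begin

text \<open>
  The abelian group \<open>\<Gamma>\<close> is a type \<open>'g\<close> of class \<open>ab_group_add\<close>, hence written additively: its unit is
  \<open>0\<close>, the product \<open>g h\<close> is \<open>g + h\<close>, and the power \<open>g\<^sup>n\<close> is the \<open>n\<close>-fold sum \<open>gpow g n\<close>. The field is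
  a type \<open>'k\<close> of class \<open>field\<close>.
\<close>

definition gpow :: "'g::ab_group_add \<Rightarrow> nat \<Rightarrow> 'g"
  where "gpow h n = (\<Sum>i<n. h)"

definition character :: "('g::ab_group_add \<Rightarrow> 'k::field) \<Rightarrow> bool"
  where "character c \<longleftrightarrow> (\<forall>h. c h \<noteq> 0) \<and> (\<forall>h h'. c (h + h') = c h * c h')"

definition mult_order :: "'k::monoid_mult \<Rightarrow> enat"
  where "mult_order q =
    (if \<exists>n>0. q ^ n = 1 then enat (LEAST n. 0 < n \<and> q ^ n = 1) else \<infinity>)"

datatype letter = L1 | L2

definition wdeg :: "(letter \<Rightarrow> 'g::ab_group_add) \<Rightarrow> letter list \<Rightarrow> 'g"
  where "wdeg g w = (\<Sum>i\<leftarrow>w. g i)"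

definition wchar :: "(letter \<Rightarrow> 'g::ab_group_add \<Rightarrow> 'k::field) \<Rightarrow> letter list \<Rightarrow> 'g \<Rightarrow> 'k"
  where "wchar \<chi> w h = (\<Prod>i\<leftarrow>w. \<chi> i h)"


subsection \<open>The smash product of the free algebra with the group algebra\<close>

text \<open>
  The key \<open>(w, h)\<close> stands for the basis element \<open>w # h\<close> with \<open>w\<close> a word and \<open>h \<in> \<Gamma>\<close>. The product is
  the bilinear extension of \<open>(w # h) (w' # h') = w (h \<cdot> w') # h h' = \<chi>\<^bsub>w'\<^esub>(h) (w w' # h h')\<close>.
\<close>

type_synonym ('g, 'k) smash = "(letter list \<times> 'g) \<Rightarrow>\<^sub>0 'k"

definition smash_mult ::
    "(letter \<Rightarrow> 'g::ab_group_add \<Rightarrow> 'k::field) \<Rightarrow> ('g, 'k) smash \<Rightarrow> ('g, 'k) smash \<Rightarrow> ('g, 'k) smash"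
  where "smash_mult \<chi> a b =
    (\<Sum>(w, h)\<in>Poly_Mapping.keys a. \<Sum>(w', h')\<in>Poly_Mapping.keys b.
      Poly_Mapping.single (w @ w', h + h')
        (Poly_Mapping.lookup a (w, h) * Poly_Mapping.lookup b (w', h') * wchar \<chi> w' h))"

definition smash_alg ::
    "(letter \<Rightarrow> 'g::ab_group_add \<Rightarrow> 'k::field) \<Rightarrow> ('k, ('g, 'k) smash) module"
  where "smash_alg \<chi> =
    \<lparr>carrier = UNIV, mult = smash_mult \<chi>, one = Poly_Mapping.single ([], 0) 1,
     zero = 0, add = (+), smult = (\<lambda>c. Poly_Mapping.map ((*) c))\<rparr>"

lemma smash_mult_superset:
  assumes "finite U" "finite V" "Poly_Mapping.keys a \<subseteq> U" "Poly_Mapping.keys b \<subseteq> V"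
  shows "smash_mult \<chi> a b =
    (\<Sum>(w, h)\<in>U. \<Sum>(w', h')\<in>V. Poly_Mapping.single (w @ w', h + h')
        (Poly_Mapping.lookup a (w, h) * Poly_Mapping.lookup b (w', h') * wchar \<chi> w' h))"
proof -
  have *: "(\<Sum>(w', h')\<in>Poly_Mapping.keys b. Poly_Mapping.single (w @ w', h + h')
        (Poly_Mapping.lookup a (w, h) * Poly_Mapping.lookup b (w', h') * wchar \<chi> w' h)) =
     (\<Sum>(w', h')\<in>V. Poly_Mapping.single (w @ w', h + h')
        (Poly_Mapping.lookup a (w, h) * Poly_Mapping.lookup b (w', h') * wchar \<chi> w' h))" for w h
    by (rule sum.mono_neutral_left) (use assms in \<open>auto simp: in_keys_iff\<close>)
  show ?thesis
    unfolding smash_mult_def *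
    by (rule sum.mono_neutral_left) (use assms in \<open>auto simp: in_keys_iff\<close>)
qed

lemma smash_mult_add_left: "smash_mult \<chi> (a + a') b = smash_mult \<chi> a b + smash_mult \<chi> a' b"
proof -
  let ?U = "Poly_Mapping.keys a \<union> Poly_Mapping.keys a'"
  have "smash_mult \<chi> (a + a') b = (\<Sum>(w, h)\<in>?U. \<Sum>(w', h')\<in>Poly_Mapping.keys b.
      Poly_Mapping.single (w @ w', h + h')
        (Poly_Mapping.lookup (a + a') (w, h) * Poly_Mapping.lookup b (w', h') * wchar \<chi> w' h))"
    by (rule smash_mult_superset) (use Poly_Mapping.keys_add[of a a'] in auto)
  also have "\<dots> = smash_mult \<chi> a b + smash_mult \<chi> a' b"
    by (simp add: smash_mult_superset[of ?U "Poly_Mapping.keys b"] lookup_add algebra_simps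
        case_prod_unfold single_add sum.distrib)
  finally show ?thesis .
qed

lemma smash_mult_add_right: "smash_mult \<chi> a (b + b') = smash_mult \<chi> a b + smash_mult \<chi> a b'"
proof -
  let ?V = "Poly_Mapping.keys b \<union> Poly_Mapping.keys b'"
  have "smash_mult \<chi> a (b + b') = (\<Sum>(w, h)\<in>Poly_Mapping.keys a. \<Sum>(w', h')\<in>?V.
      Poly_Mapping.single (w @ w', h + h')
        (Poly_Mapping.lookup a (w, h) * Poly_Mapping.lookup (b + b') (w', h') * wchar \<chi> w' h))"
    by (rule smash_mult_superset) (use Poly_Mapping.keys_add[of b b'] in auto)
  also have "\<dots> = smash_mult \<chi> a b + smash_mult \<chi> a b'"
    by (simp add: smash_mult_superset[of "Poly_Mapping.keys a" ?V] lookup_add algebra_simps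
        case_prod_unfold single_add sum.distrib)
  finally show ?thesis .
qed

lemma smash_mult_zero [simp]: "smash_mult \<chi> 0 b = 0" "smash_mult \<chi> a 0 = 0"
  by (simp_all add: smash_mult_def)

lemma smash_mult_single:
  "smash_mult \<chi> (Poly_Mapping.single (w, h) c) (Poly_Mapping.single (w', h') d) =
    Poly_Mapping.single (w @ w', h + h') (c * d * wchar \<chi> w' h)"
  by (subst smash_mult_superset[of "{(w, h)}" "{(w', h')}"]) auto

lemma smash_induct [case_names zero single add]:
  assumes "P 0" "\<And>w h c. P (Poly_Mapping.single (w, h) c)" "\<And>a b. P a \<Longrightarrow> P b \<Longrightarrow> P (a + b)"
  shows "P (a :: ('g, 'k::field) smash)"
proof (induction a rule: update_induct)
  case const
  then show ?case by (simp add: assms(1))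
next
  case (update f x b)
  have "Poly_Mapping.update x b f = f + Poly_Mapping.single x b"
    using update by (intro poly_mapping_eqI)
      (auto simp: lookup_update lookup_add lookup_single in_keys_iff when_def)
  then show ?case using assms update by (cases x) auto
qed

lemma character_zero: "character c \<Longrightarrow> c 0 = 1"
  unfolding character_def by (metis add_0 mult_cancel_right1)

lemma wchar_append: "wchar \<chi> (v @ w) h = wchar \<chi> v h * wchar \<chi> w h"
  by (simp add: wchar_def)

lemma wchar_zero:
  assumes "character (\<chi> L1)" "character (\<chi> L2)"
  shows "wchar \<chi> w 0 = 1"
proof -
  have "\<chi> i 0 = 1" for i using assms by (cases i) (auto simp: character_zero)
  then show ?thesis by (induction w) (auto simp: wchar_def)
qed

lemma wchar_add:
  assumes "character (\<chi> L1)" "character (\<chi> L2)"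
  shows "wchar \<chi> w (h + h') = wchar \<chi> w h * wchar \<chi> w h'"
proof -
  have "\<chi> i (h + h') = \<chi> i h * \<chi> i h'" for i using assms by (cases i) (auto simp: character_def)
  then show ?thesis by (induction w) (auto simp: wchar_def)
qed

lemma smash_mult_assoc:
  assumes "character (\<chi> L1)" "character (\<chi> L2)"
  shows "smash_mult \<chi> (smash_mult \<chi> a b) c = smash_mult \<chi> a (smash_mult \<chi> b c)"
proof (induction a rule: smash_induct)
  case (single w h x)
  show ?case
  proof (induction b rule: smash_induct)
    case (single w' h' y)
    show ?case
      by (induction c rule: smash_induct)
        (simp_all add: smash_mult_single smash_mult_add_right wchar_append wchar_add[OF assms]
          add.assoc mult_ac)
  qed (simp_all add: smash_mult_add_left smash_mult_add_right)
qed (simp_all add: smash_mult_add_left)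

lemma smash_mult_one:
  assumes "character (\<chi> L1)" "character (\<chi> L2)"
  shows "smash_mult \<chi> (Poly_Mapping.single ([], 0) 1) a = a"
    and "smash_mult \<chi> a (Poly_Mapping.single ([], 0) 1) = a"
proof -
  show "smash_mult \<chi> (Poly_Mapping.single ([], 0) 1) a = a"
    by (induction a rule: smash_induct)
      (simp_all add: smash_mult_single smash_mult_add_right wchar_zero[OF assms])
  show "smash_mult \<chi> a (Poly_Mapping.single ([], 0) 1) = a"
    by (induction a rule: smash_induct)
      (simp_all add: smash_mult_single smash_mult_add_left wchar_def)
qed

lemma ring_smash_alg:
  assumes "character (\<chi> L1)" "character (\<chi> L2)"
  shows "ring (smash_alg \<chi>)"
proof (rule ringI)
  show "abelian_group (smash_alg \<chi>)"
  proof (rule abelian_groupI)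
    fix x assume "x \<in> carrier (smash_alg \<chi>)"
    show "\<exists>y\<in>carrier (smash_alg \<chi>). y \<oplus>\<^bsub>smash_alg \<chi>\<^esub> x = \<zero>\<^bsub>smash_alg \<chi>\<^esub>"
      by (rule bexI[of _ "- x"]) (auto simp: smash_alg_def)
  qed (auto simp: smash_alg_def add_ac)
  show "Group.monoid (smash_alg \<chi>)"
    by (rule monoidI)
      (simp_all add: smash_alg_def smash_mult_one[OF assms] smash_mult_assoc[OF assms])
qed (simp_all add: smash_alg_def smash_mult_add_left smash_mult_add_right)

definition var :: "letter \<Rightarrow> ('g::ab_group_add, 'k::field) smash"
  where "var i = Poly_Mapping.single ([i], 0) 1"

definition grp :: "'g::ab_group_add \<Rightarrow> ('g, 'k::field) smash"
  where "grp h = Poly_Mapping.single ([], h) 1"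


subsection \<open>Quotient algebras and bases\<close>

text \<open>The quotient ring of the library, equipped with the induced scalar multiplication.\<close>

definition quot_algebra :: "('k, 'a, 'm) module_scheme \<Rightarrow> 'a set \<Rightarrow> ('k, 'a set) module"
  where "quot_algebra A I =
    \<lparr>carrier = carrier (A Quot I), mult = mult (A Quot I), one = one (A Quot I),
     zero = zero (A Quot I), add = add (A Quot I),
     smult = (\<lambda>c X. \<Union>x\<in>X. I +>\<^bsub>A\<^esub> (c \<odot>\<^bsub>A\<^esub> x))\<rparr>"

lemma smult_smash_alg:
  assumes "character (\<chi> L1)" "character (\<chi> L2)"
  shows "c \<odot>\<^bsub>smash_alg \<chi>\<^esub> a = smash_mult \<chi> (Poly_Mapping.single ([], 0) c) a"
proof -
  have map_add: "Poly_Mapping.map ((*) c) (a + b) =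
      Poly_Mapping.map ((*) c) a + Poly_Mapping.map ((*) c) b" for a b :: "('a, 'b) smash"
    by (intro poly_mapping_eqI) (simp add: lookup_add Poly_Mapping.map.rep_eq when_def
      flip: distrib_left)
  show ?thesis
    by (induction a rule: smash_induct)
      (simp_all add: smash_alg_def smash_mult_single smash_mult_add_right map_add map_eq_zero_iff
        wchar_zero[OF assms])
qed

lemma smult_quot_algebra:
  assumes "character (\<chi> L1)" "character (\<chi> L2)" "ideal I (smash_alg \<chi>)"
  shows "c \<odot>\<^bsub>quot_algebra (smash_alg \<chi>) I\<^esub> (I +>\<^bsub>smash_alg \<chi>\<^esub> a) =
    I +>\<^bsub>smash_alg \<chi>\<^esub> (c \<odot>\<^bsub>smash_alg \<chi>\<^esub> a)"
proof -
  interpret ideal I "smash_alg \<chi>" by fact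
  have carr: "x \<in> carrier (smash_alg \<chi>)" for x by (simp add: smash_alg_def)
  have smult: "c \<odot>\<^bsub>smash_alg \<chi>\<^esub> x = Poly_Mapping.single ([], 0) c \<otimes>\<^bsub>smash_alg \<chi>\<^esub> x" for x
    unfolding smult_smash_alg[OF assms(1,2)] by (simp add: smash_alg_def)
  have eq: "I +>\<^bsub>smash_alg \<chi>\<^esub> (c \<odot>\<^bsub>smash_alg \<chi>\<^esub> x) = I +>\<^bsub>smash_alg \<chi>\<^esub> (c \<odot>\<^bsub>smash_alg \<chi>\<^esub> a)"
    if "x \<in> I +>\<^bsub>smash_alg \<chi>\<^esub> a" for x
  proof (rule a_repr_independence[symmetric])
    from that obtain i where i: "i \<in> I" "x = i \<oplus>\<^bsub>smash_alg \<chi>\<^esub> a"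
      by (auto simp: a_r_coset_def')
    then show "c \<odot>\<^bsub>smash_alg \<chi>\<^esub> x \<in> I +>\<^bsub>smash_alg \<chi>\<^esub> (c \<odot>\<^bsub>smash_alg \<chi>\<^esub> a)"
      unfolding smult by (auto simp: a_r_coset_def' r_distr carr I_l_closed)
  qed (simp_all add: carr a_subgroup)
  have "I +>\<^bsub>smash_alg \<chi>\<^esub> a \<noteq> {}"
    using a_rcos_self[OF carr, of a] by blast
  then show ?thesis
    unfolding quot_algebra_def module.simps using eq by (rule SUP_eq_const)
qed

text \<open>Finitely supported coefficient families are elements of \<open>'i \<Rightarrow>\<^sub>0 'k\<close>.\<close>

definition lin_comb :: "('k::field, 'v, 'm) module_scheme \<Rightarrow> ('i \<Rightarrow> 'v) \<Rightarrow> ('i \<Rightarrow>\<^sub>0 'k) \<Rightarrow> 'v"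
  where "lin_comb M b c =
    (\<Oplus>\<^bsub>M\<^esub>i\<in>Poly_Mapping.keys c. Poly_Mapping.lookup c i \<odot>\<^bsub>M\<^esub> b i)"

definition is_basis :: "('k::field, 'v, 'm) module_scheme \<Rightarrow> 'i set \<Rightarrow> ('i \<Rightarrow> 'v) \<Rightarrow> bool"
  where "is_basis M J b \<longleftrightarrow>
    b \<in> J \<rightarrow> carrier M \<and>
    (\<forall>v\<in>carrier M. \<exists>c. Poly_Mapping.keys c \<subseteq> J \<and> lin_comb M b c = v) \<and>
    (\<forall>c. Poly_Mapping.keys c \<subseteq> J \<and> lin_comb M b c = \<zero>\<^bsub>M\<^esub> \<longrightarrow> c = 0)"


subsection \<open>The defining relations\<close>

context
  fixes g :: "letter \<Rightarrow> 'g::ab_group_add"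
    and \<chi> :: "letter \<Rightarrow> 'g \<Rightarrow> 'k::field"
begin

definition braiding :: "letter \<Rightarrow> letter \<Rightarrow> 'k"
  where "braiding i j = \<chi> j (g i)"

private abbreviation (input) "q \<equiv> braiding"

text \<open>\<open>N\<^sub>w\<close> is the order of \<open>\<chi>\<^sub>w(g\<^sub>w)\<close>.\<close>

definition word_order :: "letter list \<Rightarrow> enat"
  where "word_order w = mult_order (wchar \<chi> w (wdeg g w))"

text \<open>The constraint on the coefficient \<open>\<mu>\<^sub>w\<close>; it is void if \<open>N\<^sub>w = \<infinity>\<close>.\<close>

definition mu_admissible :: "letter list \<Rightarrow> 'k \<Rightarrow> bool"
  where "mu_admissible w \<mu> \<longleftrightarrow>
    (\<forall>n. word_order w = enat n \<longrightarrow>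
      gpow (wdeg g w) n = 0 \<or> \<not> (\<forall>h. wchar \<chi> w h ^ n = 1) \<longrightarrow> \<mu> = 0)"

definition la_admissible :: "letter list \<Rightarrow> 'k \<Rightarrow> bool"
  where "la_admissible w la \<longleftrightarrow>
    (wdeg g w = 0 \<or> \<not> (\<forall>h. wchar \<chi> w h = 1) \<longrightarrow> la = 0)"

private abbreviation (input) A :: "('k, ('g, 'k) smash) module"
  where "A \<equiv> smash_alg \<chi>"

definition qcomm :: "'k \<Rightarrow> ('g, 'k) smash \<Rightarrow> ('g, 'k) smash \<Rightarrow> ('g, 'k) smash"
  where "qcomm c a b = a \<otimes>\<^bsub>A\<^esub> b - c \<odot>\<^bsub>A\<^esub> (b \<otimes>\<^bsub>A\<^esub> a)"

private abbreviation (input) x1 :: "('g, 'k) smash" where "x1 \<equiv> var L1"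
private abbreviation (input) x2 :: "('g, 'k) smash" where "x2 \<equiv> var L2"

definition x12 :: "('g, 'k) smash"
  where "x12 = qcomm (q L1 L2) x1 x2"

definition x112 :: "('g, 'k) smash"
  where "x112 = qcomm (q L1 L1 * q L1 L2) x1 x12"

definition x122 :: "('g, 'k) smash"
  where "x122 = qcomm (q L1 L2 * q L2 L2) x12 x2"

text \<open>\<open>dpow w n\<close> is \<open>1 - g\<^sub>w\<^sup>n\<close>.\<close>

definition dpow :: "letter list \<Rightarrow> nat \<Rightarrow> ('g, 'k) smash"
  where "dpow w n = \<one>\<^bsub>A\<^esub> - grp (gpow (wdeg g w) n)"

text \<open>
  \<open>lifting_relations \<mu>1 \<mu>2 \<mu>12 la112 la122 S\<close> states that the braiding matrix falls under one
  of the cases and that \<open>S\<close> is the set of generators of the ideal in that case. Sets of the form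
  \<open>{r n | n. N = enat n}\<close> are empty if \<open>N = \<infinity>\<close>: a generator with an infinite power is omitted.
\<close>

inductive lifting_relations ::
    "'k \<Rightarrow> 'k \<Rightarrow> 'k \<Rightarrow> 'k \<Rightarrow> 'k \<Rightarrow> ('g, 'k) smash set \<Rightarrow> bool"
  for \<mu>1 \<mu>2 \<mu>12 la112 la122 :: 'k
  where
    case_1a:
      "\<lbrakk> q L1 L2 * q L2 L1 = inverse (q L1 L1); inverse (q L1 L1) = inverse (q L2 L2);
         q L1 L1 = -1 \<rbrakk>
       \<Longrightarrow> lifting_relations \<mu>1 \<mu>2 \<mu>12 la112 la122
         { x1 [^]\<^bsub>A\<^esub> (2::nat) - \<mu>1 \<odot>\<^bsub>A\<^esub> dpow [L1] 2,
           x12 [^]\<^bsub>A\<^esub> (2::nat) - (4 * \<mu>1 * q L2 L1) \<odot>\<^bsub>A\<^esub> (x2 [^]\<^bsub>A\<^esub> (2::nat))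
             - \<mu>12 \<odot>\<^bsub>A\<^esub> dpow [L1, L2] 2,
           x2 [^]\<^bsub>A\<^esub> (2::nat) - \<mu>2 \<odot>\<^bsub>A\<^esub> dpow [L2] 2 }"
  | case_1b:
      "\<lbrakk> q L1 L2 * q L2 L1 = inverse (q L1 L1); inverse (q L1 L1) = inverse (q L2 L2);
         mult_order (q L1 L1) = 3 \<rbrakk>
       \<Longrightarrow> lifting_relations \<mu>1 \<mu>2 \<mu>12 la112 la122
         { x112 - la112 \<odot>\<^bsub>A\<^esub> dpow [L1, L1, L2] 1,
           x122 - la122 \<odot>\<^bsub>A\<^esub> dpow [L1, L2, L2] 1,
           x1 [^]\<^bsub>A\<^esub> (3::nat) - \<mu>1 \<odot>\<^bsub>A\<^esub> dpow [L1] 3,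
           x12 [^]\<^bsub>A\<^esub> (3::nat) + ((1 - q L1 L1) * q L1 L1 * la112) \<odot>\<^bsub>A\<^esub> x122
             - (\<mu>1 * (1 - q L1 L1) ^ 3) \<odot>\<^bsub>A\<^esub> (x2 [^]\<^bsub>A\<^esub> (3::nat))
             - \<mu>12 \<odot>\<^bsub>A\<^esub> dpow [L1, L2] 3,
           x2 [^]\<^bsub>A\<^esub> (3::nat) - \<mu>2 \<odot>\<^bsub>A\<^esub> dpow [L2] 3 }"
  | case_1c:
      "\<lbrakk> q L1 L2 * q L2 L1 = inverse (q L1 L1); inverse (q L1 L1) = inverse (q L2 L2);
         N = mult_order (q L1 L1); 4 \<le> N \<rbrakk>
       \<Longrightarrow> lifting_relations \<mu>1 \<mu>2 \<mu>12 la112 la122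
         ({ x112, x122 }
           \<union> { x1 [^]\<^bsub>A\<^esub> n - \<mu>1 \<odot>\<^bsub>A\<^esub> dpow [L1] n | n::nat. N = enat n }
           \<union> { x12 [^]\<^bsub>A\<^esub> n
                 - (\<mu>1 * (q L1 L1 - 1) ^ n * q L2 L1 ^ (n * (n - 1) div 2)) \<odot>\<^bsub>A\<^esub> (x2 [^]\<^bsub>A\<^esub> n)
                 - \<mu>12 \<odot>\<^bsub>A\<^esub> dpow [L1, L2] n | n::nat. N = enat n }
           \<union> { x2 [^]\<^bsub>A\<^esub> n - \<mu>2 \<odot>\<^bsub>A\<^esub> dpow [L2] n | n::nat. N = enat n })"
  | case_2a:
      "\<lbrakk> q L1 L2 * q L2 L1 = inverse (q L1 L1); q L2 L2 = -1;
         N = mult_order (q L1 L1); N \<noteq> 4; 3 \<le> N \<rbrakk>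
       \<Longrightarrow> lifting_relations \<mu>1 \<mu>2 \<mu>12 la112 la122
         ({ x112 }
           \<union> { x1 [^]\<^bsub>A\<^esub> n - \<mu>1 \<odot>\<^bsub>A\<^esub> dpow [L1] n | n::nat. N = enat n }
           \<union> { x2 [^]\<^bsub>A\<^esub> (2::nat) - \<mu>2 \<odot>\<^bsub>A\<^esub> dpow [L2] 2 })"
  | case_2b:
      "\<lbrakk> q L1 L2 * q L2 L1 = inverse (q L1 L1); q L2 L2 = -1;
         mult_order (q L1 L1) = 4 \<rbrakk>
       \<Longrightarrow> lifting_relations \<mu>1 \<mu>2 \<mu>12 la112 la122
         { x112 - la112 \<odot>\<^bsub>A\<^esub> dpow [L1, L1, L2] 1,
           x1 [^]\<^bsub>A\<^esub> (4::nat) - \<mu>1 \<odot>\<^bsub>A\<^esub> dpow [L1] 4,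
           x2 [^]\<^bsub>A\<^esub> (2::nat) - \<mu>2 \<odot>\<^bsub>A\<^esub> dpow [L2] 2 }"
  | case_3a:
      "\<lbrakk> q L1 L1 = -1; q L1 L2 * q L2 L1 = inverse (q L2 L2);
         N = mult_order (q L2 L2); N \<noteq> 4; 3 \<le> N \<rbrakk>
       \<Longrightarrow> lifting_relations \<mu>1 \<mu>2 \<mu>12 la112 la122
         ({ x122 }
           \<union> { x1 [^]\<^bsub>A\<^esub> (2::nat) - \<mu>1 \<odot>\<^bsub>A\<^esub> dpow [L1] 2 }
           \<union> { x2 [^]\<^bsub>A\<^esub> n - \<mu>2 \<odot>\<^bsub>A\<^esub> dpow [L2] n | n::nat. N = enat n })"
  | case_3b:
      "\<lbrakk> q L1 L1 = -1; q L1 L2 * q L2 L1 = inverse (q L2 L2);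
         mult_order (q L2 L2) = 4 \<rbrakk>
       \<Longrightarrow> lifting_relations \<mu>1 \<mu>2 \<mu>12 la112 la122
         { x122 - la122 \<odot>\<^bsub>A\<^esub> dpow [L1, L2, L2] 1,
           x1 [^]\<^bsub>A\<^esub> (2::nat) - \<mu>1 \<odot>\<^bsub>A\<^esub> dpow [L1] 2,
           x2 [^]\<^bsub>A\<^esub> (4::nat) - \<mu>2 \<odot>\<^bsub>A\<^esub> dpow [L2] 4 }"
  | case_4a:
      "\<lbrakk> q L1 L1 = -1; q L2 L2 = -1; N = mult_order (q L1 L2 * q L2 L1); 3 \<le> N;
         q L1 L2 \<noteq> 1; q L1 L2 \<noteq> -1 \<rbrakk>
       \<Longrightarrow> lifting_relations \<mu>1 \<mu>2 \<mu>12 la112 la122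
         ({ x1 [^]\<^bsub>A\<^esub> (2::nat) - \<mu>1 \<odot>\<^bsub>A\<^esub> dpow [L1] 2 }
           \<union> { x12 [^]\<^bsub>A\<^esub> n - \<mu>12 \<odot>\<^bsub>A\<^esub> dpow [L1, L2] n | n::nat. N = enat n }
           \<union> { x2 [^]\<^bsub>A\<^esub> (2::nat) })"
  | case_4b:
      "\<lbrakk> q L1 L1 = -1; q L2 L2 = -1; N = mult_order (q L1 L2 * q L2 L1); 3 \<le> N;
         q L1 L2 = 1 \<or> q L1 L2 = -1 \<rbrakk>
       \<Longrightarrow> lifting_relations \<mu>1 \<mu>2 \<mu>12 la112 la122
         ({ x1 [^]\<^bsub>A\<^esub> (2::nat) }
           \<union> { x12 [^]\<^bsub>A\<^esub> n - \<mu>12 \<odot>\<^bsub>A\<^esub> dpow [L1, L2] n | n::nat. N = enat n }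
           \<union> { x2 [^]\<^bsub>A\<^esub> (2::nat) - \<mu>2 \<odot>\<^bsub>A\<^esub> dpow [L2] 2 })"

end

end

theory Submission
  imports Defs "HOL-Library.Function_Algebras" "HOL-Library.Product_Plus"
begin

text \<open>
  Spanning: modulo shorter words \<open>x\<^sub>1\<^sub>2\<close> \<open>q\<close>-commutes with \<open>x\<^sub>1\<close> and \<open>x\<^sub>2\<close>, and the \<open>N\<^sub>u\<close>-th power of
  \<open>x\<^sub>u\<close> vanishes, so left multiplication by a letter preserves the span of the ordered monomials. In cases (2) and (3)
  the needed relation for \<open>x\<^sub>1\<^sub>2\<^sup>2\<close> is not among the generators; it comes from the two ways of reordering \<open>x\<^sub>1x\<^sub>1\<^sub>2x\<^sub>2\<close>.

  Independence: the algebra acts on a module over the group algebra whose coordinates separate the images of a fixed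
  vector under the ordered monomials. The module is built by adjoining \<open>x\<^sub>1\<close>, then \<open>x\<^sub>1\<^sub>2\<close>, then \<open>x\<^sub>2\<close>, the letters acting as operators
  semilinear over the characters. The \<open>N\<close>-th power of a letter commutes with the adjoined variable up to a unit,
  because \<open>q\<close>-numbers vanish at roots of unity, so it is determined by few values. The admissibility of the coefficients
  makes \<open>\<mu>\<^sub>u (1 - g\<^sub>u\<^bsup>N\<^esup>)\<close> and \<open>\<lambda>\<^sub>w (1 - g\<^sub>w)\<close> central in the action. Cases (3) and (4a) are
  the mirror images of (2) and (4b): read right multiplication as left multiplication.
\<close>

text \<open>The coefficients \<mu>(1 - g^N) and \<lambda>(1 - g) are elements of the group algebra,
  not numbers, so the models are free over the whole group algebra and a letter can only be
  semilinear. What separates the cases is how far \<open>x12\<close> can be treated before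
  \<open>x2\<close> is present. In (1), once the other relations are substituted, the N-th power of
  \<open>x12\<close> is an element of the group algebra, so the letters are adjoined one at a time.
  In (4), \<open>x12 x2 + p x2 x12\<close> (with \<open>p\<close> = q12) is a multiple of
  \<open>x1\<close> rather than a scalar, so \<open>x2\<close> is adjoined by triangular matrices
  over the module that carries \<open>x1\<close> and \<open>x12\<close>. In (2), the square of
  \<open>x12\<close> contains \<open>x2\<close> itself, so both are adjoined at once, with constants
  dictated by comparing coefficients in the overlaps. The mirror image goes through right
  multiplication because exchanging the letters would turn \<open>x12\<close> into x2 x1 - q21 x1
  x2, which is not a multiple of \<open>x12\<close>; reversing products keeps the element and makes
  it a commutator of x2 with x1.\<close>

abbreviation "single \<equiv> Poly_Mapping.single"
abbreviation "lookup \<equiv> Poly_Mapping.lookup"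
abbreviation "keys \<equiv> Poly_Mapping.keys"

section \<open>Arithmetic of the smash product\<close>

locale smash =
  fixes \<chi> :: "letter \<Rightarrow> 'g::ab_group_add \<Rightarrow> 'k::field"
  assumes char1: "character (\<chi> L1)" and char2: "character (\<chi> L2)"
begin

abbreviation mul :: "('g, 'k) smash \<Rightarrow> ('g, 'k) smash \<Rightarrow> ('g, 'k) smash"  (infixl \<open>\<star>\<close> 70)
  where "a \<star> b \<equiv> smash_mult \<chi> a b"

abbreviation A :: "('k, ('g, 'k) smash) module"
  where "A \<equiv> smash_alg \<chi>"

abbreviation pow :: "('g, 'k) smash \<Rightarrow> nat \<Rightarrow> ('g, 'k) smash"  (infixr \<open>\<up>\<close> 80)
  where "a \<up> n \<equiv> a [^]\<^bsub>A\<^esub> n"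

abbreviation pbw_basis :: "('g, 'k) smash set \<Rightarrow> ('g, 'k) smash \<Rightarrow> enat \<Rightarrow> enat \<Rightarrow> enat \<Rightarrow> bool"
  where "pbw_basis I y N1 N12 N2 \<equiv>
    is_basis (quot_algebra A I) {(a, b, c, h). enat c < N1 \<and> enat b < N12 \<and> enat a < N2}
      (\<lambda>(a, b, c, h). I +>\<^bsub>A\<^esub> (var L2 \<up> a \<star> y \<up> b \<star> var L1 \<up> c \<star> grp h))"

definition sc :: "'k \<Rightarrow> ('g, 'k) smash"
  where "sc c = single ([], 0) c"

lemmas mul_add = smash_mult_add_left smash_mult_add_right

lemma mul_assoc: "a \<star> b \<star> c = a \<star> (b \<star> c)"
  by (rule smash_mult_assoc[OF char1 char2])

lemma mul_minus: "(- a) \<star> b = - (a \<star> b)" "a \<star> (- b) = - (a \<star> b)"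
proof -
  have "(- a) \<star> b + a \<star> b = 0" "a \<star> (- b) + a \<star> b = 0"
    by (simp_all flip: mul_add)
  then show "(- a) \<star> b = - (a \<star> b)" "a \<star> (- b) = - (a \<star> b)"
    by (simp_all add: eq_neg_iff_add_eq_0)
qed

lemma mul_diff: "(a - a') \<star> b = a \<star> b - a' \<star> b" "a \<star> (b - b') = a \<star> b - a \<star> b'"
  using mul_add(1)[of \<chi> a "- a'" b] mul_add(2)[of \<chi> a b "- b'"] by (simp_all add: mul_minus)

lemma chi_zero: "\<chi> i 0 = 1"
  using char1 char2 by (cases i) (auto simp: character_zero)

lemma chi_add: "\<chi> i (h + h') = \<chi> i h * \<chi> i h'"
  using char1 char2 by (cases i) (auto simp: character_def)

lemma chi_nonzero: "\<chi> i h \<noteq> 0"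
  using char1 char2 by (cases i) (auto simp: character_def)

lemma sc_1_mul [simp]: "sc 1 \<star> a = a" "a \<star> sc 1 = a"
  unfolding sc_def by (rule smash_mult_one[OF char1 char2])+

lemma sc_single: "sc c \<star> single (w, h) r = single (w, h) (c * r)"
  by (simp add: sc_def smash_mult_single wchar_zero[OF char1 char2])

lemma sc_mul_sc: "sc c \<star> sc d = sc (c * d)"
  unfolding sc_single[of c "[]" 0 d, folded sc_def] ..

lemma sc_0 [simp]: "sc 0 = 0"
  by (simp add: sc_def)

lemma sc_add: "sc (c + d) = sc c + sc d"
  by (simp add: sc_def single_add)

lemma sc_minus: "sc (- c) = - sc c"
  by (simp add: sc_def single_uminus)

lemma sc_central: "a \<star> sc c = sc c \<star> a"
  by (induction a rule: smash_induct)
    (simp_all add: mul_add sc_single, simp add: sc_def smash_mult_single wchar_def mult.commute)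

definition scl :: "'k \<Rightarrow> ('g, 'k) smash \<Rightarrow> ('g, 'k) smash"  (infixr \<open>\<cdot>\<close> 75)
  where "c \<cdot> a = sc c \<star> a"

lemma scl_single: "c \<cdot> single (w, h) r = single (w, h) (c * r)"
  by (simp add: scl_def sc_single)

lemma scl_mul [simp]: "(c \<cdot> a) \<star> b = c \<cdot> (a \<star> b)" "a \<star> (c \<cdot> b) = c \<cdot> (a \<star> b)"
  unfolding scl_def by (metis mul_assoc sc_central)+

lemma scl_scl [simp]: "c \<cdot> d \<cdot> a = (c * d) \<cdot> a"
  by (simp add: scl_def sc_mul_sc flip: mul_assoc)

lemma scl_1 [simp]: "1 \<cdot> a = a" "0 \<cdot> a = 0" "c \<cdot> 0 = 0"
  by (simp_all add: scl_def)

lemma scl_left: "(c + d) \<cdot> a = c \<cdot> a + d \<cdot> a" "(c - d) \<cdot> a = c \<cdot> a - d \<cdot> a"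
  "(- c) \<cdot> a = - (c \<cdot> a)"
  using sc_add[of c "- d"] by (simp_all add: scl_def sc_add mul_add sc_minus mul_minus mul_diff)

lemma scl_right: "c \<cdot> (a + b) = c \<cdot> a + c \<cdot> b" "c \<cdot> (a - b) = c \<cdot> a - c \<cdot> b"
  "c \<cdot> (- a) = - (c \<cdot> a)"
  by (simp_all add: scl_def mul_add mul_diff mul_minus)

lemma ring_A: "Ring.ring A"
  by (rule ring_smash_alg[OF char1 char2])

lemma A_simps [simp]:
  "carrier A = UNIV" "a \<otimes>\<^bsub>A\<^esub> b = a \<star> b" "a \<oplus>\<^bsub>A\<^esub> b = a + b" "\<zero>\<^bsub>A\<^esub> = 0"
  "\<one>\<^bsub>A\<^esub> = sc 1"
  by (simp_all add: smash_alg_def sc_def)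

lemma A_smult [simp]: "c \<odot>\<^bsub>A\<^esub> a = c \<cdot> a"
  unfolding scl_def sc_def by (rule smult_smash_alg[OF char1 char2])

lemma A_pow_Suc: "a \<up> (Suc n) = a \<up> n \<star> a"
  by (simp add: nat_pow_def)

lemma A_pow_Suc2: "a \<up> (Suc n) = a \<star> a \<up> n"
  by (induction n) (simp_all add: A_pow_Suc mul_assoc)

lemma A_pow_numerals:
  "a \<up> 2 = a \<star> a"
  by (simp add: A_pow_Suc numeral_2_eq_2)

end

section \<open>Spanning\<close>

locale smash_ideal = smash \<chi> for \<chi> :: "letter \<Rightarrow> 'g::ab_group_add \<Rightarrow> 'k::field" +
  fixes I
  assumes ideal_I: "ideal I (smash_alg \<chi>)"
begin

lemma I_zero: "0 \<in> I"
  and I_add: "a \<in> I \<Longrightarrow> b \<in> I \<Longrightarrow> a + b \<in> I"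
  and I_mul_left: "a \<in> I \<Longrightarrow> b \<star> a \<in> I"
  and I_mul_right: "a \<in> I \<Longrightarrow> a \<star> b \<in> I"
proof -
  interpret ideal I A by (fact ideal_I)
  show "0 \<in> I" using additive_subgroup.zero_closed[OF additive_subgroup_axioms] by simp
  show "a + b \<in> I" if "a \<in> I" "b \<in> I" using additive_subgroup.a_closed[OF additive_subgroup_axioms that] by simp
  show "b \<star> a \<in> I" if "a \<in> I" using I_l_closed[OF that, of b] by simp
  show "a \<star> b \<in> I" if "a \<in> I" using I_r_closed[OF that, of b] by simp
qed

lemma I_scl: "a \<in> I \<Longrightarrow> c \<cdot> a \<in> I"
  unfolding scl_def by (rule I_mul_left)

lemma I_minus: "a \<in> I \<Longrightarrow> - a \<in> I"
  using I_scl[of a "-1"] by (simp add: scl_left)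

text \<open>Filtration by word length, with group elements in degree 0. The rule
  \<open>Fil_I\<close> builds congruence modulo \<open>I\<close> into membership, so a relation
  counts as an estimate of the degree.\<close>

inductive_set Fil :: "nat \<Rightarrow> ('g, 'k) smash set" for n where
  Fil_I: "a \<in> I \<Longrightarrow> a \<in> Fil n"
| Fil_single: "length w \<le> n \<Longrightarrow> single (w, h) r \<in> Fil n"
| Fil_add: "a \<in> Fil n \<Longrightarrow> b \<in> Fil n \<Longrightarrow> a + b \<in> Fil n"

lemma Fil_mono: "a \<in> Fil m \<Longrightarrow> m \<le> n \<Longrightarrow> a \<in> Fil n"
  by (induction rule: Fil.induct) (auto intro: Fil.intros)

lemma Fil_mul: assumes "a \<in> Fil m" "b \<in> Fil n" shows "a \<star> b \<in> Fil (m + n)"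
  using assms(1)
proof (induction rule: Fil.induct)
  case (Fil_single w h r)
  show ?case using assms(2)
  proof (induction rule: Fil.induct)
    case (Fil_single w' h' r')
    show ?case unfolding smash_mult_single
      using Fil_single.hyps \<open>length w \<le> m\<close> by (intro Fil.Fil_single) simp
  qed (auto intro: Fil.intros I_mul_left simp: mul_add)
qed (auto intro: Fil.intros I_mul_right simp: mul_add)

lemma Fil_mul_le: "a \<in> Fil m \<Longrightarrow> b \<in> Fil n \<Longrightarrow> m + n \<le> k \<Longrightarrow> a \<star> b \<in> Fil k"
  using Fil_mul Fil_mono by blast

lemma Fil_sc: "sc c \<in> Fil n"
  unfolding sc_def by (rule Fil_single) simp

lemma Fil_zero: "0 \<in> Fil n"
  using Fil_I[OF I_zero] .

lemma Fil_sc_mul: "a \<in> Fil n \<Longrightarrow> c \<cdot> a \<in> Fil n"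
  using Fil_mul[OF Fil_sc[of _ 0]] by (simp add: scl_def)

lemma Fil_minus: "a \<in> Fil n \<Longrightarrow> - a \<in> Fil n"
  using Fil_sc_mul[of a n "-1"] by (simp add: scl_left)

lemma Fil_diff: "a \<in> Fil n \<Longrightarrow> b \<in> Fil n \<Longrightarrow> a - b \<in> Fil n"
  using Fil_add[OF _ Fil_minus] by fastforce

lemma Fil_grp: "grp h \<in> Fil n"
  unfolding grp_def by (rule Fil_single) simp

lemma Fil_var: "1 \<le> n \<Longrightarrow> var i \<in> Fil n"
  unfolding var_def by (rule Fil_single) simp

lemma Fil_pow: "a \<in> Fil m \<Longrightarrow> a \<up> n \<in> Fil (n * m)"
  by (induction n) (auto simp: A_pow_Suc Fil_sc add.commute intro!: Fil_mul_le)

lemma Fil_pow_le: "a \<in> Fil m \<Longrightarrow> n * m \<le> k \<Longrightarrow> a \<up> n \<in> Fil k"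
  using Fil_pow Fil_mono by blast

lemma Fil_cong: "a - b \<in> Fil n \<Longrightarrow> b \<in> Fil n \<Longrightarrow> a \<in> Fil n"
  using Fil_add[of "a - b" n b] by simp

end

text \<open>Here \<open>y\<close> plays the role of \<open>x12\<close> and has weight 2. The errors
  in \<open>x1y\<close> and \<open>yx2\<close> are one degree shorter than the products they
  straighten, and a top power falls at least one below its own degree.\<close>

locale pbw_order = smash_ideal \<chi> I for \<chi> :: "letter \<Rightarrow> 'g::ab_group_add \<Rightarrow> 'k::field" and I +
  fixes y :: "('g, 'k) smash" and p s s' :: 'k and N1 N12 N2 :: enat
  assumes y_eq: "var L1 \<star> var L2 = p \<cdot> (var L2 \<star> var L1) + y"
    and y_Fil: "y \<in> Fil 2"
    and x1y: "var L1 \<star> y - s \<cdot> (y \<star> var L1) \<in> Fil 2"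
    and yx2: "y \<star> var L2 - s' \<cdot> (var L2 \<star> y) \<in> Fil 2"
    and top1: "N1 = enat n \<Longrightarrow> 0 < n \<and> var L1 \<up> n \<in> Fil (n - 1)"
    and top12: "N12 = enat n \<Longrightarrow> 0 < n \<and> y \<up> n \<in> Fil (2 * n - 1)"
    and top2: "N2 = enat n \<Longrightarrow> 0 < n \<and> var L2 \<up> n \<in> Fil (n - 1)"
begin

definition J :: "(nat \<times> nat \<times> nat \<times> 'g) set"
  where "J = {(a, b, c, h). enat c < N1 \<and> enat b < N12 \<and> enat a < N2}"

definition mono :: "nat \<times> nat \<times> nat \<times> 'g \<Rightarrow> ('g, 'k) smash"
  where "mono = (\<lambda>(a, b, c, h). var L2 \<up> a \<star> y \<up> b \<star> var L1 \<up> c \<star> grp h)"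

abbreviation comb :: "(nat \<times> nat \<times> nat \<times> 'g \<Rightarrow>\<^sub>0 'k) \<Rightarrow> ('g, 'k) smash"
  where "comb c \<equiv> \<Sum>j\<in>keys c. lookup c j \<cdot> mono j"

definition wt :: "nat \<times> nat \<times> nat \<times> 'g \<Rightarrow> nat"
  where "wt = (\<lambda>(a, b, c, h). a + 2 * b + c)"

inductive_set sp :: "nat \<Rightarrow> ('g, 'k) smash set" for n where
  sp_I: "a \<in> I \<Longrightarrow> a \<in> sp n"
| sp_mono: "j \<in> J \<Longrightarrow> wt j \<le> n \<Longrightarrow> r \<cdot> mono j \<in> sp n"
| sp_add: "a \<in> sp n \<Longrightarrow> b \<in> sp n \<Longrightarrow> a + b \<in> sp n"

lemma sp_le: "a \<in> sp m \<Longrightarrow> m \<le> n \<Longrightarrow> a \<in> sp n"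
  by (induction rule: sp.induct) (auto intro: sp.intros)

lemma sp_sc: "a \<in> sp n \<Longrightarrow> c \<cdot> a \<in> sp n"
proof (induction rule: sp.induct)
  case (sp_mono j r)
  then show ?case using sp.sp_mono[of j n "c * r"] by simp
qed (auto intro: sp.intros I_scl simp: scl_right)

text \<open>Each passage of x1 over an x2 may produce one \<open>y\<close>, which is then moved to
  the right end. At \<open>a = 0\<close> the truncated exponent \<open>a - 1\<close> would leave a
  stray \<open>y\<close> of too large a degree, hence the clause on \<open>k\<close>.\<close>

lemma x1_pow_x2:
  "\<exists>k. var L1 \<star> var L2 \<up> a - (p ^ a) \<cdot> (var L2 \<up> a \<star> var L1)
     - k \<cdot> (var L2 \<up> (a - 1) \<star> y) \<in> Fil a \<and> (a = 0 \<longrightarrow> k = 0)"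
proof (induction a)
  case 0
  then show ?case by (auto intro!: exI[of _ 0] Fil_zero)
next
  case (Suc a)
  then obtain k where k: "var L1 \<star> var L2 \<up> a - (p ^ a) \<cdot> (var L2 \<up> a \<star> var L1)
     - k \<cdot> (var L2 \<up> (a - 1) \<star> y) \<in> Fil a" (is "?D \<in> _") and k0: "a = 0 \<longrightarrow> k = 0" by blast
  let ?X = "var L2 \<up> a" and ?Y = "var L2 \<up> (a - 1)"
  let ?R = "y \<star> var L2 - s' \<cdot> (var L2 \<star> y)"
  have 1: "?D \<star> var L2 \<in> Fil (Suc a)" by (rule Fil_mul_le[OF k Fil_var[OF order_refl]]) simp
  have 2: "k \<cdot> (?Y \<star> ?R) \<in> Fil (Suc a)"
  proof (cases a)
    case (Suc m)
    have "?Y \<in> Fil (a - 1)" by (rule Fil_pow_le[OF Fil_var[of 1]]) auto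
    from Fil_mul_le[OF this yx2] Suc show ?thesis by (auto intro: Fil_sc_mul)
  qed (use k0 Fil_zero in auto)
  have 3: "(k * d) \<cdot> (?Y \<star> (var L2 \<star> y)) = (k * d) \<cdot> (?X \<star> y)" for d
    using k0 by (cases a) (simp_all add: A_pow_Suc mul_assoc)
  have "var L1 \<star> var L2 \<up> (Suc a) - (p ^ Suc a) \<cdot> (var L2 \<up> (Suc a) \<star> var L1)
     - (p ^ a + s' * k) \<cdot> (?X \<star> y) = ?D \<star> var L2 + k \<cdot> (?Y \<star> ?R)"
    using 3[of s']
    by (simp add: A_pow_Suc mul_add mul_diff mul_assoc y_eq scl_left scl_right
        power_Suc2 algebra_simps del: power_Suc)
  then show ?case using Fil_add[OF 1 2] by (intro exI[of _ "p ^ a + s' * k"]) simp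
qed

lemma x1_pow_y:
  "var L1 \<star> y \<up> b - (s ^ b) \<cdot> (y \<up> b \<star> var L1) \<in> Fil (2 * b)"
proof (induction b)
  case 0
  then show ?case by (simp add: Fil_zero)
next
  case (Suc b)
  let ?Y = "y \<up> b" and ?R = "var L1 \<star> y - s \<cdot> (y \<star> var L1)"
  let ?D = "var L1 \<star> ?Y - (s ^ b) \<cdot> (?Y \<star> var L1)"
  have 1: "?D \<star> y \<in> Fil (2 * Suc b)" by (rule Fil_mul_le[OF Suc y_Fil]) simp
  have 2: "(s ^ b) \<cdot> (?Y \<star> ?R) \<in> Fil (2 * Suc b)"
    by (rule Fil_sc_mul, rule Fil_mul_le[OF Fil_pow[OF y_Fil] x1y]) simp
  have "var L1 \<star> y \<up> (Suc b) - (s ^ Suc b) \<cdot> (y \<up> (Suc b) \<star> var L1)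
     = ?D \<star> y + (s ^ b) \<cdot> (?Y \<star> ?R)"
    by (simp add: A_pow_Suc mul_add mul_diff mul_assoc scl_left scl_right
        power_Suc2 algebra_simps del: power_Suc)
  then show ?case using Fil_add[OF 1 2] by simp
qed

lemma Fil_subset_sp: "Fil n \<subseteq> sp n"
proof (induction n)
  have J0: "(0, 0, 0, h) \<in> J" for h
  proof -
    have "enat 0 < N1" "enat 0 < N12" "enat 0 < N2"
      using top1 top12 top2 by (cases N1; cases N12; cases N2; simp)+
    then show ?thesis by (simp add: J_def)
  qed
  case 0
  show ?case
  proof
    fix a :: "('g, 'k) smash" assume "a \<in> Fil 0"
    then show "a \<in> sp 0"
    proof (induction rule: Fil.induct)
      case (Fil_single w h r)
      have "r \<cdot> mono (0, 0, 0, h) \<in> sp 0" by (rule sp_mono[OF J0]) (simp add: wt_def)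
      then show ?case using Fil_single by (simp add: mono_def grp_def scl_single)
    qed (auto intro: sp.intros)
  qed
next
  case (Suc n)
  have low: "a \<in> sp (Suc n)" if "a \<in> Fil n" for a
    using that Suc sp_le[of a n "Suc n"] by auto
  \<comment> \<open>After reordering, the leading terms are ordered monomials of weight at most n +
    1. All errors lie in \<open>Fil n\<close>, where the induction hypothesis applies through
    \<open>low\<close>; an exponent that reaches its bound also drops the monomial into
    \<open>Fil n\<close>.\<close>
  have main: "var i \<star> mono (a, b, c, h) \<in> sp (Suc n)"
    if j: "(a, b, c, h) \<in> J" and w: "wt (a, b, c, h) \<le> n" for i a b c h
  proof -
    have w: "a + 2 * b + c \<le> n" using w by (simp add: wt_def)
    have J: "enat c < N1" "enat b < N12" "enat a < N2" using j by (auto simp: J_def)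
    note F1 = Fil_pow[OF Fil_var[of 1 L1, simplified], simplified]
    note F2 = Fil_pow[OF Fil_var[of 1 L2, simplified], simplified]
    note Fy = Fil_pow[OF y_Fil]
    note Fg = Fil_grp[of h 0]
    show ?thesis
    proof (cases i)
      case L2
      have eq: "var i \<star> mono (a, b, c, h) = mono (Suc a, b, c, h)"
        unfolding L2 mono_def prod.case A_pow_Suc2[of "var L2"] mul_assoc ..
      show ?thesis
      proof (cases "enat (Suc a) < N2")
        case True
        then have "1 \<cdot> mono (Suc a, b, c, h) \<in> sp (Suc n)"
          using J w by (intro sp_mono) (auto simp: J_def wt_def)
        then show ?thesis by (simp add: eq)
      next
        case False
        with J have "N2 = enat (Suc a)" by (cases N2) auto
        from top2[OF this] have t: "var L2 \<up> (Suc a) \<in> Fil a" by simp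
        have "mono (Suc a, b, c, h) \<in> Fil n"
          unfolding mono_def prod.case
          by (rule Fil_mul_le[OF Fil_mul[OF Fil_mul[OF t Fy] F1] Fg]) (use w in simp)
        then show ?thesis unfolding eq by (rule low)
      qed
    next
      case L1
      obtain k where k: "var L1 \<star> var L2 \<up> a - (p ^ a) \<cdot> (var L2 \<up> a \<star> var L1)
       - k \<cdot> (var L2 \<up> (a - 1) \<star> y) \<in> Fil a" (is "?D \<in> _") and k0: "a = 0 \<longrightarrow> k = 0"
        using x1_pow_x2[of a] by blast
      let ?X = "var L2 \<up> a" and ?Y = "y \<up> b" and ?Z = "var L1 \<up> c \<star> grp h"
      let ?E = "var L1 \<star> ?Y - (s ^ b) \<cdot> (?Y \<star> var L1)"
      have r1: "?D \<star> (?Y \<star> ?Z) \<in> Fil n"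
        by (rule Fil_mul_le[OF k Fil_mul[OF Fy Fil_mul[OF F1 Fg]]]) (use w in simp)
      have r2: "(p ^ a) \<cdot> (?X \<star> (?E \<star> ?Z)) \<in> Fil n"
        by (rule Fil_sc_mul, rule Fil_mul_le[OF F2 Fil_mul[OF x1_pow_y Fil_mul[OF F1 Fg]]])
          (use w in simp)
      have m1: "mono (a, b, Suc c, h) \<in> sp (Suc n)"
      proof (cases "enat (Suc c) < N1")
        case True
        then have "1 \<cdot> mono (a, b, Suc c, h) \<in> sp (Suc n)"
          using J w by (intro sp_mono) (auto simp: J_def wt_def)
        then show ?thesis by simp
      next
        case False
        with J have "N1 = enat (Suc c)" by (cases N1) auto
        from top1[OF this] have t: "var L1 \<up> (Suc c) \<in> Fil c" by simp
        have "mono (a, b, Suc c, h) \<in> Fil n"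
          unfolding mono_def prod.case
          by (rule Fil_mul_le[OF Fil_mul[OF Fil_mul[OF F2 Fy] t] Fg]) (use w in simp)
        then show ?thesis by (rule low)
      qed
      have m2: "k \<cdot> mono (a - 1, Suc b, c, h) \<in> sp (Suc n)"
      proof (cases "a = 0")
        case True
        then show ?thesis using k0 sp_I[OF I_zero] by simp
      next
        case a: False
        then have a': "enat (a - 1) < N2" using J by (cases N2) auto
        show ?thesis
        proof (cases "enat (Suc b) < N12")
          case True
          then show ?thesis using J a' w a by (intro sp_mono) (auto simp: J_def wt_def)
        next
          case False
          with J have "N12 = enat (Suc b)" by (cases N12) auto
          from top12[OF this] have t: "y \<up> (Suc b) \<in> Fil (2 * b + 1)" by simp
          have "mono (a - 1, Suc b, c, h) \<in> Fil n"
            unfolding mono_def prod.case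
            by (rule Fil_mul_le[OF Fil_mul[OF Fil_mul[OF F2 t] F1] Fg]) (use w a in simp)
          then show ?thesis by (intro sp_sc low)
        qed
      qed
      have "var i \<star> mono (a, b, c, h) = ?D \<star> (?Y \<star> ?Z) + (p ^ a) \<cdot> (?X \<star> (?E \<star> ?Z))
         + (p ^ a * s ^ b) \<cdot> mono (a, b, Suc c, h) + k \<cdot> mono (a - 1, Suc b, c, h)"
        unfolding L1 mono_def prod.case A_pow_Suc2[of "var L1"] A_pow_Suc2[of y]
        by (simp add: mul_add mul_diff mul_assoc scl_right)
      then show ?thesis using low[OF r1] low[OF r2] sp_sc[OF m1] m2 by (auto intro: sp_add)
    qed
  qed
  have step: "var i \<star> a \<in> sp (Suc n)" if "a \<in> sp n" for i a
    using that
  proof (induction rule: sp.induct)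
    case (sp_mono j r)
    obtain a b c h where "j = (a, b, c, h)" by (cases j)
    then show ?case using main[of a b c h i] sp_mono by (auto simp: intro: sp_sc)
  qed (auto intro: sp.intros I_mul_left simp: mul_add)
  show ?case
  proof
    fix a :: "('g, 'k) smash" assume "a \<in> Fil (Suc n)"
    then show "a \<in> sp (Suc n)"
    proof (induction rule: Fil.induct)
      case (Fil_single w h r)
      show ?case
      proof (cases w)
        case Nil
        then show ?thesis by (intro low Fil.Fil_single) simp
      next
        case (Cons i w')
        have "single (w', h) r \<in> sp n"
          using Suc Fil_single Cons by (auto intro: Fil.Fil_single)
        from step[OF this, of i] show ?thesis
          by (simp add: Cons var_def smash_mult_single wchar_zero[OF char1 char2])
      qed
    qed (auto intro: sp.intros)
  qed
qed

lemma sp_expand: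
  assumes "a \<in> sp n"
  shows "\<exists>c. keys c \<subseteq> J \<and> a - comb c \<in> I"
  using assms
proof (induction rule: sp.induct)
  case (sp_I a)
  then show ?case by (intro exI[of _ 0]) simp
next
  case (sp_mono j r)
  show ?case using sp_mono I_zero by (intro exI[of _ "single j r"]) auto
next
  case (sp_add a b)
  then obtain c d where cd: "keys c \<subseteq> J" "keys d \<subseteq> J"
    "a - comb c \<in> I"
    "b - comb d \<in> I" by blast
  have "comb (c + d) = comb c + comb d"
    by (rule setsum_keys_plus_distrib) (simp_all add: scl_left)
  then show ?case using cd I_add[OF cd(3,4)] Poly_Mapping.keys_add[of c d]
    by (intro exI[of _ "c + d"]) (auto simp: algebra_simps)
qed

lemma spanning:
  "\<exists>c. keys c \<subseteq> J \<and> a - comb c \<in> I"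
proof -
  have "\<exists>n. a \<in> Fil n"
  proof (induction a rule: smash_induct)
    case (single w h c)
    then show ?case using Fil_single[OF order_refl] by blast
  next
    case (add a b)
    then obtain m n where "a \<in> Fil m" "b \<in> Fil n" by blast
    then have "a \<in> Fil (max m n)" "b \<in> Fil (max m n)" by (auto intro: Fil_mono)
    then show ?case using Fil_add by blast
  qed (use Fil_zero in blast)
  then show ?thesis using Fil_subset_sp sp_expand by blast
qed

end

section \<open>Semilinear operators\<close>

definition ring_endo :: "('r::comm_ring_1 \<Rightarrow> 'r) \<Rightarrow> bool"
  where "ring_endo \<tau> \<longleftrightarrow> \<tau> 1 = 1 \<and> (\<forall>a b. \<tau> (a + b) = \<tau> a + \<tau> b) \<and> (\<forall>a b. \<tau> (a * b) = \<tau> a * \<tau> b)"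

lemma ring_endoD:
  assumes "ring_endo \<tau>"
  shows "\<tau> 1 = 1" "\<tau> (a + b) = \<tau> a + \<tau> b" "\<tau> (a * b) = \<tau> a * \<tau> b" "\<tau> 0 = 0"
    "\<tau> (- a) = - \<tau> a" "\<tau> (a - b) = \<tau> a - \<tau> b" "\<tau> (a ^ n) = \<tau> a ^ n"
    "\<tau> (sum f S) = (\<Sum>i\<in>S. \<tau> (f i))"
proof -
  note d = assms[unfolded ring_endo_def]
  interpret additive \<tau> using d by unfold_locales blast
  show "\<tau> 1 = 1" "\<tau> (a + b) = \<tau> a + \<tau> b" "\<tau> (a * b) = \<tau> a * \<tau> b" using d by blast+
  show "\<tau> 0 = 0" "\<tau> (- a) = - \<tau> a" "\<tau> (a - b) = \<tau> a - \<tau> b" by (fact zero minus diff)+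
  show "\<tau> (a ^ n) = \<tau> a ^ n" using d by (induction n) auto
  show "\<tau> (sum f S) = (\<Sum>i\<in>S. \<tau> (f i))" by (fact sum)
qed

lemma ring_endo_funpow: "ring_endo \<tau> \<Longrightarrow> ring_endo (\<tau> ^^ n)"
  by (induction n) (auto simp: ring_endo_def)

lemma ring_endo_comp: "ring_endo \<tau> \<Longrightarrow> ring_endo \<tau>' \<Longrightarrow> ring_endo (\<lambda>k. \<tau> (\<tau>' k))"
  by (auto simp: ring_endo_def)

lemma funpow_commute: "(\<And>x. f (g x) = g (f x)) \<Longrightarrow> (f ^^ n) (g x) = g ((f ^^ n) x)"
  by (induction n) auto

lemma funpow_fixpoint: "f x = x \<Longrightarrow> (f ^^ n) x = x"
  by (induction n) auto

text \<open>The relation g x = \<chi>(g) x g extended to the group algebra: \<open>\<tau> k\<close>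
  is what the scalar \<open>k\<close> becomes after passing \<open>X\<close> from left to
  right.\<close>

definition semilin :: "('r \<Rightarrow> 'v::ab_group_add \<Rightarrow> 'v) \<Rightarrow> ('r \<Rightarrow> 'r) \<Rightarrow> ('v \<Rightarrow> 'v) \<Rightarrow> bool"
  where "semilin act \<tau> X \<longleftrightarrow> (\<forall>v w. X (v + w) = X v + X w) \<and> (\<forall>k v. act k (X v) = X (act (\<tau> k) v))"

lemma semilinD:
  assumes "semilin act \<tau> X"
  shows "X (v + w) = X v + X w" "act k (X v) = X (act (\<tau> k) v)" "X 0 = 0" "X (- v) = - X v"
    "X (v - w) = X v - X w"
proof -
  note d = assms[unfolded semilin_def]
  interpret additive X using d by unfold_locales blast
  show "X (v + w) = X v + X w" "act k (X v) = X (act (\<tau> k) v)" using d by blast+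
  show "X 0 = 0" "X (- v) = - X v" "X (v - w) = X v - X w" by (fact zero minus diff)+
qed

lemma semilin_pow: "semilin act \<tau> X \<Longrightarrow> semilin act (\<tau> ^^ n) (X ^^ n)"
  by (induction n) (auto simp: semilin_def funpow_swap1)

lemma semilin_comp:
  "semilin act \<tau> X \<Longrightarrow> semilin act \<tau>' Y \<Longrightarrow> semilin act (\<lambda>k. \<tau>' (\<tau> k)) (\<lambda>v. X (Y v))"
  by (auto simp: semilin_def)

lemma semilin_fixed: "semilin act \<tau> X \<Longrightarrow> \<tau> k = k \<Longrightarrow> X (act k v) = act k (X v)"
  by (simp add: semilinD)

text \<open>The q-number (n)_s. In a field it vanishes when \<open>s\<close> is a nontrivial n-th
  root of unity, which is what cuts off the straightening formulas at the end of a block.\<close>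

definition qn :: "'r::comm_ring_1 \<Rightarrow> nat \<Rightarrow> 'r"
  where "qn s n = (\<Sum>i<n. s ^ i)"

lemma qn_simps [simp]: "qn s 0 = 0" "qn s (Suc 0) = 1" and qn_Suc: "qn s (Suc n) = 1 + s * qn s n"
  and qn_Suc': "qn s (Suc n) = qn s n + s ^ n"
proof -
  show "qn s (Suc n) = 1 + s * qn s n"
    unfolding qn_def sum.lessThan_Suc_shift by (simp add: sum_distrib_left)
qed (simp_all add: qn_def)

context module
begin

text \<open>Every passage of a \<open>P\<close> over \<open>Q\<close> leaves a scalar
  \<open>l\<close>, which is carried to the right of the remaining factors \<open>P\<close> and is
  twisted by them. For \<open>n = 0\<close> the sum is empty, so the truncated \<open>n - 1\<close>
  does no harm.\<close>

lemma semilin_funpow_mul: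
  assumes P: "semilin scale \<tau> P" and \<tau>: "ring_endo \<tau>" "\<tau> s = s"
    and PQ: "\<And>v. P (Q v) = scale s (Q (P v)) + scale l v"
  shows "(P ^^ n) (Q v) = scale (s ^ n) (Q ((P ^^ n) v))
    + (P ^^ (n - 1)) (scale (\<Sum>i<n. s ^ i * (\<tau> ^^ i) l) v)"
proof (induction n)
  case (Suc n)
  note [simp] = semilinD(1,3)[OF P] semilinD(1,3)[OF semilin_pow[OF P]]
  have fx: "P (scale (s ^ n) w) = scale (s ^ n) (P w)" for n w
    by (rule semilin_fixed[OF P]) (simp add: ring_endoD[OF \<tau>(1)] \<tau>(2))
  have pull: "scale (s ^ n * l) ((P ^^ n) v) = (P ^^ n) (scale (s ^ n * (\<tau> ^^ n) l) v)"
    using funpow_fixpoint[of \<tau> "s ^ n"] \<tau>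
    by (simp add: semilinD(2)[OF semilin_pow[OF P]] ring_endoD[OF ring_endo_funpow[OF \<tau>(1)]]
        ring_endoD[OF \<tau>(1)])
  have shift: "P ((P ^^ (n - 1)) (scale (\<Sum>i<n. s ^ i * (\<tau> ^^ i) l) v))
      = (P ^^ n) (scale (\<Sum>i<n. s ^ i * (\<tau> ^^ i) l) v)"
    by (cases n) auto
  show ?case
    using Suc pull shift by (simp add: fx PQ scale_right_distrib scale_left_distrib mult.commute)
qed auto

text \<open>Second-order version for a chain of commutators: \<open>R\<close> is the commutator of
  \<open>P\<close> with \<open>Q\<close>, and the scalar \<open>l\<close> that of \<open>P\<close>
  with \<open>R\<close>. The coefficient of \<open>R\<close> is a q-number and so vanishes at
  suitable exponents. The index \<open>j - 1\<close> at \<open>j = 0\<close> is harmless because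
  (0)_q = 0.\<close>

lemma semilin_funpow_mul2:
  assumes P: "semilin scale \<tau> P" and \<tau>: "ring_endo \<tau>" "\<tau> p = p" "\<tau> q = q"
    and PQ: "\<And>v. P (Q v) = scale p (Q (P v)) + R v"
    and PR: "\<And>v. P (R v) = scale (q * p) (R (P v)) + scale l v"
  shows "(P ^^ n) (Q v) = scale (p ^ n) (Q ((P ^^ n) v))
    + scale (p ^ (n - 1) * qn q n) (R ((P ^^ (n - 1)) v))
    + (P ^^ (n - 2)) (scale (\<Sum>j<n. p ^ (j - 1) * qn q j * (\<tau> ^^ (j - 1)) l) v)"
proof (induction n)
  case (Suc n)
  note [simp] = semilinD(1,3)[OF P] semilinD(1,3)[OF semilin_pow[OF P]]
  define m where "m n = (\<Sum>j<n. p ^ (j - 1) * qn q j * (\<tau> ^^ (j - 1)) l)" for n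
  define c where "c n = p ^ (n - 1) * qn q n" for n
  have fp: "(\<tau> ^^ k) (c n) = c n" for n k
    by (rule funpow_fixpoint) (simp add: qn_def c_def ring_endoD[OF \<tau>(1)] \<tau>)
  have fx: "P (scale (p ^ n) w) = scale (p ^ n) (P w)" for n w
    by (rule semilin_fixed[OF P]) (simp add: ring_endoD[OF \<tau>(1)] \<tau>)
  have fc: "P (scale (c n) w) = scale (c n) (P w)" for n w
    by (rule semilin_fixed[OF P]) (use fp[of 1] in simp)
  have pull: "scale (c n * l) ((P ^^ (n - 1)) v) = (P ^^ (n - 1)) (scale (c n * (\<tau> ^^ (n - 1)) l) v)"
    using fp[of "n - 1" n]
    by (simp only: semilinD(2)[OF semilin_pow[OF P]] ring_endoD(3)[OF ring_endo_funpow[OF \<tau>(1)]])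
  have shift: "P ((P ^^ (n - 2)) (scale (m n) v)) = (P ^^ (n - 1)) (scale (m n) v)"
    by (cases n; cases "n - 1") (auto simp: m_def)
  have Rn: "scale (c n) (R (P ((P ^^ (n - 1)) v))) = scale (c n) (R ((P ^^ n) v))"
    by (cases n) (auto simp: c_def)
  have mS: "m (Suc n) = m n + c n * (\<tau> ^^ (n - 1)) l"
    by (simp add: m_def c_def)
  have c: "c (Suc n) = p ^ n + c n * (q * p)"
    unfolding c_def by (cases n) (simp_all add: qn_Suc algebra_simps)
  have "(P ^^ Suc n) (Q v) = scale (p ^ n) (scale p (Q ((P ^^ Suc n) v)) + R ((P ^^ n) v))
      + scale (q * p) (scale (c n) (R (P ((P ^^ (n - 1)) v)))) + scale (c n * l) ((P ^^ (n - 1)) v)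
      + (P ^^ (n - 1)) (scale (m n) v)"
    using Suc[folded m_def c_def] shift by (simp only: funpow.simps o_apply semilinD(1)[OF P] fx fc PQ PR
        scale_right_distrib scale_left_distrib scale_scale mult_ac add_ac)
  also have "\<dots> = scale (p ^ Suc n) (Q ((P ^^ Suc n) v)) + scale (c (Suc n)) (R ((P ^^ n) v))
      + (P ^^ (n - 1)) (scale (m (Suc n)) v)"
    unfolding Rn pull c mS by (simp add: scale_right_distrib scale_left_distrib algebra_simps)
  finally show ?case unfolding m_def c_def by simp
qed auto

end

section \<open>Adjoining variables to a module\<close>

text \<open>
  A function \<open>f\<close> represents \<open>\<Sum>\<^sub>a x\<^sup>a f(a)\<close>. Since the index type cannot depend on \<open>N\<close>, the naturals are read as
  independent blocks of length \<open>N\<close>, and \<open>x\<^sup>N = u\<close> acts inside each block. The value \<open>N = 0\<close> encodes \<open>N = \<infinity>\<close>: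
  as \<open>a mod 0 = a\<close>, there is then one infinite block, and \<open>u = 0\<close>.
\<close>

definition lact :: "('r \<Rightarrow> 'v \<Rightarrow> 'v) \<Rightarrow> ('r \<Rightarrow> 'r) \<Rightarrow> nat \<Rightarrow> 'r \<Rightarrow> (nat \<Rightarrow> 'v) \<Rightarrow> nat \<Rightarrow> 'v"
  where "lact act \<tau> N k f a = act ((\<tau> ^^ (a mod N)) k) (f a)"

text \<open>Multiplication by the adjoined \<open>x\<close>. For \<open>N = 0\<close> the only start
  of a block is position 0, and \<open>u = 0\<close> discards the meaningless value read
  there.\<close>

definition shift :: "('r \<Rightarrow> 'v \<Rightarrow> 'v) \<Rightarrow> nat \<Rightarrow> 'r \<Rightarrow> (nat \<Rightarrow> 'v) \<Rightarrow> nat \<Rightarrow> 'v"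
  where "shift act N u f a = (if a mod N = 0 then act u (f (a + N - 1)) else f (a - 1))"

text \<open>The extension P of \<open>t\<close> with P x = s x P + z: it sends x^n v to s^n x^n (t
  v) + (n)_s z x^(n-1) v. At the end of a block the formula reads the next block, but with the
  coefficient (N)_s z, which is assumed to be zero wherever this matters.\<close>

definition down :: "('r::comm_ring_1 \<Rightarrow> 'v::ab_group_add \<Rightarrow> 'v) \<Rightarrow> nat \<Rightarrow> 'r \<Rightarrow> 'r \<Rightarrow> ('v \<Rightarrow> 'v) \<Rightarrow> (nat \<Rightarrow> 'v) \<Rightarrow> nat \<Rightarrow> 'v"
  where "down act N s z t f a = act (s ^ (a mod N)) (t (f a)) + act (qn s (Suc (a mod N)) * z) (f (Suc a))"

lemma mod_cases:
  fixes N :: nat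
  assumes "N \<noteq> 1"
  obtains (top) "N > 0" "Suc (a mod N) = N" "Suc a mod N = 0"
  | (inner) "Suc (a mod N) \<noteq> N" "Suc a mod N = Suc (a mod N)"
proof (cases "Suc (a mod N) = N")
  case True
  then show ?thesis by (intro top) (auto simp: mod_Suc)
next
  case False
  then show ?thesis by (intro inner) (auto simp: mod_Suc)
qed

text \<open>The conditions on \<open>u\<close> are forced by x^N = u: \<open>u_fix\<close> because x
  commutes with its own power, \<open>u_central\<close> because k x^N = x^N \<tau>^N(k).\<close>

locale line = module act for act :: "'r::comm_ring_1 \<Rightarrow> 'v::ab_group_add \<Rightarrow> 'v"  (infixr \<open>\<bullet>\<close> 75) +
  fixes \<tau> :: "'r \<Rightarrow> 'r" and N :: nat and u :: 'r
  assumes endo: "ring_endo \<tau>" and N1: "N \<noteq> 1" and u0: "N = 0 \<Longrightarrow> u = 0" and u_fix: "\<tau> u = u"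
    and u_central: "u * (\<tau> ^^ N) k = u * k"
begin

abbreviation "L \<equiv> lact act \<tau> N"
abbreviation "S \<equiv> shift act N u"

lemmas pow_endo = ring_endoD[OF ring_endo_funpow[OF endo]]

lemma L_module: "Modules.module L"
  by unfold_locales (simp_all add: fun_eq_iff lact_def pow_endo scale_right_distrib scale_left_distrib)

lemma L_fixed: "\<tau> k = k \<Longrightarrow> L k f a = k \<bullet> f a"
  by (simp add: lact_def funpow_fixpoint)

lemma S_zero: "a mod N = 0 \<Longrightarrow> S f a = u \<bullet> f (a + N - 1)"
  by (simp add: shift_def)

lemma S_Suc: "Suc (a mod N) \<noteq> N \<Longrightarrow> S f (Suc a) = f a"
  by (rule mod_cases[OF N1, of a]) (auto simp: shift_def)

lemma S_pos: "a mod N \<noteq> 0 \<Longrightarrow> S f a = f (a - 1)"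
  by (simp add: shift_def)

lemma wrap_mod: "a mod N = 0 \<Longrightarrow> N > 0 \<Longrightarrow> (a + N - Suc 0) mod N = N - Suc 0"
proof -
  assume "a mod N = 0" "N > 0"
  then obtain k where "a = N * k" by (auto elim: dvdE)
  then have "a + N - Suc 0 = (N - Suc 0) + N * k" using \<open>N > 0\<close> by simp
  then show ?thesis using \<open>N > 0\<close> by (simp only: mod_mult_self2) simp
qed

lemma pred_mod: "a mod N \<noteq> 0 \<Longrightarrow> (a - Suc 0) mod N = a mod N - Suc 0"
  by (cases a) (auto simp: mod_Suc split: if_splits)

lemma S_semilin: "semilin L \<tau> S"
  unfolding semilin_def
proof (intro conjI allI ext)
  show "S (f + g) a = (S f + S g) a" for f g a
    by (simp add: shift_def scale_right_distrib)
  show "L k (S f) a = S (L (\<tau> k) f) a" for k f a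
  proof (cases "a mod N = 0")
    case True
    show ?thesis
    proof (cases "N = 0")
      case False
      then have "(\<tau> ^^ (N - 1)) (\<tau> k) = (\<tau> ^^ N) k" by (cases N) (simp_all add: funpow_swap1)
      then have "L k (S f) a = (k * u) \<bullet> f (a + N - 1)"
          "S (L (\<tau> k) f) a = (u * (\<tau> ^^ N) k) \<bullet> f (a + N - 1)"
        using True wrap_mod[OF True] False by (simp_all add: S_zero lact_def)
      then show ?thesis by (simp only: u_central mult.commute)
    qed (use True in \<open>simp add: shift_def lact_def u0\<close>)
  next
    case False
    then have "(\<tau> ^^ (a mod N - 1)) (\<tau> k) = (\<tau> ^^ (a mod N)) k"
      by (cases "a mod N") (simp_all add: funpow_swap1)
    moreover have "S (L (\<tau> k) f) a = (\<tau> ^^ (a mod N - 1)) (\<tau> k) \<bullet> f (a - 1)"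
      using pred_mod[OF False] by (simp add: S_pos[OF False] lact_def)
    ultimately show ?thesis by (simp add: S_pos[OF False] lact_def)
  qed
qed

lemma S_pow:
  assumes "N > 0"
  shows "(S ^^ N) f = L u f"
proof -
  have 1: "(S ^^ n) f a = (if n \<le> a mod N then f (a - n) else u \<bullet> f (a + N - n))" if "n \<le> N" for n a
    using that
  proof (induction n arbitrary: a)
    case (Suc n)
    show ?case
    proof (cases "a mod N = 0")
      case True
      have "n \<le> (a + N - 1) mod N" using Suc.prems wrap_mod[OF True assms] by simp
      then have "(S ^^ n) f (a + N - 1) = f (a + N - 1 - n)"
        using Suc.IH[of "a + N - 1"] Suc.prems by simp
      then show ?thesis using True unfolding funpow.simps o_apply S_zero[OF True] by simp
    next
      case False
      then have "a > 0" by (auto intro: ccontr)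
      then have "a - 1 - n = a - Suc n" "a - 1 + N - n = a + N - Suc n"
        "(n \<le> (a - 1) mod N) = (Suc n \<le> a mod N)"
        using False pred_mod[OF False] by auto
      then show ?thesis using Suc.IH[of "a - 1"] Suc.prems
        unfolding funpow.simps o_apply S_pos[OF False] by simp
    qed
  qed simp
  have "\<not> N \<le> a mod N" for a using assms by (simp add: not_le)
  then show ?thesis using 1[OF order_refl] by (intro ext) (simp add: L_fixed[OF u_fix])
qed

text \<open>
  The boundary terms of \<open>P\<close> vanish at the top of a block, and \<open>S\<close> carries the values of \<open>P\<close> downwards from there.
\<close>

lemma eq_by_top:
  assumes PS: "\<And>f. P (S f) = L c (S (P f))" and c: "\<tau> c = c" "d * c = 1"
    and w: "\<tau> w = c * w" and N: "N > 0"
    and top: "\<And>f a. Suc (a mod N) = N \<Longrightarrow> P f a = L w f a"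
  shows "P f = L w f"
proof -
  interpret LM: Modules.module L by (rule L_module)
  have wS: "L w (S f) = L c (S (L w f))" for f
    by (simp add: semilinD(2)[OF S_semilin] c w)
  have "P f a = L w f a" if "N - a mod N = k" for a k f
    using that
  proof (induction k arbitrary: a f)
    case (Suc k)
    show ?case
    proof (cases rule: mod_cases[OF N1, of a, case_names top inner])
      case inner
      then have "N - Suc a mod N = k" using Suc.prems by simp
      from Suc.IH[OF this, of "S f"] have "L c (S (P f)) (Suc a) = L c (S (L w f)) (Suc a)"
        by (simp add: PS wS)
      then have "c \<bullet> P f a = c \<bullet> L w f a" using inner by (simp add: L_fixed c S_Suc)
      then have "d \<bullet> c \<bullet> P f a = d \<bullet> c \<bullet> L w f a" by simp
      then show ?thesis by (simp add: c)
    qed (use N1 top in auto)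
  next
    case 0
    then show ?case using mod_less_divisor[OF N, of a] by linarith
  qed
  then show ?thesis by blast
qed

end

definition delta :: "nat \<Rightarrow> 'v::zero \<Rightarrow> nat \<Rightarrow> 'v"
  where "delta a v = (\<lambda>b. if b = a then v else 0)"

lemma (in module) funpow_at:
  assumes "\<And>f. P f a = scale c (t (f a))" "\<And>v. t (scale c v) = scale c (t v)"
  shows "(P ^^ n) f a = scale (c ^ n) ((t ^^ n) (f a))"
proof -
  have t: "t (scale (c ^ n) v) = scale (c ^ n) (t v)" for v n
  proof (induction n arbitrary: v)
    case (Suc n)
    show ?case using Suc[of "scale c v"] by (simp add: assms mult.commute)
  qed simp
  show ?thesis by (induction n) (simp_all add: assms t)
qed

context line
begin

abbreviation "D \<equiv> down act N"

lemma D_semilin: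
  assumes t: "semilin act \<tau>' t" and \<tau>': "ring_endo \<tau>'" "\<And>k. \<tau> (\<tau>' k) = \<tau>' (\<tau> k)"
    and s: "\<tau>' s = s" and z: "\<And>k. z * \<tau> (\<tau>' k) = z * k" and top: "qn s N * z = 0"
  shows "semilin L \<tau>' (D s z t)"
  unfolding semilin_def
proof (intro conjI allI ext)
  note [simp] = semilinD(1)[OF t]
  show "D s z t (f + g) a = (D s z t f + D s z t g) a" for f g a
    by (simp add: down_def scale_right_distrib)
  show "L k (D s z t f) a = D s z t (L (\<tau>' k) f) a" for k f a
  proof -
    let ?i = "a mod N"
    have 1: "(\<tau> ^^ ?i) k \<bullet> s ^ ?i \<bullet> t (f a) = s ^ ?i \<bullet> t ((\<tau> ^^ ?i) (\<tau>' k) \<bullet> f a)"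
      by (simp add: scale_left_commute[of _ "s ^ ?i"] semilinD(2)[OF t] funpow_commute \<tau>'(2) mult.commute)
    have 2: "(\<tau> ^^ ?i) k * (qn s (Suc ?i) * z) = qn s (Suc ?i) * z * (\<tau> ^^ (Suc a mod N)) (\<tau>' k)"
    proof (cases rule: mod_cases[OF N1, of a, case_names top inner])
      case top
      then show ?thesis using assms(6) by simp
    next
      case inner
      have "z * (\<tau> ^^ (Suc a mod N)) (\<tau>' k) = z * \<tau> (\<tau>' ((\<tau> ^^ ?i) k))"
        using inner by (simp add: funpow_commute \<tau>'(2))
      then show ?thesis by (metis z mult.assoc mult.commute)
    qed
    show ?thesis by (simp add: down_def lact_def scale_right_distrib 1[simplified] 2[simplified])
  qed
qed

text \<open>Inside a block this is the recursion (n+1)_s = 1 + s (n)_s. At its start the wrapped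
  term has to agree, which is the condition \<open>s ^ N * \<tau>' u = u\<close>: P passes x^N = u
  with the factor s^N.\<close>

lemma D_S:
  assumes t: "semilin act \<tau>' t" and \<tau>': "ring_endo \<tau>'" and s: "\<tau> s = s" "\<tau>' s = s" and z: "\<tau> z = z" and u: "s ^ N * \<tau>' u = u"
    and top: "qn s N * z = 0"
  shows "D s z t (S f) = L s (S (D s z t f)) + L z f"
proof
  fix a
  note [simp] = semilinD(1)[OF t]
  have ts: "t (s \<bullet> v) = s \<bullet> t v" for v by (rule semilin_fixed[OF t s(2)])
  show "D s z t (S f) a = (L s (S (D s z t f)) + L z f) a"
  proof (cases "a mod N = 0")
    case True
    have f1: "S f (Suc a) = f a" using True N1 by (intro S_Suc) auto
    show ?thesis
    proof (cases "N = 0")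
      case N: False
      have "t (u \<bullet> v) = (s * u * s ^ (N - 1)) \<bullet> t v" for v
      proof -
        have "s * u * s ^ (N - 1) = s ^ N * u" using N by (cases N) auto
        then have "(s * u * s ^ (N - 1)) \<bullet> t v = t ((s ^ N * \<tau>' u) \<bullet> v)"
          by (simp add: semilinD(2)[OF t] ring_endoD[OF \<tau>'] s)
        then show ?thesis by (simp add: u)
      qed
      then show ?thesis using True N f1 top wrap_mod[OF True]
        by (simp add: down_def lact_def S_zero L_fixed z s scale_right_distrib mult_ac)
    qed (use True f1 in \<open>simp add: down_def lact_def shift_def u0 L_fixed z s semilinD(3)[OF t]\<close>)
  next
    case False
    then obtain i where i: "a mod N = Suc i" by (cases "a mod N") auto
    have "(qn s (Suc (Suc i)) * z) \<bullet> S f (Suc a) = (qn s (Suc (Suc i)) * z) \<bullet> f a"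
    proof (cases "Suc (a mod N) = N")
      case True
      then show ?thesis using top i by simp
    qed (use i S_Suc[of a f] in simp)
    moreover have "0 < a" using False by (auto intro: ccontr)
    ultimately show ?thesis using False i pred_mod[OF False]
      by (simp add: down_def L_fixed z s S_pos qn_Suc scale_right_distrib scale_left_distrib algebra_simps)
  qed
qed

text \<open>If \<open>z = 0\<close>, the operator acts position by position. Otherwise (M)_s z = 0
  removes the error in P^M x = s^M x P^M, and it is enough to compare the two sides at the ends of
  the blocks. The disjunction admits an infinite block together with \<open>z = 0\<close>.\<close>

lemma D_pow:
  assumes t: "semilin act \<tau>' t" and \<tau>': "ring_endo \<tau>'" and s: "\<tau> s = s" "\<tau>' s = s" "d * s = 1"
    and top: "qn s N * z = 0"
    and tM: "\<And>v. (t ^^ M) v = w \<bullet> v" and w: "\<tau> w = s ^ M * w"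
    and z: "z = 0 \<or> N > 0 \<and> qn s M * z = 0 \<and> \<tau> z = z \<and> \<tau>' z = z \<and> s ^ N * \<tau>' u = u
      \<and> semilin L \<tau>' (D s z t)"
  shows "(D s z t ^^ M) f = L w f"
proof -
  have ts: "t (s ^ n \<bullet> v) = s ^ n \<bullet> t v" for n v
    by (rule semilin_fixed[OF t]) (simp add: ring_endoD[OF \<tau>'] s)
  have wi: "(\<tau> ^^ i) w = (s ^ i) ^ M * w" for i
    by (induction i) (simp_all add: w ring_endoD[OF endo] s power_mult_distrib mult_ac)
  have at: "(D s z t ^^ M) f a = L w f a" if "\<And>f. D s z t f a = s ^ (a mod N) \<bullet> t (f a)" for f a
    using funpow_at[where P = "D s z t" and t = t and c = "s ^ (a mod N)" and a = a and n = M and f = f]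
    by (simp add: that ts tM lact_def wi)
  from z show ?thesis
  proof
    assume "z = 0"
    then show ?thesis by (intro ext at) (simp add: down_def)
  next
    assume z: "N > 0 \<and> qn s M * z = 0 \<and> \<tau> z = z \<and> \<tau>' z = z \<and> s ^ N * \<tau>' u = u
      \<and> semilin L \<tau>' (D s z t)"
    then have zf: "(\<tau>' ^^ i) z = z" for i by (simp add: funpow_fixpoint)
    interpret LM: Modules.module L by (rule L_module)
    have 0: "(\<Sum>i<M. s ^ i * (\<tau>' ^^ i) z) = 0"
      using z by (simp add: zf qn_def sum_distrib_right)
    from z have sl: "semilin L \<tau>' (D s z t)" by blast
    have PS: "D s z t (S f) = L s (S (D s z t f)) + L z f" for f
      by (rule D_S[OF t \<tau>']) (use s z top in auto)
    have "(D s z t ^^ M) (S f) = L (s ^ M) (S ((D s z t ^^ M) f))" for f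
      unfolding LM.semilin_funpow_mul[where Q = S, OF sl \<tau>' s(2) PS] 0
      using semilinD(3)[OF semilin_pow[OF sl]] by simp
    then show ?thesis
    proof (rule eq_by_top)
      show "d ^ M * s ^ M = 1" using s(3) by (simp flip: power_mult_distrib)
      fix f a assume "Suc (a mod N) = N"
      then show "(D s z t ^^ M) f a = L w f a"
        by (intro at) (simp add: down_def top)
    qed (use z w s in \<open>simp_all add: ring_endoD[OF endo]\<close>)
  qed
qed

lemma D_delta: "t 0 = 0 \<Longrightarrow> D s z t (delta 0 v) = delta 0 (t v)"
  by (auto simp: fun_eq_iff down_def delta_def)

lemma L_delta: "L k (delta 0 v) = delta 0 (k \<bullet> v)"
  by (auto simp: fun_eq_iff lact_def delta_def)

lemma S_delta: "N = 0 \<or> n < N \<Longrightarrow> (S ^^ n) (delta 0 v) = delta n v"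
proof (induction n)
  case (Suc n)
  have "S (delta n v) a = delta (Suc n) v a" for a
  proof (cases "a mod N = 0")
    case True
    then have "a + N - 1 \<noteq> n \<and> a \<noteq> Suc n" if "N \<noteq> 0"
      using that Suc.prems by (cases "a = 0") (auto dest: dvd_imp_le)
    then show ?thesis using True by (cases "N = 0") (auto simp: shift_def delta_def u0)
  next
    case False
    then have "a > 0" by (auto intro: ccontr)
    then show ?thesis using False by (auto simp: S_pos delta_def)
  qed
  then have "S (delta n v) = delta (Suc n) v" by (rule ext)
  moreover have "N = 0 \<or> n < N" using Suc.prems by auto
  ultimately show ?case using Suc.IH by simp
qed simp

end

text \<open>
  Multiplication by \<open>x\<^sub>1\<close> after adjoining \<open>x\<^sub>2\<close>, where \<open>[x\<^sub>1x\<^sub>1x\<^sub>2] = z\<close> and \<open>[x\<^sub>1x\<^sub>2x\<^sub>2] = w\<close>. As \<open>w \<noteq> 0\<close> only if \<open>N = 3\<close>,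
  the position \<open>a + 2\<close> lies in the block of \<open>a\<close> only for \<open>a mod N = 0\<close>.
\<close>

definition slope :: "('r::comm_ring_1 \<Rightarrow> 'v::ab_group_add \<Rightarrow> 'v) \<Rightarrow> nat \<Rightarrow> 'r \<Rightarrow> 'r \<Rightarrow> 'r \<Rightarrow> ('v \<Rightarrow> 'v) \<Rightarrow> ('v \<Rightarrow> 'v) \<Rightarrow> (nat \<Rightarrow> 'v) \<Rightarrow> nat \<Rightarrow> 'v"
  where "slope act N p q w t y f a = act (p ^ (a mod N)) (t (f a))
    + act (p ^ (a mod N) * qn q (Suc (a mod N))) (y (f (Suc a)))
    + (if a mod N = 0 then act w (f (Suc (Suc a))) else 0)"

text \<open>\<open>z\<close> and \<open>w\<close> are the values of [x1 x1 x2] and [x1 x2 x2]. If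
  one of them is nonzero, its trivial character forces q12 = q21 = q11 to be a primitive cube root
  of unity, so the two share one alternative. The last conditions say that each value is central for
  the characters of its own word.\<close>

definition cubic_terms :: "('r::comm_ring_1 \<Rightarrow> 'r) \<Rightarrow> ('r \<Rightarrow> 'r) \<Rightarrow> nat \<Rightarrow> 'r \<Rightarrow> 'r \<Rightarrow> 'r \<Rightarrow> 'r \<Rightarrow> bool"
  where "cubic_terms \<tau>1 \<tau>2 N p q z w \<longleftrightarrow> w = 0 \<and> z = 0 \<or>
      N = 3 \<and> p = q \<and> 1 + q + q * q = 0 \<and> \<tau>1 z = z \<and> \<tau>2 z = z \<and> \<tau>1 w = w \<and> \<tau>2 w = w \<and>
      (\<forall>k. z * \<tau>1 (\<tau>1 (\<tau>2 k)) = z * k) \<and> (\<forall>k. w * \<tau>1 (\<tau>2 (\<tau>2 k)) = w * k)"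

text \<open>\<open>x2\<close> is adjoined to a module on which \<open>t\<close> and \<open>y\<close>
  already represent \<open>x1\<close> and \<open>x12\<close>. By \<open>pu\<close>, x1 passes x2^N =
  u consistently; \<open>qu\<close> gives the same for \<open>x12\<close>.\<close>

locale ore_line = line act \<tau>2 N u
  for act :: "'r::comm_ring_1 \<Rightarrow> 'v::ab_group_add \<Rightarrow> 'v"  (infixr \<open>\<bullet>\<close> 75) and \<tau>2 N u +
  fixes \<tau>1 :: "'r \<Rightarrow> 'r" and t y :: "'v \<Rightarrow> 'v" and p q z w p' q' :: 'r
  assumes endo1: "ring_endo \<tau>1" and comm: "\<And>k. \<tau>2 (\<tau>1 k) = \<tau>1 (\<tau>2 k)"
    and t: "semilin act \<tau>1 t" and y: "semilin act (\<lambda>k. \<tau>1 (\<tau>2 k)) y"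
    and fixed: "\<tau>1 p = p" "\<tau>2 p = p" "\<tau>1 q = q" "\<tau>2 q = q"
    and unit: "p' * p = 1" "q' * q = 1"
    and ty: "\<And>v. t (y v) = (q * p) \<bullet> y (t v) + z \<bullet> v"
    and qN: "qn q N = 0" and pu: "p ^ N * \<tau>1 u = u" and qu: "q ^ N * u = u"
    and cubic: "cubic_terms \<tau>1 \<tau>2 N p q z w"
begin

lemmas wz = cubic[unfolded cubic_terms_def]

abbreviation "U \<equiv> slope act N p q w t y"
abbreviation "Y \<equiv> D (p * q) w y"

lemmas e1 = ring_endoD[OF endo1]
lemmas e2 = ring_endoD[OF endo]

lemma endo12: "ring_endo (\<lambda>k. \<tau>1 (\<tau>2 k))"
  by (rule ring_endo_comp[OF endo1 endo])

lemma pq_top: "qn (p * q) N * w = 0"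
  using wz
proof (elim disjE conjE)
  assume *: "N = 3" "p = q" "1 + q + q * q = 0"
  have "qn (q * q) 3 = (1 + q + q * q) * (1 - q + q * q)"
    by (simp add: qn_def numeral_3_eq_3 algebra_simps)
  then show ?thesis using * by simp
qed simp

lemma w_fixed: "\<tau>1 w = w" "\<tau>2 w = w" "w * \<tau>1 (\<tau>2 (\<tau>2 k)) = w * k"
  and z_fixed: "\<tau>1 z = z" "\<tau>2 z = z"
  using wz by (auto simp: e1 e2)

lemma Y_semilin: "semilin L (\<lambda>k. \<tau>1 (\<tau>2 k)) Y"
  by (rule D_semilin[OF y endo12]) (simp_all add: comm fixed e1 e2 w_fixed pq_top)

lemma Y_S: "Y (S f) = L (p * q) (S (Y f)) + L w f"
proof (rule D_S[OF y endo12])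
  have "(p * q) ^ N * \<tau>1 u = u"
    using pu qu by (metis mult.commute mult.left_commute power_mult_distrib)
  then show "(p * q) ^ N * \<tau>1 (\<tau>2 u) = u" by (simp add: u_fix)
qed (simp_all add: fixed e1 e2 w_fixed pq_top)

text \<open>At the end of a block the \<open>x12\<close> term dies by (N)_q = 0, and the
  \<open>w\<close> term occurs only at the start; \<open>x1\<close> acts there through
  \<open>t\<close> alone.\<close>

lemma U_top: "Suc (a mod N) = N \<Longrightarrow> U f a = p ^ (a mod N) \<bullet> t (f a)"
  using N1 qN by (auto simp: slope_def)

lemma U_semilin: "semilin L \<tau>1 U"
  unfolding semilin_def
proof (intro conjI allI ext)
  note [simp] = semilinD(1)[OF t] semilinD(1)[OF y]
  show "U (f + g) a = (U f + U g) a" for f g a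
    by (simp add: slope_def scale_right_distrib)
  fix k f a
  let ?i = "a mod N"
  have t1: "k \<bullet> p ^ n \<bullet> t v = p ^ n \<bullet> t (\<tau>1 k \<bullet> v)" for n k v
    unfolding scale_left_commute[of k "p ^ n"] semilinD(2)[OF t, of k] ..
  have y1: "k \<bullet> c \<bullet> y v = c \<bullet> y (\<tau>1 (\<tau>2 k) \<bullet> v)" for c k v
    unfolding scale_left_commute[of k c] semilinD(2)[OF y, of k] ..
  have c1: "(\<tau>2 ^^ n) (\<tau>1 k) = \<tau>1 ((\<tau>2 ^^ n) k)" for n k
    by (rule funpow_commute) (rule comm)
  show "L k (U f) a = U (L (\<tau>1 k) f) a"
  proof (cases rule: mod_cases[OF N1, of a, case_names top inner])
    case top
    then show ?thesis by (simp only: lact_def U_top t1 c1)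
  next
    case inner
    have "w \<bullet> (\<tau>2 ^^ (Suc (Suc a) mod N)) (\<tau>1 k) \<bullet> v = w \<bullet> k \<bullet> v" if "?i = 0" for v
      using wz
    proof (elim disjE conjE)
      assume *: "N = 3" "\<forall>k. w * \<tau>1 (\<tau>2 (\<tau>2 k)) = w * k"
      then have "Suc (Suc a) mod N = 2" using that by (auto simp: mod_Suc)
      then show ?thesis using * by (simp add: numeral_2_eq_2 comm)
    qed simp
    then have "(\<tau>2 ^^ ?i) k \<bullet> (if ?i = 0 then w \<bullet> v else 0)
        = (if ?i = 0 then w \<bullet> (\<tau>2 ^^ (Suc (Suc a) mod N)) (\<tau>1 k) \<bullet> v else 0)" for v
      by (simp add: mult.commute)
    moreover have "(\<tau>2 ^^ (Suc a mod N)) (\<tau>1 k) = \<tau>1 (\<tau>2 ((\<tau>2 ^^ ?i) k))"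
      using inner by (simp add: c1 comm)
    ultimately show ?thesis
      by (simp only: slope_def lact_def scale_right_distrib t1 y1 c1)
  qed
qed

lemma U_S: "U (S f) = L p (S (U f)) + Y f"
proof
  fix a
  note [simp] = semilinD(1)[OF t] semilinD(1)[OF y]
  show "U (S f) a = (L p (S (U f)) + Y f) a"
  proof (cases "a mod N = 0")
    case True
    have f1: "S f (Suc a) = f a" using True N1 by (intro S_Suc) auto
    have f2: "w \<bullet> S f (Suc (Suc a)) = w \<bullet> f (Suc a)"
      using wz
    proof (elim disjE conjE)
      assume "N = 3"
      then have "Suc (Suc a mod N) \<noteq> N" using True by (auto simp: mod_Suc)
      then show ?thesis by (simp add: S_Suc)
    qed simp
    have "t (S f a) = p \<bullet> S (U f) a"
    proof (cases "N = 0")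
      case N: False
      then have "Suc ((a + N - 1) mod N) = N" using wrap_mod[OF True] by simp
      note top = U_top[OF this]
      have "p * (u * p ^ (N - 1)) = p ^ N * u" using N by (cases N) auto
      then have "p \<bullet> u \<bullet> p ^ (N - 1) \<bullet> t v = (p ^ N * u) \<bullet> t v" for v
        by (simp only: scale_scale)
      then have "p \<bullet> u \<bullet> p ^ (N - 1) \<bullet> t v = t ((p ^ N * \<tau>1 u) \<bullet> v)" for v
        by (simp only: semilinD(2)[OF t] e1 fixed)
      then show ?thesis using True wrap_mod[OF True] N
        by (simp add: S_zero top[simplified] pu del: scale_scale)
    qed (use True in \<open>simp add: shift_def u0 semilinD(3)[OF t]\<close>)
    then show ?thesis using True f1 f2
      by (simp add: slope_def down_def L_fixed fixed)
  next
    case False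
    then obtain i where i: "a mod N = Suc i" by (cases "a mod N") auto
    have f1: "(c * qn q (Suc (Suc i))) \<bullet> y (S f (Suc a)) = (c * qn q (Suc (Suc i))) \<bullet> y (f a)" for c
    proof (cases "Suc (a mod N) = N")
      case True
      then show ?thesis using qN i by simp
    qed (use i S_Suc[of a f] in simp)
    have pos: "0 < a" using False by (auto intro: ccontr)
    \<comment> \<open>Nonzero \<open>w\<close> leaves only the positions 1 and 2 of a block of
      length 3. They give p + (2)_{pq} = 1 + q + q^2 and (3)_{pq}, both zero.\<close>
    have w: "((if i = 0 then p else 0) + qn (p * q) (Suc (Suc i))) * w = 0"
      using wz
    proof (elim disjE conjE)
      assume *: "N = 3" "p = q" "1 + q + q * q = 0"
      then have "i = 0 \<or> i = 1" using i mod_less_divisor[of 3 a] by auto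
      then show ?thesis
      proof
        assume "i = 0"
        then show ?thesis using * by (simp add: qn_Suc add_ac)
      next
        assume "i = 1"
        then show ?thesis using * pq_top by (simp add: numeral_3_eq_3)
      qed
    qed simp
    have "U (S f) a = p ^ Suc i \<bullet> t (f (a - 1)) + (p ^ Suc i * qn q (Suc (Suc i))) \<bullet> y (f a)"
      using False i f1 by (simp add: slope_def S_pos)
    moreover have "L p (S (U f)) a = p \<bullet> (p ^ i \<bullet> t (f (a - 1)) + (p ^ i * qn q (Suc i)) \<bullet> y (f a)
        + (if i = 0 then w \<bullet> f (Suc a) else 0))"
      using False i pos pred_mod[OF False] by (simp add: L_fixed fixed S_pos slope_def)
    moreover have "p ^ Suc i * qn q (Suc (Suc i)) = p * (p ^ i * qn q (Suc i)) + (p * q) ^ Suc i"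
      by (simp add: qn_Suc'[of q "Suc i"] algebra_simps power_mult_distrib)
    moreover have "p \<bullet> (if i = 0 then w \<bullet> v else 0) + (qn (p * q) (Suc (Suc i)) * w) \<bullet> v = 0" for v
    proof -
      have "(((if i = 0 then p else 0) + qn (p * q) (Suc (Suc i))) * w) \<bullet> v = 0"
        by (simp only: w scale_zero_left)
      then show ?thesis by (cases "i = 0") (simp_all add: distrib_right scale_left_distrib)
    qed
    moreover have "Y f a = (p * q) ^ Suc i \<bullet> y (f a) + (qn (p * q) (Suc (Suc i)) * w) \<bullet> f (Suc a)"
      using i by (simp add: down_def)
    ultimately show ?thesis
      by (simp only: plus_fun_apply scale_right_distrib scale_left_distrib scale_scale power_Suc
          add.assoc[symmetric])
       (simp only: add.assoc add.left_commute[of _ "(p * q * (p * q) ^ i) \<bullet> y (f a)"] add_0_right)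
  qed
qed

lemma qn_fixed: "ring_endo \<tau> \<Longrightarrow> \<tau> s = s \<Longrightarrow> \<tau> (qn s n) = qn s n"
  by (simp add: qn_def ring_endoD)

lemma t_fixed: "\<tau>1 c = c \<Longrightarrow> t (c \<bullet> v) = c \<bullet> t v"
  and y_fixed: "\<tau>1 c = c \<Longrightarrow> \<tau>2 c = c \<Longrightarrow> y (c \<bullet> v) = c \<bullet> y v"
  using semilin_fixed[OF t, of c v] semilin_fixed[OF y, of c v] by simp_all

text \<open>Without cubic terms the two sides have the same monomials with the same powers of
  \<open>p\<close> and \<open>q\<close>. In the cubic case only three positions exist, and each is a
  computation in the normal form modulo q^2 = -1 - q.\<close>

lemma U_Y: "U (Y f) = L (q * p) (Y (U f)) + L z f"
proof
  fix a
  let ?i = "a mod N"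
  note [simp] = semilinD(1,3)[OF t] semilinD(1,3)[OF y]
  note fx = t_fixed y_fixed e1 e2 fixed qn_def
  show "U (Y f) a = (L (q * p) (Y (U f)) + L z f) a"
    using wz
  proof (elim disjE conjE)
    assume 0: "w = 0" "z = 0"
    show ?thesis
    proof (cases rule: mod_cases[OF N1, of a, case_names top inner])
      case top
      have "U (Y f) a = (p ^ ?i * (p * q) ^ ?i * (q * p)) \<bullet> y (t (f a))"
        by (simp add: U_top[OF top(2), unfolded 0] down_def 0 ty fx mult.assoc)
      moreover have "L (q * p) (Y (U f)) a = (q * p * ((p * q) ^ ?i * p ^ ?i)) \<bullet> y (t (f a))"
        by (simp add: U_top[OF top(2), unfolded 0] down_def 0 fx L_fixed)
      ultimately show ?thesis by (simp add: 0 lact_def pow_endo mult_ac)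
    next
      case inner
      let ?c = "p ^ ?i * qn q (Suc ?i)"
      have c: "\<tau>1 ?c = ?c" "\<tau>2 ?c = ?c" by (simp_all add: fx)
      have "U (Y f) a = (p ^ ?i * (p * q) ^ ?i * (q * p)) \<bullet> y (t (f a))
          + (?c * (p * q) ^ Suc ?i) \<bullet> y (y (f (Suc a)))"
        using inner by (simp add: slope_def down_def 0 ty t_fixed y_fixed e1 e2 fixed mult.assoc del: power_Suc)
      moreover have "L (q * p) (Y (U f)) a = (q * p * ((p * q) ^ ?i * p ^ ?i)) \<bullet> y (t (f a))
          + (q * p * ((p * q) ^ ?i * ?c)) \<bullet> y (y (f (Suc a)))"
        by (simp add: slope_def down_def 0 y_fixed c t_fixed e1 e2 fixed L_fixed scale_right_distrib mult.assoc
            qn_fixed[OF endo1 fixed(3)] qn_fixed[OF endo fixed(4)])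
      ultimately show ?thesis by (simp add: 0 lact_def pow_endo mult_ac)
    qed
  next
    assume *: "N = 3" "p = q" "1 + q + q * q = 0" "\<tau>1 z = z" "\<tau>2 z = z" "\<tau>1 w = w" "\<tau>2 w = w"
    have q2: "q * q = - 1 - q" using *(3) by (simp add: algebra_simps eq_neg_iff_add_eq_0)
    have q2': "q * (q * x) = - x - q * x" for x
      using arg_cong[OF q2, of "\<lambda>r. r * x"] by (simp add: algebra_simps)
    have q5: "q * (q * (q * (q * q))) = - 1 - q" "q * (q * q) = 1" by (simp_all add: q2 q2' algebra_simps)
    have f: "Y g b = (q * q) ^ (b mod 3) \<bullet> y (g b) + (qn (q * q) (Suc (b mod 3)) * w) \<bullet> g (Suc b)"
      "U g b = q ^ (b mod 3) \<bullet> t (g b) + (q ^ (b mod 3) * qn q (Suc (b mod 3))) \<bullet> y (g (Suc b))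
        + (if b mod 3 = 0 then w \<bullet> g (Suc (Suc b)) else 0)" for g b
      by (simp_all add: down_def slope_def *)
    have qp: "\<tau>2 (q * p) = q * p" by (simp add: e2 fixed)
    have fq: "\<tau>1 q = q" "\<tau>2 q = q" by (fact fixed)+
    note ev = plus_fun_apply L_fixed[OF qp] L_fixed[OF *(5)] f
    note fx = scale_right_distrib t_fixed y_fixed e1 e2 fq ty[unfolded *(2)] *(2,4-7) qn_def numeral_3_eq_3
      numeral_2_eq_2
    note nf = q2 q2' algebra_simps scale_left_distrib scale_left_diff_distrib
    have "a mod 3 < 3" by simp
    then consider "a mod 3 = 0" | "a mod 3 = 1" | "a mod 3 = 2" by linarith
    then show ?thesis
    proof cases
      case 1
      then have m: "Suc a mod 3 = 1" "Suc (Suc a) mod 3 = 2" by (simp_all add: mod_Suc)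
      show ?thesis unfolding ev 1 m by (simp add: fx) (simp add: nf)
    next
      case 2
      then have m: "Suc a mod 3 = 2" "Suc (Suc a) mod 3 = 0" by (simp_all add: mod_Suc)
      show ?thesis unfolding ev 2 m by (simp add: fx) (simp add: nf)
    next
      case 3
      then have m: "Suc a mod 3 = 0" "Suc (Suc a) mod 3 = 1" by (simp_all add: mod_Suc)
      show ?thesis unfolding ev 3 m by (simp add: fx) (simp add: nf)
    qed
  qed
qed

lemma Y_pow:
  assumes "\<And>v. (y ^^ N) v = r \<bullet> v" "\<tau>2 r = (p * q) ^ N * r"
  shows "N > 0 \<Longrightarrow> (Y ^^ N) f = L r f"
proof (rule D_pow[OF y endo12 _ _ _ pq_top assms])
  show "p' * q' * (p * q) = 1" using unit by (metis mult.commute mult.left_commute mult_1)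
  have "(p * q) ^ N * \<tau>1 u = u"
    using pu qu by (metis mult.commute mult.left_commute power_mult_distrib)
  then show "w = 0 \<or> N > 0 \<and> qn (p * q) N * w = 0 \<and> \<tau>2 w = w \<and> \<tau>1 (\<tau>2 w) = w
      \<and> (p * q) ^ N * \<tau>1 (\<tau>2 u) = u \<and> semilin L (\<lambda>k. \<tau>1 (\<tau>2 k)) Y"
    using wz pq_top Y_semilin by (auto simp: w_fixed u_fix)
qed (simp_all add: fixed e1 e2)

text \<open>By (N)_q = 0 the \<open>Y\<close> term disappears when U^N passes \<open>S\<close>, and
  the remaining scalar is z + q(1+q)z = 0 in the cubic case. So U^N commutes with \<open>S\<close>
  up to p^N and is determined at the ends of the blocks, where it is a power of
  \<open>t\<close>.\<close>

lemma U_pow: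
  assumes tN: "\<And>v. (t ^^ N) v = r \<bullet> v" and r: "\<tau>2 r = p ^ N * r" and N: "N > 0"
  shows "(U ^^ N) f = L r f"
proof -
  interpret LM: Modules.module L by (rule L_module)
  have m: "(\<Sum>j<N. p ^ (j - 1) * qn q j * (\<tau>1 ^^ (j - 1)) z) = 0"
    using wz
  proof (elim disjE conjE)
    assume "z = 0"
    then show ?thesis by (simp add: ring_endoD[OF ring_endo_funpow[OF endo1]])
  next
    assume *: "N = 3" "p = q" "1 + q + q * q = 0"
    have "z + q * (1 + q) * z = (1 + q + q * q) * z" by (simp add: algebra_simps)
    then have "z + q * (1 + q) * z = 0" using *(3) by simp
    then show ?thesis using * by (simp add: numeral_3_eq_3 qn_Suc z_fixed)
  qed
  have US: "(U ^^ N) (S f) = L (p ^ N) (S ((U ^^ N) f))" for f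
    unfolding LM.semilin_funpow_mul2[where Q = S and R = Y and l = z, OF U_semilin endo1 fixed(1,3) U_S U_Y] m
    using qN semilinD(3)[OF semilin_pow[OF U_semilin]] by simp
  have ri: "(\<tau>2 ^^ i) r = (p ^ i) ^ N * r" for i
    by (induction i) (simp_all add: r e2 fixed power_mult_distrib mult_ac)
  show ?thesis
  proof (rule eq_by_top[where P = "U ^^ N", OF US _ _ r N])
    show "\<tau>2 (p ^ N) = p ^ N" "p' ^ N * p ^ N = 1"
      using unit by (simp_all add: e2 fixed flip: power_mult_distrib)
    fix f a assume top: "Suc (a mod N) = N"
    show "(U ^^ N) f a = L r f a"
      using funpow_at[where P = U and t = t and c = "p ^ (a mod N)" and a = a and n = N and f = f]
      by (simp add: U_top[OF top] t_fixed e1 fixed tN lact_def ri)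
  qed
qed

lemma U_delta: "U (delta 0 v) = delta 0 (t v)"
  by (auto simp: fun_eq_iff slope_def delta_def semilinD(3)[OF t] semilinD(3)[OF y])

end

section \<open>Adjoining \<open>x2\<close> with \<open>x2^2 = u\<close> to a module with
  \<open>x1^2 = 0\<close>\<close>

locale ore_pair = module act for act :: "'r::comm_ring_1 \<Rightarrow> 'v::ab_group_add \<Rightarrow> 'v"  (infixr \<open>\<bullet>\<close> 75) +
  fixes \<tau>1 \<tau>2 :: "'r \<Rightarrow> 'r" and t y :: "'v \<Rightarrow> 'v" and p u :: 'r
  assumes endo1: "ring_endo \<tau>1" and endo2: "ring_endo \<tau>2" and comm: "\<And>k. \<tau>2 (\<tau>1 k) = \<tau>1 (\<tau>2 k)"
    and t: "semilin act \<tau>1 t" and y: "semilin act (\<lambda>k. \<tau>1 (\<tau>2 k)) y"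
    and fixed: "\<tau>1 p = p" "\<tau>2 p = p"
    and ty: "\<And>v. t (y v) = (- p) \<bullet> y (t v)" and tt: "\<And>v. t (t v) = 0"
    and u_fix: "\<tau>2 u = u" and u_central: "\<And>k. u * \<tau>2 (\<tau>2 k) = u * k"
begin

lemmas e1 = ring_endoD[OF endo1]
lemmas e2 = ring_endoD[OF endo2]
lemmas tD = semilinD[OF t]
lemmas yD = semilinD[OF y]

text \<open>For q22 = -1 the mixed terms cancel in x12 x2 + p x2 x12 = x1 x2^2 - p^2 x2^2 x1. With
  x2^2 = u the right side is x1 r.\<close>

definition r :: 'r where "r = u - p ^ 2 * \<tau>1 u"
text \<open>A pair (v, w) stands for v + x2 w. The entry \<open>t (r \<bullet> w)\<close> of
  \<open>Y\<close> below is the term x1 r that appears when \<open>x12\<close> passes x2.\<close>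

definition pact :: "'r \<Rightarrow> 'v \<times> 'v \<Rightarrow> 'v \<times> 'v"
  where "pact k = (\<lambda>(v, w). (k \<bullet> v, \<tau>2 k \<bullet> w))"
definition X1 :: "'v \<times> 'v \<Rightarrow> 'v \<times> 'v" where "X1 = (\<lambda>(v, w). (t v + y w, p \<bullet> t w))"
definition X2 :: "'v \<times> 'v \<Rightarrow> 'v \<times> 'v" where "X2 = (\<lambda>(v, w). (u \<bullet> w, v))"
definition Y :: "'v \<times> 'v \<Rightarrow> 'v \<times> 'v" where "Y = (\<lambda>(v, w). (y v + t (r \<bullet> w), (- p) \<bullet> y w))"

lemmas defs = pact_def X1_def X2_def Y_def

lemma p_act: "t (p \<bullet> v) = p \<bullet> t v" "y (p \<bullet> v) = p \<bullet> y v"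
  "t (p ^ n \<bullet> v) = p ^ n \<bullet> t v" "y (p ^ n \<bullet> v) = p ^ n \<bullet> y v"
  by (simp_all add: semilin_fixed[OF t] semilin_fixed[OF y] fixed e1 e2)

lemma pact_module: "Modules.module pact"
  by unfold_locales (auto simp: pact_def scale_right_distrib scale_left_distrib e2)

lemma X1_semilin: "semilin pact \<tau>1 X1"
  unfolding semilin_def
proof (intro conjI allI)
  show "pact k (X1 v) = X1 (pact (\<tau>1 k) v)" for k v
  proof (cases v)
    case (Pair a b)
    have "\<tau>2 k \<bullet> p \<bullet> t b = p \<bullet> \<tau>2 k \<bullet> t b" by (rule scale_left_commute)
    then show ?thesis by (simp add: Pair defs scale_right_distrib tD yD comm del: scale_scale)
  qed
qed (auto simp: defs tD yD scale_right_distrib)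

lemma X2_semilin: "semilin pact \<tau>2 X2"
  by (auto simp: semilin_def defs scale_right_distrib u_central mult.commute[of _ u])

lemma X2_X2: "X2 (X2 v) = pact u v"
  by (cases v) (simp add: defs u_fix)

lemma X1_X1: "X1 (X1 v) = 0"
  by (cases v) (simp add: defs tD(1,3) tt ty p_act zero_prod_def)

lemma X1_X2: "X1 (X2 v) = pact p (X2 (X1 v)) + Y v"
proof (cases v)
  case (Pair a b)
  have "\<tau>1 (p * (u * p)) + r = u" by (simp add: e1 fixed r_def power2_eq_square algebra_simps)
  then have "(p * (u * p)) \<bullet> t b + t (r \<bullet> b) = t (u \<bullet> b)"
    by (simp only: tD(2) tD(1)[symmetric] scale_left_distrib[symmetric])
  then show ?thesis
    by (simp add: Pair defs fixed scale_right_distrib add.left_commute[of "(p * (u * p)) \<bullet> t b"])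
qed

lemma Y_semilin: "semilin pact (\<lambda>k. \<tau>1 (\<tau>2 k)) Y"
  unfolding semilin_def
proof (intro conjI allI)
  interpret Q: Modules.module pact by (rule pact_module)
  have Y: "Y v = X1 (X2 v) - pact p (X2 (X1 v))" for v by (simp add: X1_X2)
  show "Y (v + w) = Y v + Y w" for v w
    unfolding Y by (simp add: semilinD(1)[OF X1_semilin] semilinD(1)[OF X2_semilin] Q.scale_right_distrib)
  show "pact k (Y v) = Y (pact (\<tau>1 (\<tau>2 k)) v)" for k v
    unfolding Y Q.scale_right_diff_distrib Q.scale_left_commute[of k p]
    by (simp only: semilinD(2)[OF X1_semilin, of k] semilinD(2)[OF X2_semilin, of "\<tau>1 k"]
        semilinD(2)[OF X2_semilin, of k] semilinD(2)[OF X1_semilin, of "\<tau>2 k"] comm)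
qed

text \<open>\<open>Y\<close> is triangular with diagonal entries y and -p y. In Y^n every
  off-diagonal term picks up (-p)^n from the diagonal and another (-p)^n when \<open>t\<close>
  passes y^n, hence the powers of p^2. The sum in \<open>rN\<close> is the scalar in the
  off-diagonal entry of Y^N.\<close>

lemma Y_pow:
  assumes yN: "\<And>v. (y ^^ N) v = w \<bullet> v" and w: "\<tau>2 w = (- p) ^ N * w"
    and rN: "(\<Sum>i<N. (p ^ 2) ^ i * ((\<lambda>k. \<tau>1 (\<tau>2 k)) ^^ i) r) = 0"
  shows "(Y ^^ N) v = pact w v"
proof -
  let ?\<tau> = "\<lambda>k. \<tau>1 (\<tau>2 k)"
  have mp: "y ((- p) ^ n \<bullet> v) = (- p) ^ n \<bullet> y v" for n v
    by (rule semilin_fixed[OF y]) (simp add: e1 e2 fixed)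
  have t_pow: "t ((y ^^ n) v) = (- p) ^ n \<bullet> (y ^^ n) (t v)" for n v
    by (induction n) (simp_all add: ty mp mult.commute)
  note yn = semilinD[OF semilin_pow[OF y]]
  have "(Y ^^ n) (a, b) = ((y ^^ n) a
      + (y ^^ (n - 1)) (t ((\<Sum>i<n. (p ^ 2) ^ i * (?\<tau> ^^ i) r) \<bullet> b)), (- p) ^ n \<bullet> (y ^^ n) b)" for n a b
  proof (induction n)
    case (Suc n)
    let ?s = "\<Sum>i<n. (p ^ 2) ^ i * (?\<tau> ^^ i) r"
    have 1: "y ((y ^^ (n - 1)) (t (?s \<bullet> b))) = (y ^^ n) (t (?s \<bullet> b))"
      by (cases n) (simp_all add: tD yD)
    have 2: "t (r \<bullet> (- p) ^ n \<bullet> (y ^^ n) b) = (y ^^ n) (t (((p ^ 2) ^ n * (?\<tau> ^^ n) r) \<bullet> b))"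
    proof -
      have "t (r \<bullet> (- p) ^ n \<bullet> (y ^^ n) b) = t ((- p) ^ n \<bullet> r \<bullet> (y ^^ n) b)"
        by (simp only: scale_left_commute)
      also have "\<dots> = (- p) ^ n \<bullet> t ((y ^^ n) ((?\<tau> ^^ n) r \<bullet> b))"
        by (simp only: yn(2)[of r] semilin_fixed[OF t, of "(- p) ^ n"] e1 fixed)
      also have "\<dots> = ((- p) ^ n * (- p) ^ n) \<bullet> (y ^^ n) (t ((?\<tau> ^^ n) r \<bullet> b))"
        by (simp only: t_pow scale_scale)
      also have "(- p) ^ n * (- p) ^ n = (p ^ 2) ^ n"
        by (simp add: power2_eq_square flip: power_mult_distrib)
      also have "(p ^ 2) ^ n \<bullet> (y ^^ n) (t ((?\<tau> ^^ n) r \<bullet> b)) = (y ^^ n) (t ((p ^ 2) ^ n \<bullet> (?\<tau> ^^ n) r \<bullet> b))"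
        by (simp only: yn tD ring_endoD[OF ring_endo_funpow[OF ring_endo_comp[OF endo1 endo2]]]
            funpow_fixpoint[of ?\<tau> p] e1 e2 fixed)
      finally show ?thesis by simp
    qed
    show ?case unfolding funpow.simps o_apply Suc.IH unfolding Y_def prod.case yD(1) 1 2
      by (simp add: scale_left_distrib tD(1) yn(1) add.assoc mp)
  qed (simp add: tD)
  note pw = this
  show ?thesis
  proof (cases v)
    case (Pair a b)
    have "(y ^^ (N - 1)) (t (0 \<bullet> b)) = 0" by (simp add: tD yn)
    then show ?thesis unfolding Pair pw rN by (simp add: yN pact_def w del: scale_zero_left)
  qed
qed

end

text \<open>
  The scalars of a straightening with \<open>[x\<^sub>1x\<^sub>1x\<^sub>2] = l\<close> and \<open>x\<^sub>2\<^sup>2 = u\<close>, in which \<open>x\<^sub>1\<^sub>2x\<^sub>2 + p x\<^sub>2x\<^sub>1\<^sub>2 = x\<^sub>1 r\<close>,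
  \<open>x\<^sub>1\<^sub>2\<^sup>2 = x\<^sub>1\<^sup>2 e + x\<^sub>2 b\<close>, and \<open>s\<close> is the constant term of \<open>x\<^sub>1\<^sub>2x\<^sub>2x\<^sub>1\<^sub>2\<close>.
\<close>

locale quad_scalars =
  fixes \<tau>1 \<tau>2 :: "'r::comm_ring_1 \<Rightarrow> 'r" and p q u l b e r s :: 'r
  assumes endo1: "ring_endo \<tau>1" and endo2: "ring_endo \<tau>2" and comm: "\<And>k. \<tau>2 (\<tau>1 k) = \<tau>1 (\<tau>2 k)"
    and fixed: "\<tau>1 p = p" "\<tau>2 p = p" "\<tau>1 q = q" "\<tau>2 q = q"
    and u_fix: "\<tau>2 u = u" and u_central: "u = 0 \<and> e = 0 \<or> (\<forall>k. \<tau>2 (\<tau>2 k) = k)"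
    and l_central: "l = 0 \<and> b = 0 \<or> (\<forall>k. \<tau>1 (\<tau>1 (\<tau>2 k)) = k)"
    and r: "r = u - p * p * \<tau>1 u" and s: "s = l * \<tau>1 u - p * p * u * l - p * u * b"
    and e: "p * (1 + q) * e = r - q * p * p * \<tau>1 r" and e1': "q * q * p * p * \<tau>1 e = e"
    and b: "q * q * p * \<tau>1 b = b"
    and l2: "\<tau>2 l = - (p * p * l) - p * (1 + q) * b"
    and l12: "\<tau>1 (\<tau>2 l) = b - q * p * l"
    and l122: "\<tau>1 (\<tau>2 (\<tau>2 l)) = q * p * p * (p * l + b)"
    and s1: "s + q * p * \<tau>1 l * \<tau>1 r - q * p * p * r * l - q * p * r * b - q * q * p * p * p * \<tau>1 s = 0"
begin

lemmas e1 = ring_endoD[OF endo1]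
lemmas e2 = ring_endoD[OF endo2]

end

locale ore_quad = module act + quad_scalars \<tau>1 \<tau>2 p q u l b e r s
  for act :: "'r::comm_ring_1 \<Rightarrow> 'v::ab_group_add \<Rightarrow> 'v"  (infixr \<open>\<bullet>\<close> 75)
    and \<tau>1 \<tau>2 p q u l b e r s +
  fixes t :: "'v \<Rightarrow> 'v"
  assumes t: "semilin act \<tau>1 t"
begin

lemmas tD = semilinD[OF t]

text \<open>A quadruple stands for \<open>v\<^sub>0\<^sub>0 + x\<^sub>2 v\<^sub>1\<^sub>0 + x\<^sub>1\<^sub>2 v\<^sub>0\<^sub>1 + x\<^sub>2x\<^sub>1\<^sub>2 v\<^sub>1\<^sub>1\<close>.\<close>

type_synonym (in -) 'a quad = "'a \<times> 'a \<times> 'a \<times> 'a"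

definition qact :: "'r \<Rightarrow> 'v quad \<Rightarrow> 'v quad"
  where "qact k = (\<lambda>(v00, v10, v01, v11).
    (k \<bullet> v00, \<tau>2 k \<bullet> v10, \<tau>1 (\<tau>2 k) \<bullet> v01, \<tau>1 (\<tau>2 (\<tau>2 k)) \<bullet> v11))"
text \<open>On x2 x12 v the product x1 x2 x12 equals p x2 x1 x12 + x12^2. Inserting x1 x12 = qp x12
  x1 + l and x12^2 = x1^2 e + x2 b gives the terms with \<open>e\<close> and
  \<open>p * l + b\<close>.\<close>

definition X1 :: "'v quad \<Rightarrow> 'v quad"
  where "X1 = (\<lambda>(v00, v10, v01, v11).
    (t v00 + l \<bullet> v01 + t (t (e \<bullet> v11)), p \<bullet> t v10 + (p * l + b) \<bullet> v11,
     (q * p) \<bullet> t v01 + v10, (q * p * p) \<bullet> t v11))"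
definition X2 :: "'v quad \<Rightarrow> 'v quad"
  where "X2 = (\<lambda>(v00, v10, v01, v11). (u \<bullet> v10, v00, \<tau>1 u \<bullet> v11, v01))"
text \<open>Obtained from x12 x2 = x1 r - p x2 x12 and x12^2 = x1^2 e + x2 b. On x2 x12 v both are
  needed, and \<open>s\<close> is chosen so that x1 x2 = p x2 x1 + x12 holds there as well.\<close>

definition Y :: "'v quad \<Rightarrow> 'v quad"
  where "Y = (\<lambda>(v00, v10, v01, v11).
    (t (r \<bullet> v10) + s \<bullet> v11 + t (t (e \<bullet> v01)), b \<bullet> v01 - p \<bullet> t (t (e \<bullet> v11)),
     v00 + (q * p) \<bullet> t (\<tau>1 r \<bullet> v11), - (p \<bullet> v10)))"

lemmas defs = qact_def X1_def X2_def Y_def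

lemma qact_module: "Modules.module qact"
  by unfold_locales (auto simp: qact_def scale_right_distrib scale_left_distrib e1 e2)

lemma X2_semilin: "semilin qact \<tau>2 X2"
proof -
  have 1: "u * \<tau>2 (\<tau>2 k) = u * k" for k using u_central by auto
  have 2: "\<tau>1 u * \<tau>1 (\<tau>2 (\<tau>2 k)) = \<tau>1 u * \<tau>1 k" for k using 1[of k] by (metis e1(3))
  show ?thesis
    by (auto simp: semilin_def defs scale_right_distrib 1 2 mult.commute[of _ u] mult.commute[of _ "\<tau>1 u"])
qed

lemma X2_X2: "X2 (X2 v) = qact u v"
  by (cases v) (simp add: defs u_fix)

lemma X1_semilin: "semilin qact \<tau>1 X1"
  unfolding semilin_def
proof (intro conjI allI)
  have L: "c * \<tau>1 (\<tau>1 (\<tau>2 k)) = c * k" if "c = l \<or> c = p * l + b" for c k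
    using l_central that by auto
  have E: "e * \<tau>1 (\<tau>1 (\<tau>2 (\<tau>2 k))) = e * \<tau>1 (\<tau>1 k)" for k using u_central by auto
  have c: "k \<bullet> c \<bullet> t v = c \<bullet> t (\<tau>1 k \<bullet> v)" for k c v
    unfolding scale_left_commute[of k c] tD(2)[of k] ..
  show "qact k (X1 v) = X1 (qact (\<tau>1 k) v)" for k v
  proof -
    obtain a b' c' d where v: "v = (a, b', c', d)" by (cases v)
    have 1: "k \<bullet> l \<bullet> w = l \<bullet> \<tau>1 (\<tau>1 (\<tau>2 k)) \<bullet> w" for w
      using L[of l k] by (simp add: mult.commute)
    have 2: "\<tau>2 k \<bullet> (p * l + b) \<bullet> w = (p * l + b) \<bullet> \<tau>1 (\<tau>1 (\<tau>2 (\<tau>2 k))) \<bullet> w" for w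
      using L[of "p * l + b" "\<tau>2 k"] by (simp add: mult.commute)
    have 3: "k \<bullet> t (t (e \<bullet> w)) = t (t (e \<bullet> \<tau>1 (\<tau>1 (\<tau>2 (\<tau>2 k))) \<bullet> w))" for w
      using E[of k] by (simp add: tD mult.commute)
    show ?thesis by (simp only: v defs prod.case scale_right_distrib 1 2 3 c comm) (simp only: tD(2))
  qed
qed (auto simp: defs tD scale_right_distrib)

lemma quad_eqI:
  fixes F G :: "'v quad \<Rightarrow> 'v quad"
  assumes F: "\<And>v w. F (v + w) = F v + F w" and G: "\<And>v w. G (v + w) = G v + G w"
    and eq: "\<And>x. F (x, 0, 0, 0) = G (x, 0, 0, 0)" "\<And>x. F (0, x, 0, 0) = G (0, x, 0, 0)"
      "\<And>x. F (0, 0, x, 0) = G (0, 0, x, 0)" "\<And>x. F (0, 0, 0, x) = G (0, 0, 0, x)"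
  shows "F v = G v"
proof -
  obtain a b c d where v: "v = (a, b, c, d)" by (cases v)
  have "(a, b, c, d) = (a, 0, 0, 0) + ((0, b, 0, 0) + ((0, 0, c, 0) + (0, 0, 0, d)))" by simp
  then show ?thesis unfolding v by (simp only: F G eq)
qed

lemma add: "X1 (v + w) = X1 v + X1 w" "X2 (v + w) = X2 v + X2 w" "Y (v + w) = Y v + Y w"
  "qact k (v + w) = qact k v + qact k w"
proof -
  obtain a b' c d where v: "v = (a, b', c, d)" by (cases v)
  obtain a' b'' c' d' where w: "w = (a', b'', c', d')" by (cases w)
  show "X1 (v + w) = X1 v + X1 w" "X2 (v + w) = X2 v + X2 w" "Y (v + w) = Y v + Y w"
    "qact k (v + w) = qact k v + qact k w"
    by (simp_all add: v w defs tD(1) scale_right_distrib)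
qed

lemma cong_act: "k = k' \<Longrightarrow> k \<bullet> v = k' \<bullet> v" and cong_t: "v = w \<Longrightarrow> t v = t w"
  by simp_all

lemmas nf = defs tD scale_right_distrib scale_right_diff_distrib fixed e1 e2
lemmas fl = tD(1)[symmetric] tD(5)[symmetric] scale_left_distrib[symmetric] scale_left_diff_distrib[symmetric]

text \<open>Substituting e = q^2 p^2 \<tau>1(e) on the left and pulling \<tau>1 out brings the
  equation for \<open>e\<close> into the form in which it appears on the component x2 x12.\<close>

lemma e_twisted: "p * (1 + q) * e = q * q * p * p * (\<tau>1 r - q * p * p * \<tau>1 (\<tau>1 r))"
proof -
  have "p * (1 + q) * e = p * (1 + q) * (q * q * p * p * \<tau>1 e)" by (simp only: e1')
  also have "\<dots> = q * q * p * p * \<tau>1 (p * (1 + q) * e)" by (simp add: e1 fixed mult_ac)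
  also have "\<dots> = q * q * p * p * (\<tau>1 r - q * p * p * \<tau>1 (\<tau>1 r))"
    unfolding e by (simp add: e1 fixed)
  finally show ?thesis .
qed

text \<open>These are the equalities of coefficients behind the commutation rules: the first three
  compare x1 x2 with p x2 x1 + x12, the others x1 x12 with qp x12 x1 + l, each on one component of a
  quadruple.\<close>

lemma scalar_eqs:
  "u = p * (\<tau>1 u * p) + r" (is ?e1)
  "l * \<tau>1 u = p * (u * (p * l + b)) + s" (is ?e2)
  "q * p * \<tau>1 u = p * (\<tau>1 (\<tau>1 u) * (q * p * p)) + q * p * \<tau>1 r" (is ?e3)
  "r - e * p = q * p * (\<tau>1 r * p) + q * p * e" (is ?e4)
  "- ((p * l + b) * p) = q * p * b + \<tau>2 l" (is ?e5)
  "e = q * p * (\<tau>1 e * (q * p))" (is ?e6)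
  "p * b = q * p * (\<tau>1 b * (q * p))" (is ?e7)
  "b = q * p * l + \<tau>1 (\<tau>2 l)" (is ?e8)
  "s + \<tau>1 l * (q * p * \<tau>1 r) = q * p * (r * (p * l + b)) + q * p * (\<tau>1 s * (q * p * p))" (is ?e9)
  "p * (p * e) = q * p * (p * \<tau>1 e * (q * p * p))" (is ?e10)
  "q * p * (q * p * \<tau>1 r) - p * e = q * p * e + q * p * (q * p * \<tau>1 (\<tau>1 r) * (q * p * p))" (is ?e11)
  "\<tau>1 (\<tau>2 (\<tau>2 l)) = q * p * (p * (p * l + b))" (is ?e12)
proof -
  show ?e1 using r by (simp add: algebra_simps)
  show ?e2 using s by (simp add: algebra_simps)
  show ?e3
    unfolding r by (simp add: e1 fixed algebra_simps)
  show ?e4 using e by (simp add: algebra_simps)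
  show ?e5 unfolding l2 by (simp add: algebra_simps)
  show ?e6 using e1' by (simp add: mult_ac)
  then show ?e10 by (metis mult.assoc mult.commute)
  show ?e7 using arg_cong[OF b, of "(*) p"] by (simp add: mult_ac)
  show ?e8 using l12 by (simp add: algebra_simps)
  show ?e9
    using s1 by (simp add: algebra_simps)
  show ?e11
    using e_twisted by (simp add: algebra_simps)
  show ?e12 using l122 by (simp add: mult_ac)
qed

lemma X1_X2: "X1 (X2 v) = qact p (X2 (X1 v)) + Y v"
proof (rule quad_eqI[where F = "\<lambda>v. X1 (X2 v)" and G = "\<lambda>v. qact p (X2 (X1 v)) + Y v" and v = v])
  fix x
  show "X1 (X2 (x, 0, 0, 0)) = qact p (X2 (X1 (x, 0, 0, 0))) + Y (x, 0, 0, 0)"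
    "X1 (X2 (0, x, 0, 0)) = qact p (X2 (X1 (0, x, 0, 0))) + Y (0, x, 0, 0)"
    "X1 (X2 (0, 0, x, 0)) = qact p (X2 (X1 (0, 0, x, 0))) + Y (0, 0, x, 0)"
    "X1 (X2 (0, 0, 0, x)) = qact p (X2 (X1 (0, 0, 0, x))) + Y (0, 0, 0, x)"
    by (simp add: nf; (simp add: fl scale_minus_left[symmetric] del: scale_minus_left)?; (intro conjI cong_t cong_act; (fact scalar_eqs | simp))?)+
qed (simp_all add: add)

lemma X1_Y: "X1 (Y v) = qact (q * p) (Y (X1 v)) + qact l v"
proof (rule quad_eqI[where F = "\<lambda>v. X1 (Y v)" and G = "\<lambda>v. qact (q * p) (Y (X1 v)) + qact l v" and v = v])
  fix x
  show "X1 (Y (x, 0, 0, 0)) = qact (q * p) (Y (X1 (x, 0, 0, 0))) + qact l (x, 0, 0, 0)"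
    "X1 (Y (0, x, 0, 0)) = qact (q * p) (Y (X1 (0, x, 0, 0))) + qact l (0, x, 0, 0)"
    "X1 (Y (0, 0, x, 0)) = qact (q * p) (Y (X1 (0, 0, x, 0))) + qact l (0, 0, x, 0)"
    "X1 (Y (0, 0, 0, x)) = qact (q * p) (Y (X1 (0, 0, 0, x))) + qact l (0, 0, 0, x)"
    by (simp add: nf; (simp add: fl scale_minus_left[symmetric] del: scale_minus_left)?; (intro conjI cong_t cong_act; (fact scalar_eqs | simp))?)+
qed (simp_all add: add)

lemma Y_semilin: "semilin qact (\<lambda>k. \<tau>1 (\<tau>2 k)) Y"
  unfolding semilin_def
proof (intro conjI allI)
  interpret Q: Modules.module qact by (rule qact_module)
  have Y: "Y v = X1 (X2 v) - qact p (X2 (X1 v))" for v by (simp add: X1_X2)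
  show "qact k (Y v) = Y (qact (\<tau>1 (\<tau>2 k)) v)" for k v
    unfolding Y Q.scale_right_diff_distrib Q.scale_left_commute[of k p]
    by (simp only: semilinD(2)[OF X1_semilin, of k] semilinD(2)[OF X2_semilin, of "\<tau>1 k"]
        semilinD(2)[OF X2_semilin, of k] semilinD(2)[OF X1_semilin, of "\<tau>2 k"] comm)
qed (rule add)

lemma X1_embed: "(X1 ^^ n) (v, 0, 0, 0) = ((t ^^ n) v, 0, 0, 0)"
  by (induction n) (simp_all add: X1_def tD)

text \<open>X1^N passes both \<open>X2\<close> and \<open>Y\<close> with a mere power of p and q,
  since the error sums in \<open>qN\<close> and \<open>lN\<close> vanish; so does the scalar
  \<open>w\<close>. Every quadruple is obtained from vectors (v, 0, 0, 0) by \<open>X2\<close> and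
  \<open>Y\<close>, and on those vectors \<open>X1\<close> is \<open>t\<close>.\<close>

lemma X1_pow:
  assumes tN: "\<And>v. (t ^^ N) v = w \<bullet> v" and w: "\<tau>1 w = w" "\<tau>2 w = p ^ N * w"
    and qN: "qn q N = 0" "q ^ N = 1" and lN: "(\<Sum>i<N. (q * p) ^ i * (\<tau>1 ^^ i) l) = 0"
      "(\<Sum>j<N. p ^ (j - 1) * qn q j * (\<tau>1 ^^ (j - 1)) l) = 0"
  shows "(X1 ^^ N) v = qact w v"
proof -
  interpret Q: Modules.module qact by (rule qact_module)
  have zero: "(X1 ^^ n) (qact 0 v) = 0" for n v
    using semilinD(3)[OF semilin_pow[OF X1_semilin]] by simp
  have PY: "(X1 ^^ N) (Y v) = qact ((q * p) ^ N) (Y ((X1 ^^ N) v))" for v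
    unfolding Q.semilin_funpow_mul[where Q = Y, OF X1_semilin endo1 _ X1_Y, simplified e1 fixed, OF refl] lN zero
    by simp
  have PX: "(X1 ^^ N) (X2 v) = qact (p ^ N) (X2 ((X1 ^^ N) v))" for v
    unfolding Q.semilin_funpow_mul2[where Q = X2 and R = Y, OF X1_semilin endo1 fixed(1,3) X1_X2 X1_Y] lN qN(1) zero
    by simp
  have WX: "qact w (X2 v) = qact (p ^ N) (X2 (qact w v))" for v
  proof -
    have "qact w (X2 v) = X2 (qact (p ^ N) (qact w v))"
      by (simp add: semilinD(2)[OF X2_semilin] w)
    also have "\<dots> = qact (p ^ N) (X2 (qact w v))"
      by (rule semilin_fixed[OF X2_semilin]) (simp add: e2 fixed)
    finally show ?thesis .
  qed
  have WY: "qact w (Y v) = qact ((q * p) ^ N) (Y (qact w v))" for v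
  proof -
    have "\<tau>1 (\<tau>2 w) = (q * p) ^ N * w" using w qN by (simp add: e1 fixed power_mult_distrib)
    then have "qact w (Y v) = Y (qact ((q * p) ^ N) (qact w v))"
      by (simp add: semilinD(2)[OF Y_semilin])
    also have "\<dots> = qact ((q * p) ^ N) (Y (qact w v))"
      by (rule semilin_fixed[OF Y_semilin]) (simp add: e1 e2 fixed)
    finally show ?thesis .
  qed
  obtain a b' c d where v: "v = (a, b', c, d)" by (cases v)
  have "v = (a, 0, 0, 0) + X2 (b', 0, 0, 0) + Y (c, 0, 0, 0) + X2 (Y (d, 0, 0, 0))"
    by (simp add: v X2_def Y_def tD)
  moreover have "(X1 ^^ N) (x, 0, 0, 0) = qact w (x, 0, 0, 0)" for x
    by (simp add: X1_embed tN qact_def)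
  ultimately show ?thesis
    by (simp only: semilinD(1)[OF semilin_pow[OF X1_semilin]] add PX PY WX WY)
qed

end

section \<open>The group algebra and its twists by characters\<close>

lemma poly_mapping_single_induct [case_names zero single add]:
  assumes "P 0" "\<And>h c. P (single h c)" "\<And>a b. P a \<Longrightarrow> P b \<Longrightarrow> P (a + b)"
  shows "P (a :: 'g \<Rightarrow>\<^sub>0 'k::field)"
proof (induction a rule: update_induct)
  case const
  then show ?case by (simp add: assms(1))
next
  case (update f x b)
  have "Poly_Mapping.update x b f = f + single x b"
    using update by (intro poly_mapping_eqI)
      (auto simp: lookup_update lookup_add lookup_single in_keys_iff when_def)
  then show ?case using assms update by simp
qed

definition twist :: "('g \<Rightarrow> 'k) \<Rightarrow> ('g \<Rightarrow>\<^sub>0 'k::field) \<Rightarrow> 'g \<Rightarrow>\<^sub>0 'k"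
  where "twist \<psi> = Poly_Mapping.mapp (\<lambda>h r. \<psi> h * r)"

lemma lookup_twist: "lookup (twist \<psi> k) h = \<psi> h * lookup k h"
  by (simp add: twist_def lookup_mapp when_def in_keys_iff)

lemma twist_single: "twist \<psi> (single h r) = single h (\<psi> h * r)"
  by (intro poly_mapping_eqI) (simp add: lookup_twist lookup_single when_def)

lemma twist_add: "twist \<psi> (a + b) = twist \<psi> a + twist \<psi> b"
  by (intro poly_mapping_eqI) (simp add: lookup_twist lookup_add algebra_simps)

lemma twist_twist: "twist \<psi> (twist \<phi> k) = twist (\<lambda>h. \<psi> h * \<phi> h) k"
  by (intro poly_mapping_eqI) (simp add: lookup_twist mult_ac)

lemma twist_id: "(\<And>h. \<psi> h = 1) \<Longrightarrow> twist \<psi> k = k"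
  by (intro poly_mapping_eqI) (simp add: lookup_twist)

lemma twist_pow: "(twist \<psi> ^^ n) k = twist (\<lambda>h. \<psi> h ^ n) k"
  by (induction n) (simp_all add: twist_twist twist_id)

lemma twist_0 [simp]: "twist \<psi> 0 = 0"
  by (intro poly_mapping_eqI) (simp add: lookup_twist)

lemma ring_endo_twist:
  fixes \<psi> :: "'g::ab_group_add \<Rightarrow> 'k::field"
  assumes "character \<psi>"
  shows "ring_endo (twist \<psi>)"
proof -
  have "twist \<psi> (a * b) = twist \<psi> a * twist \<psi> b" for a b
  proof (induction a rule: poly_mapping_single_induct)
    case (single h c)
    show ?case
      by (induction b rule: poly_mapping_single_induct)
        (use assms in \<open>simp_all add: mult_single twist_single twist_add distrib_left distrib_right character_def mult_ac\<close>)
  qed (simp_all add: twist_add distrib_right)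
  moreover have "twist \<psi> 1 = 1"
    using twist_single[of \<psi> 0 1] character_zero[OF assms] by simp
  ultimately show ?thesis by (simp add: ring_endo_def twist_add)
qed

lemma twist_commute: "twist \<psi> (twist \<phi> k) = twist \<phi> (twist \<psi> k)"
  by (simp add: twist_twist mult.commute)

abbreviation cst :: "'k::zero \<Rightarrow> ('g::zero) \<Rightarrow>\<^sub>0 'k"
  where "cst \<equiv> single 0"

section \<open>Linear independence from a representation\<close>

text \<open>The disjunction in \<open>rho_mul\<close> admits representations and
  anti-representations alike; in both the operators that vanish form a two-sided ideal. For an
  anti-representation \<open>\<sigma>\<close> is inversion.\<close>

locale algebra_op = smash \<chi> + module act
  for \<chi> :: "letter \<Rightarrow> 'g::ab_group_add \<Rightarrow> 'k::field"
    and act :: "('g \<Rightarrow>\<^sub>0 'k) \<Rightarrow> 'v::ab_group_add \<Rightarrow> 'v"  (infixr \<open>\<bullet>\<close> 75) +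
  fixes \<rho> :: "('g, 'k) smash \<Rightarrow> 'v \<Rightarrow> 'v" and \<sigma> :: "'g \<Rightarrow> 'g"
  assumes rho_add: "\<rho> (a + b) v = \<rho> a v + \<rho> b v" and rho_lin: "\<rho> a (v + w) = \<rho> a v + \<rho> a w"
    and rho_single: "\<rho> (single (x, h) r) v = cst r \<bullet> \<rho> (single (x, h) 1) v"
    and rho_grp: "\<rho> (grp h) v = single (\<sigma> h) 1 \<bullet> v"
    and sigma_0: "\<sigma> 0 = 0"
    and rho_mul: "(\<forall>a b v. \<rho> (a \<star> b) v = \<rho> a (\<rho> b v)) \<or> (\<forall>a b v. \<rho> (a \<star> b) v = \<rho> b (\<rho> a v))"
begin

lemma rho_0 [simp]: "\<rho> 0 v = 0" "\<rho> a 0 = 0"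
  using rho_add[of 0 0 v] rho_lin[of a 0 0] by simp_all

lemma rho_minus: "\<rho> (- a) v = - \<rho> a v"
  using rho_add[of a "- a" v] by (simp add: eq_neg_iff_add_eq_0 add.commute)

lemma rho_diff: "\<rho> (a - b) v = \<rho> a v - \<rho> b v"
  using rho_add[of a "- b" v] by (simp add: rho_minus)

lemma rho_sc: "\<rho> (sc r) v = cst r \<bullet> v"
  using rho_single[of "[]" 0 r v] rho_grp[of 0 v] by (simp add: sc_def grp_def sigma_0)

lemma rho_scl: "\<rho> (r \<cdot> a) v = cst r \<bullet> \<rho> a v"
proof (induction a rule: smash_induct)
  case (single w h c)
  show ?case unfolding scl_single
    by (subst (1 2) rho_single) (simp add: mult_single)
qed (simp_all add: scl_right rho_add scale_right_distrib)

lemma rho_pow: "\<rho> (a \<up> n) v = (\<rho> a ^^ n) v"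
proof (induction n arbitrary: v)
  case 0
  show ?case by (simp add: rho_sc)
next
  case (Suc n)
  from rho_mul show ?case
  proof
    assume "\<forall>a b v. \<rho> (a \<star> b) v = \<rho> a (\<rho> b v)"
    then show ?thesis unfolding A_pow_Suc2 by (simp add: Suc)
  next
    assume "\<forall>a b v. \<rho> (a \<star> b) v = \<rho> b (\<rho> a v)"
    then show ?thesis unfolding A_pow_Suc by (simp add: Suc)
  qed
qed

lemma rho_dpow: "\<rho> (dpow g \<chi> w n) v = (1 - single (\<sigma> (gpow (wdeg g w) n)) 1) \<bullet> v"
  by (simp add: dpow_def rho_diff rho_sc rho_grp scale_left_diff_distrib)

lemma kernel_ideal: "ideal {a. \<forall>v. \<rho> a v = 0} A"
proof (rule idealI[OF ring_A])
  show "subgroup {a. \<forall>v. \<rho> a v = 0} (add_monoid A)"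
  proof (rule group.subgroupI)
    interpret Ring.ring A by (rule ring_A)
    show "group (add_monoid A)" by (rule a_group)
    fix a assume "a \<in> {a. \<forall>v. \<rho> a v = 0}"
    moreover have "inv\<^bsub>add_monoid A\<^esub> a = - a"
      by (rule group.inv_equality[OF a_group]) simp_all
    ultimately show "inv\<^bsub>add_monoid A\<^esub> a \<in> {a. \<forall>v. \<rho> a v = 0}" by (simp add: rho_minus)
  qed (auto simp: rho_add intro: exI[of _ 0])
qed (use rho_mul in auto)

lemma rho_ideal:
  assumes "a \<in> Idl\<^bsub>A\<^esub> S" "\<And>s v. s \<in> S \<Longrightarrow> \<rho> s v = 0"
  shows "\<rho> a v = 0"
  using ring.genideal_minimal[OF ring_A kernel_ideal, of S] assms by auto

end

section \<open>Bases of the quotient algebra\<close>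

context pbw_order
begin

lemma I_coset: "I +>\<^bsub>A\<^esub> a = I +>\<^bsub>A\<^esub> b \<longleftrightarrow> a - b \<in> I"
proof -
  interpret Ring.ring A by (rule ring_A)
  have "a \<ominus>\<^bsub>A\<^esub> b = a - b"
    using minus_equality[of "- b" b] by (simp add: minus_eq)
  then show ?thesis using quotient_eq_iff_same_a_r_cos[OF ideal_I, of a b] by auto
qed

lemma quot_add: "(I +>\<^bsub>A\<^esub> a) \<oplus>\<^bsub>quot_algebra A I\<^esub> (I +>\<^bsub>A\<^esub> b) = I +>\<^bsub>A\<^esub> (a + b)"
  using ideal.a_rcos_sum[OF ideal_I, of a b] by (simp add: quot_algebra_def FactRing_def)

lemma quot_zero: "\<zero>\<^bsub>quot_algebra A I\<^esub> = I +>\<^bsub>A\<^esub> 0"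
  using ring.a_rcos_zero[OF ring_A ideal_I I_zero] by (simp add: quot_algebra_def FactRing_def)

lemma quot_carrier: "carrier (quot_algebra A I) = range (\<lambda>a. I +>\<^bsub>A\<^esub> a)"
  by (auto simp: quot_algebra_def FactRing_def A_RCOSETS_def')

lemma quot_monoid: "abelian_monoid (quot_algebra A I)"
proof -
  interpret Q: Ring.ring "A Quot I" by (rule ideal.quotient_is_ring[OF ideal_I])
  show ?thesis
  proof (rule abelian_monoidI)
    fix x y assume "x \<in> carrier (quot_algebra A I)" "y \<in> carrier (quot_algebra A I)"
    then show "x \<oplus>\<^bsub>quot_algebra A I\<^esub> y = y \<oplus>\<^bsub>quot_algebra A I\<^esub> x"
      using Q.a_comm[of x y] by (simp add: quot_algebra_def)
  qed (auto simp: quot_algebra_def Q.a_assoc)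
qed

lemma quot_finsum:
  "finite K \<Longrightarrow> (\<Oplus>\<^bsub>quot_algebra A I\<^esub>j\<in>K. I +>\<^bsub>A\<^esub> f j) = I +>\<^bsub>A\<^esub> (\<Sum>j\<in>K. f j)"
proof (induction K rule: finite_induct)
  case empty
  show ?case using abelian_monoid.finsum_empty[OF quot_monoid] by (simp add: quot_zero)
next
  case (insert j K)
  have "(\<Oplus>\<^bsub>quot_algebra A I\<^esub>i\<in>insert j K. I +>\<^bsub>A\<^esub> f i) =
      (I +>\<^bsub>A\<^esub> f j) \<oplus>\<^bsub>quot_algebra A I\<^esub> (\<Oplus>\<^bsub>quot_algebra A I\<^esub>i\<in>K. I +>\<^bsub>A\<^esub> f i)"
    by (rule abelian_monoid.finsum_insert[OF quot_monoid]) (use insert in \<open>auto simp: quot_carrier\<close>)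
  then show ?case using insert by (simp add: quot_add)
qed

lemma quot_lin_comb:
  "lin_comb (quot_algebra A I) (\<lambda>j. I +>\<^bsub>A\<^esub> mono j) c =
    I +>\<^bsub>A\<^esub> comb c"
  unfolding lin_comb_def smult_quot_algebra[OF char1 char2 ideal_I] A_smult
  by (rule quot_finsum) simp

lemma is_basis_quot:
  assumes "\<And>c. keys c \<subseteq> J \<Longrightarrow>
    comb c \<in> I \<Longrightarrow> c = 0"
  shows "is_basis (quot_algebra A I) J (\<lambda>j. I +>\<^bsub>A\<^esub> mono j)"
  unfolding is_basis_def quot_lin_comb quot_carrier quot_zero I_coset
proof (intro conjI ballI allI impI)
  fix v assume "v \<in> range (\<lambda>a. I +>\<^bsub>A\<^esub> a)"
  then obtain a where a: "v = I +>\<^bsub>A\<^esub> a" by blast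
  obtain c where c: "keys c \<subseteq> J"
    "a - comb c \<in> I"
    using spanning by blast
  then show "\<exists>c. keys c \<subseteq> J \<and>
      I +>\<^bsub>A\<^esub> comb c = v"
    unfolding a I_coset[of _ a]
    using I_minus[OF c(2)] by (intro exI[of _ c] conjI c(1)) simp
qed (use assms in auto)

end

text \<open>The maps \<open>\<pi>\<close> recover the exponents, and the group algebra recovers the
  group element. The unit \<open>d\<close> allows for the character values that arise when a group
  element is moved past letters.\<close>

locale pbw_op = pbw_order \<chi> I y p s s' N1 N12 N2 + algebra_op \<chi> act \<rho> \<sigma>
  for \<chi> :: "letter \<Rightarrow> 'g::ab_group_add \<Rightarrow> 'k::field" and I y p s s' N1 N12 N2
    and act :: "('g \<Rightarrow>\<^sub>0 'k) \<Rightarrow> 'v::ab_group_add \<Rightarrow> 'v"  (infixr \<open>\<bullet>\<close> 75) and \<rho> \<sigma> +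
  fixes S :: "('g, 'k) smash set" and v0 :: 'v and \<pi> :: "nat \<times> nat \<times> nat \<Rightarrow> 'v \<Rightarrow> ('g \<Rightarrow>\<^sub>0 'k)"
    and d :: "nat \<times> nat \<times> nat \<times> 'g \<Rightarrow> 'k"
  assumes I_gen: "I = Idl\<^bsub>smash_alg \<chi>\<^esub> S" and rho_S: "\<And>a v. a \<in> S \<Longrightarrow> \<rho> a v = 0"
    and pi_add: "\<And>j v w. \<pi> j (v + w) = \<pi> j v + \<pi> j w"
    and pi_scl: "\<And>j r v. \<pi> j (cst r \<bullet> v) = cst r * \<pi> j v"
    and sigma_inj: "inj \<sigma>"
    and pi_mono: "\<And>a b c h a' b' c'. (a, b, c, h) \<in> pbw_order.J N1 N12 N2 \<Longrightarrow>
      (a', b', c', 0::'g) \<in> pbw_order.J N1 N12 N2 \<Longrightarrow>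
      \<pi> (a', b', c') (\<rho> (pbw_order.mono \<chi> y (a, b, c, h)) v0) =
      (if (a', b', c') = (a, b, c) then single (\<sigma> h) (d (a, b, c, h)) else 0)"
    and d: "\<And>j. d j \<noteq> 0"
begin

lemma basis: "is_basis (quot_algebra A I) J (\<lambda>j. I +>\<^bsub>A\<^esub> mono j)"
proof (rule is_basis_quot)
  fix c assume c: "keys c \<subseteq> J"
    and I: "comb c \<in> I"
  have pi0: "\<pi> j 0 = 0" for j using pi_add[of j 0 0] by simp
  have rs: "\<rho> (sum f K) v0 = (\<Sum>j\<in>K. \<rho> (f j) v0)" for f and K :: "'i set"
    by (induction K rule: infinite_finite_induct) (simp_all add: rho_add)
  have ps: "\<pi> j (sum f K) = (\<Sum>i\<in>K. \<pi> j (f i))" for f and K :: "'i set" and j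
    by (induction K rule: infinite_finite_induct) (simp_all add: pi_add pi0)
  show "c = 0"
  proof (rule ccontr)
    assume "c \<noteq> 0"
    then obtain j where j: "j \<in> keys c"
      by (metis in_keys_iff lookup_zero poly_mapping_eqI)
    obtain a b e h where jj: "j = (a, b, e, h)" by (cases j)
    have J': "(a, b, e, 0) \<in> J" using j c jj by (auto simp: J_def)
    have "0 = \<pi> (a, b, e) (\<rho> (comb c) v0)"
      using rho_ideal[OF I[unfolded I_gen] rho_S] by (simp add: pi0)
    also have "\<dots> = (\<Sum>i\<in>keys c. cst (lookup c i) * \<pi> (a, b, e) (\<rho> (mono i) v0))"
      by (simp add: rs ps rho_scl pi_scl)
    also have "\<dots> = (\<Sum>i\<in>keys c. case i of (a', b', e', h') \<Rightarrow>
        if (a', b', e') = (a, b, e) then single (\<sigma> h') (lookup c i * d i) else 0)"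
      using c by (intro sum.cong refl) (auto simp: pi_mono J' mult_single subset_iff)
    \<comment> \<open>Several monomials may share the exponents (a, b, e); the coefficient at
      \<open>\<sigma> h\<close> singles out the one with group element \<open>h\<close>, because
      \<open>\<sigma>\<close> is injective.\<close>
    finally have "0 = lookup \<dots> (\<sigma> h)" by simp
    also have "\<dots> = (\<Sum>i\<in>keys c. if i = j then lookup c j * d j else 0)"
      unfolding lookup_sum
      by (intro sum.cong refl) (auto simp: jj lookup_single when_def inj_eq[OF sigma_inj] split: if_splits)
    also have "\<dots> = lookup c j * d j" using j by simp
    finally show False using j d[of j] by (simp add: in_keys_iff)
  qed
qed

end

section \<open>Representations built from two semilinear operators\<close>

definition pbw_coords ::
    "(('g::comm_monoid_add \<Rightarrow>\<^sub>0 'k::field) \<Rightarrow> 'v::ab_group_add \<Rightarrow> 'v) \<Rightarrow> ('v \<Rightarrow> 'v) \<Rightarrow> ('v \<Rightarrow> 'v) \<Rightarrow> ('v \<Rightarrow> 'v) \<Rightarrow>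
      (nat \<Rightarrow> nat \<Rightarrow> nat \<Rightarrow> bool) \<Rightarrow> 'v \<Rightarrow> (nat \<times> nat \<times> nat \<Rightarrow> 'v \<Rightarrow> 'g \<Rightarrow>\<^sub>0 'k) \<Rightarrow> bool"
  where "pbw_coords act X1 X2 Y R v0 \<pi> \<longleftrightarrow>
    (\<forall>j v w. \<pi> j (v + w) = \<pi> j v + \<pi> j w) \<and> (\<forall>j r v. \<pi> j (act (cst r) v) = cst r * \<pi> j v) \<and>
    (\<forall>a b c a' b' c' k. R a b c \<longrightarrow> R a' b' c' \<longrightarrow>
      \<pi> (a', b', c') ((X2 ^^ a) ((Y ^^ b) ((X1 ^^ c) (act k v0)))) =
        (if (a', b', c') = (a, b, c) then k else 0))"

locale letters_rep = smash \<chi> + module act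
  for \<chi> :: "letter \<Rightarrow> 'g::ab_group_add \<Rightarrow> 'k::field"
    and act :: "('g \<Rightarrow>\<^sub>0 'k) \<Rightarrow> 'v::ab_group_add \<Rightarrow> 'v"  (infixr \<open>\<bullet>\<close> 75) +
  fixes X :: "letter \<Rightarrow> 'v \<Rightarrow> 'v"
  assumes X: "\<And>i. semilin act (twist (\<chi> i)) (X i)"
begin

lemma wchar_Cons: "wchar \<chi> (i # \<omega>) h = \<chi> i h * wchar \<chi> \<omega> h"
  by (simp add: wchar_def)

lemma twist_wchar: "twist (wchar \<chi> (i # \<omega>)) k = twist (wchar \<chi> \<omega>) (twist (\<chi> i) k)"
  by (simp add: twist_twist wchar_Cons[abs_def] mult.commute)

lemma foldr_semilin: "semilin act (twist (wchar \<chi> \<omega>)) (foldr X \<omega>)"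
proof (induction \<omega>)
  case Nil
  then show ?case by (simp add: semilin_def twist_id wchar_def)
next
  case (Cons i \<omega>)
  then show ?case
    using semilin_comp[OF X[of i] Cons] by (simp add: twist_wchar[abs_def] o_def)
qed

lemma fold_semilin: "semilin act (twist (wchar \<chi> \<omega>)) (fold X \<omega>)"
proof (induction \<omega>)
  case Nil
  then show ?case by (simp add: semilin_def twist_id wchar_def)
next
  case (Cons i \<omega>)
  then show ?case
    using semilin_comp[OF Cons X[of i]] by (simp add: twist_wchar[abs_def] o_def twist_commute[of "\<chi> i"])
qed

definition linext :: "(letter list \<Rightarrow> 'g \<Rightarrow> 'k \<Rightarrow> 'v) \<Rightarrow> ('g, 'k) smash \<Rightarrow> 'v"
  where "linext F a = (\<Sum>(\<omega>, h)\<in>keys a. F \<omega> h (lookup a (\<omega>, h)))"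

lemma linext_single: "(\<And>\<omega> h. F \<omega> h 0 = 0) \<Longrightarrow> linext F (single (\<omega>, h) r) = F \<omega> h r"
  by (simp add: linext_def)

lemma linext_add:
  assumes "\<And>\<omega> h. F \<omega> h 0 = 0" "\<And>\<omega> h r r'. F \<omega> h (r + r') = F \<omega> h r + F \<omega> h r'"
  shows "linext F (a + b) = linext F a + linext F b"
  using setsum_keys_plus_distrib[of "\<lambda>x r. F (fst x) (snd x) r" a b]
  by (simp add: linext_def case_prod_unfold assms)

definition rhoL :: "('g, 'k) smash \<Rightarrow> 'v \<Rightarrow> 'v"
  where "rhoL a v = linext (\<lambda>\<omega> h r. foldr X \<omega> (single h r \<bullet> v)) a"

text \<open>
  Right multiplication. Inverting the group elements turns the right action of the group algebra into one
  for which the same semilinear operators can be used.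
\<close>

definition rhoR :: "('g, 'k) smash \<Rightarrow> 'v \<Rightarrow> 'v"
  where "rhoR a v = linext (\<lambda>\<omega> h r. single (- h) r \<bullet> fold X \<omega> v) a"

lemma rhoL_single: "rhoL (single (\<omega>, h) r) v = foldr X \<omega> (single h r \<bullet> v)"
  unfolding rhoL_def by (rule linext_single) (simp add: semilinD(3)[OF foldr_semilin])

lemma rhoR_single: "rhoR (single (\<omega>, h) r) v = single (- h) r \<bullet> fold X \<omega> v"
  unfolding rhoR_def by (rule linext_single) simp

lemma rhoL_add: "rhoL (a + b) v = rhoL a v + rhoL b v"
  unfolding rhoL_def by (rule linext_add)
    (simp_all add: semilinD[OF foldr_semilin] single_add scale_left_distrib)

lemma rhoR_add: "rhoR (a + b) v = rhoR a v + rhoR b v"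
  unfolding rhoR_def by (rule linext_add) (simp_all add: single_add scale_left_distrib)

lemma rhoL_0: "rhoL 0 v = 0" and rhoR_0: "rhoR 0 v = 0"
  by (simp_all add: rhoL_def rhoR_def linext_def)

lemma rhoL_lin: "rhoL a (v + w) = rhoL a v + rhoL a w"
  by (induction a rule: smash_induct)
    (simp_all add: rhoL_0 rhoL_single rhoL_add scale_right_distrib semilinD(1)[OF foldr_semilin])

lemma rhoR_lin: "rhoR a (v + w) = rhoR a v + rhoR a w"
  by (induction a rule: smash_induct)
    (simp_all add: rhoR_0 rhoR_single rhoR_add scale_right_distrib semilinD(1)[OF fold_semilin])

lemma rhoR_zero: "rhoR a 0 = 0"
  using rhoR_lin[of a 0 0] by simp

lemma rhoL_mul: "rhoL (a \<star> b) v = rhoL a (rhoL b v)"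
proof (induction a rule: smash_induct)
  case (single \<omega> h r)
  show ?case
  proof (induction b rule: smash_induct)
    case (single \<omega>' h' r')
    have "single h r \<bullet> foldr X \<omega>' (single h' r' \<bullet> v)
      = foldr X \<omega>' (single (h + h') (r * r' * wchar \<chi> \<omega>' h) \<bullet> v)"
      by (simp add: semilinD(2)[OF foldr_semilin] twist_single mult_single mult_ac add.commute)
    then show ?case by (simp add: smash_mult_single rhoL_single)
  qed (simp_all add: mul_add rhoL_add rhoL_lin rhoL_single semilinD[OF foldr_semilin] rhoL_0 scale_right_distrib)
qed (simp_all add: mul_add rhoL_add rhoL_0)

text \<open>The factor \<chi>(h) in the product of the smash algebra cancels against the twist of
  the inverse -h, which is the reason for inverting group elements.\<close>

lemma rhoR_mul: "rhoR (a \<star> b) v = rhoR b (rhoR a v)"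
proof (induction a rule: smash_induct)
  case (single \<omega> h r)
  show ?case
  proof (induction b rule: smash_induct)
    case (single \<omega>' h' r')
    have "wchar \<chi> \<omega>' h * wchar \<chi> \<omega>' (- h) = 1"
      using wchar_add[OF char1 char2, of \<omega>' h "- h"] wchar_zero[OF char1 char2, of \<omega>'] by simp
    then have "single (- (h + h')) (r * r' * wchar \<chi> \<omega>' h) \<bullet> fold X \<omega>' w
      = single (- h') r' \<bullet> fold X \<omega>' (single (- h) r \<bullet> w)" for w
    proof -
      have "single (- (h + h')) (r * r' * wchar \<chi> \<omega>' h)
        = single (- h') r' * single (- h) (wchar \<chi> \<omega>' h * r)"
        by (simp add: mult_single mult_ac add.commute)
      moreover have "single (- h) (wchar \<chi> \<omega>' h * r) \<bullet> fold X \<omega>' w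
          = fold X \<omega>' (single (- h) r \<bullet> w)"
        using \<open>wchar \<chi> \<omega>' h * wchar \<chi> \<omega>' (- h) = 1\<close>
        by (simp add: semilinD(2)[OF fold_semilin] twist_single mult.commute mult.left_commute[of "wchar \<chi> \<omega>' (- h)"])
      ultimately show ?thesis by (metis scale_scale)
    qed
    then show ?case by (simp add: smash_mult_single rhoR_single)
  qed (simp_all add: mul_add rhoR_add rhoR_0)
qed (simp_all add: mul_add rhoR_add rhoR_lin rhoR_0 rhoR_zero)

lemma rhoL_var: "rhoL (var i) v = X i v" and rhoR_var: "rhoR (var i) v = X i v"
  by (simp_all add: var_def rhoL_single rhoR_single)

sublocale L: algebra_op \<chi> act rhoL "\<lambda>h. h"
proof
  show "rhoL (single (\<omega>, h) r) v = cst r \<bullet> rhoL (single (\<omega>, h) 1) v" for \<omega> h r v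
    using funpow_fixpoint[of "\<lambda>x. x"]
    by (simp add: rhoL_single semilinD(2)[OF foldr_semilin] twist_single wchar_zero[OF char1 char2] mult_single)
qed (use rhoL_mul in \<open>simp_all add: rhoL_add rhoL_lin grp_def rhoL_single\<close>)

sublocale R: algebra_op \<chi> act rhoR uminus
proof
  show "rhoR (single (\<omega>, h) r) v = cst r \<bullet> rhoR (single (\<omega>, h) 1) v" for \<omega> h r v
    by (simp add: rhoR_single mult_single)
qed (use rhoR_mul in \<open>simp_all add: rhoR_add rhoR_lin grp_def rhoR_single\<close>)

lemmas rhoL_simps = L.rho_diff L.rho_scl L.rho_dpow L.rho_pow
lemmas rhoR_simps = R.rho_diff R.rho_scl R.rho_dpow R.rho_pow

lemma basis_left:
  assumes order: "pbw_order \<chi> I y p s s' N1 N12 N2" and I: "I = Idl\<^bsub>A\<^esub> S"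
    and S: "\<And>a v. a \<in> S \<Longrightarrow> rhoL a v = 0" and Y: "\<And>v. rhoL y v = Y v"
    and coords: "pbw_coords act (X L1) (X L2) Y (\<lambda>a b c. enat c < N1 \<and> enat b < N12 \<and> enat a < N2) v0 \<pi>"
  shows "pbw_basis I y N1 N12 N2"
proof -
  interpret O: pbw_order \<chi> I y p s s' N1 N12 N2 by (rule order)
  have [simp]: "rhoL (var i) = X i" "rhoL y = Y" for i by (simp_all add: fun_eq_iff rhoL_var Y)
  note co = coords[unfolded pbw_coords_def]
  interpret pbw_op \<chi> I y p s s' N1 N12 N2 act rhoL "\<lambda>h. h" S v0 \<pi> "\<lambda>_. 1"
  proof
    show "\<pi> (a', b', c') (rhoL (O.mono (a, b, c, h)) v0) =
        (if (a', b', c') = (a, b, c) then single h 1 else 0)"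
      if "(a, b, c, h) \<in> O.J" "(a', b', c', 0) \<in> O.J" for a b c h a' b' c'
      using that co by (simp add: O.mono_def O.J_def rhoL_mul L.rho_pow L.rho_grp)
  qed (use I S co in auto)
  show ?thesis using basis by (simp add: O.J_def O.mono_def case_prod_unfold)
qed

text \<open>Reversed products turn x2^a x12^b x1^c into X1^c Y^b X2^a, so the hypothesis on
  coordinates has the two letters exchanged and the exponents in the opposite order.\<close>

lemma basis_right:
  assumes order: "pbw_order \<chi> I y p s s' N1 N12 N2" and I: "I = Idl\<^bsub>A\<^esub> S"
    and S: "\<And>a v. a \<in> S \<Longrightarrow> rhoR a v = 0" and Y: "\<And>v. rhoR y v = Y v"
    and Ysl: "semilin act (\<lambda>k. twist (\<chi> L2) (twist (\<chi> L1) k)) Y"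
    and coords: "pbw_coords act (X L2) (X L1) Y (\<lambda>c b a. enat c < N1 \<and> enat b < N12 \<and> enat a < N2) v0 \<pi>"
  shows "pbw_basis I y N1 N12 N2"
proof -
  interpret O: pbw_order \<chi> I y p s s' N1 N12 N2 by (rule order)
  have [simp]: "rhoR (var i) = X i" "rhoR y = Y" for i by (simp_all add: fun_eq_iff rhoR_var Y)
  note co = coords[unfolded pbw_coords_def]
  define d where "d = (\<lambda>(a, b, c, h). \<chi> L2 (- h) ^ a * (\<chi> L2 (- h) * \<chi> L1 (- h)) ^ b * \<chi> L1 (- h) ^ c)"
  have Ysl': "semilin act (twist (\<lambda>h. \<chi> L2 h * \<chi> L1 h)) Y"
    using Ysl by (simp add: twist_twist)
  \<comment> \<open>In an ordered monomial the group element stands on the right and therefore acts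
    last here. It is moved inwards to the base vector; \<open>d\<close> collects the character
    values met on the way.\<close>
  have push: "single (- h) 1 \<bullet> (X L1 ^^ c) ((Y ^^ b) ((X L2 ^^ a) v))
      = (X L1 ^^ c) ((Y ^^ b) ((X L2 ^^ a) (single (- h) (d (a, b, c, h)) \<bullet> v)))" for a b c h v
    by (simp add: semilinD(2)[OF semilin_pow[OF X]] semilinD(2)[OF semilin_pow[OF Ysl']] twist_pow
        twist_single d_def mult_ac)
  interpret pbw_op \<chi> I y p s s' N1 N12 N2 act rhoR uminus S v0 "\<lambda>(a, b, c). \<pi> (c, b, a)" d
  proof
    show "(case (a', b', c') of (a, b, c) \<Rightarrow> \<pi> (c, b, a)) (rhoR (O.mono (a, b, c, h)) v0) =
        (if (a', b', c') = (a, b, c) then single (- h) (d (a, b, c, h)) else 0)"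
      if "(a, b, c, h) \<in> O.J" "(a', b', c', 0) \<in> O.J" for a b c h a' b' c'
      using that co by (simp add: O.mono_def O.J_def rhoR_mul R.rho_pow R.rho_grp push)
    show "d j \<noteq> 0" for j
      by (cases j) (simp add: d_def chi_nonzero)
  qed (use I S co in \<open>auto simp: inj_def split: prod.split\<close>)
  show ?thesis using basis by (simp add: O.J_def O.mono_def case_prod_unfold)
qed

end

section \<open>Models over a commutative ring\<close>

text \<open>
  A constant of its own: a \<open>module\<close> interpretation with \<open>(*)\<close> as scalar multiplication would turn
  associativity into a simp rule that loops with \<open>mult_ac\<close>.
\<close>

definition lmul :: "'r::comm_ring_1 \<Rightarrow> 'r \<Rightarrow> 'r" where "lmul a b = a * b"

lemma module_lmul: "Modules.module lmul"
  by unfold_locales (simp_all add: lmul_def algebra_simps)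

lemma funpow_transfer: "(\<And>v. P (e v) = e (t v)) \<Longrightarrow> (P ^^ n) (e v) = e ((t ^^ n) v)"
  by (induction n) auto

lemma funpow_2: "(f ^^ 2) x = f (f x)"
  by (simp add: numeral_2_eq_2)

text \<open>The levels are \<open>x1\<close>, \<open>x12\<close>, \<open>x2\<close>, all with blocks
  of the same length N and with N-th powers \<open>u1\<close>, \<open>u12\<close>,
  \<open>u2\<close>. The factors p^N say how each power passes the other letters; factors q^N are
  already absorbed by q^N = 1.\<close>

locale case1 =
  fixes \<tau>1 \<tau>2 :: "'r::comm_ring_1 \<Rightarrow> 'r" and N :: nat and p q z w u1 u12 u2 p' q' :: 'r
  assumes endo1: "ring_endo \<tau>1" and endo2: "ring_endo \<tau>2" and comm: "\<And>k. \<tau>2 (\<tau>1 k) = \<tau>1 (\<tau>2 k)"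
    and fixed: "\<tau>1 p = p" "\<tau>2 p = p" "\<tau>1 q = q" "\<tau>2 q = q"
    and unit: "p' * p = 1" "q' * q = 1"
    and N: "N \<noteq> 1" and qN: "qn q N = 0" "q ^ N = 1"
    and u_zero: "N = 0 \<Longrightarrow> u1 = 0 \<and> u12 = 0 \<and> u2 = 0"
    and u1: "\<tau>1 u1 = u1" "\<tau>2 u1 = p ^ N * u1" "\<And>k. u1 * (\<tau>1 ^^ N) k = u1 * k"
    and u12: "p ^ N * \<tau>1 u12 = u12" "\<tau>2 u12 = p ^ N * u12"
      "\<And>k. u12 * ((\<lambda>k. \<tau>1 (\<tau>2 k)) ^^ N) k = u12 * k"
    and u2: "\<tau>2 u2 = u2" "p ^ N * \<tau>1 u2 = u2" "\<And>k. u2 * (\<tau>2 ^^ N) k = u2 * k"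
    and cubic: "cubic_terms \<tau>1 \<tau>2 N p q z w"
begin

lemmas wz = cubic[unfolded cubic_terms_def]

abbreviation "\<tau>12 \<equiv> \<lambda>k. \<tau>1 (\<tau>2 k)"

lemmas e1 = ring_endoD[OF endo1]
lemmas e2 = ring_endoD[OF endo2]

abbreviation "act1 \<equiv> lact lmul \<tau>1 N"
abbreviation "t1 \<equiv> shift lmul N u1"

sublocale B1: line lmul \<tau>1 N u1
  by (rule line.intro[OF module_lmul]) (unfold_locales; (rule endo1 N u1 | simp add: u_zero)+)

abbreviation "act2 \<equiv> lact act1 \<tau>12 N"
abbreviation "y2 \<equiv> shift act1 N u12"
abbreviation "t2 \<equiv> down act1 N (q * p) z t1"

lemma endo12: "ring_endo \<tau>12"
  by (rule ring_endo_comp[OF endo1 endo2])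

sublocale B2: line act1 \<tau>12 N u12
  by (rule line.intro[OF B1.L_module]) (unfold_locales; (rule endo12 N u12(3) | simp add: u_zero u12 e1 fixed)+)

lemma z_top: "qn (q * p) N * z = 0"
  using wz
proof (elim disjE conjE)
  assume *: "N = 3" "p = q" "1 + q + q * q = 0"
  have "qn (q * q) 3 = (1 + q + q * q) * (1 - q + q * q)"
    by (simp add: qn_def numeral_3_eq_3 algebra_simps)
  then show ?thesis using * by simp
qed simp

lemma z_fixed: "\<tau>1 z = z" "\<tau>2 z = z" and z_central: "z * \<tau>1 (\<tau>1 (\<tau>2 k)) = z * k"
  using wz by (auto simp: e1 e2)

lemma qpN: "(q * p) ^ N = p ^ N"
  using qN by (simp add: power_mult_distrib)

lemma t2_semilin: "semilin act2 \<tau>1 t2"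
  by (rule B2.D_semilin[OF B1.S_semilin endo1])
    (simp_all add: comm e1 e2 fixed z_top z_central)

lemma t2_y2: "t2 (y2 f) = act2 (q * p) (y2 (t2 f)) + act2 z f"
  by (rule B2.D_S[OF B1.S_semilin endo1])
    (simp_all add: e1 e2 fixed z_top z_fixed qpN u12)

sublocale ore_line act2 \<tau>2 N u2 \<tau>1 t2 y2 p q z w p' q'
proof (rule ore_line.intro)
  show "line act2 \<tau>2 N u2"
    by (rule line.intro[OF B2.L_module]) (unfold_locales; (rule endo2 N u2 | simp add: u_zero)+)
  show "ore_line_axioms act2 \<tau>2 N u2 \<tau>1 t2 y2 p q z w p' q'"
    by (rule ore_line_axioms.intro)
      (rule endo1 comm t2_semilin B2.S_semilin fixed unit t2_y2 qN u2 cubic | simp add: qN)+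
qed

abbreviation "act3 \<equiv> lact act2 \<tau>2 N"
abbreviation "X1 \<equiv> slope act2 N p q w t2 y2"
abbreviation "X2 \<equiv> shift act2 N u2"
abbreviation "X12 \<equiv> down act2 N (p * q) w y2"

lemma X1_pow: "N > 0 \<Longrightarrow> (X1 ^^ N) f = act3 u1 f"
proof (rule U_pow)
  assume "N > 0"
  show "(t2 ^^ N) v = act2 u1 v" for v
  proof (rule B2.D_pow[OF B1.S_semilin endo1])
    have "q' * p' * (q * p) = (p' * p) * (q' * q)" by (simp only: mult_ac)
    then show "q' * p' * (q * p) = 1" using unit by simp
    show "z = 0 \<or> 0 < N \<and> qn (q * p) N * z = 0 \<and> \<tau>1 (\<tau>2 z) = z \<and> \<tau>1 z = z \<and> (q * p) ^ N * \<tau>1 u12 = u12 \<and>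
      semilin act2 \<tau>1 t2"
      using \<open>N > 0\<close> z_top t2_semilin by (simp add: z_fixed qpN u12)
  qed (use \<open>N > 0\<close> B1.S_pow in \<open>simp_all add: e1 e2 fixed z_top qpN u1\<close>)
qed (simp_all add: u1)

lemma X12_pow: "N > 0 \<Longrightarrow> (X12 ^^ N) f = act3 u12 f"
  by (rule Y_pow) (simp_all add: B2.S_pow u12 qpN[unfolded mult.commute[of q]])

definition v0 :: "nat \<Rightarrow> nat \<Rightarrow> nat \<Rightarrow> 'r" where "v0 = delta 0 (delta 0 (delta 0 1))"

lemma coords:
  assumes "N = 0 \<or> a < N" "N = 0 \<or> b < N" "N = 0 \<or> c < N"
  shows "(X2 ^^ a) ((X12 ^^ b) ((X1 ^^ c) (act3 k v0))) = delta a (delta b (delta c k))"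
proof -
  have t2: "t2 (delta 0 v) = delta 0 (t1 v)" for v
    by (rule B2.D_delta) (simp add: semilinD(3)[OF B1.S_semilin])
  have x12: "X12 (delta 0 v) = delta 0 (y2 v)" for v
    by (rule D_delta) (simp add: semilinD(3)[OF B2.S_semilin])
  have "act3 k v0 = delta 0 (delta 0 (delta 0 k))"
    by (simp add: v0_def L_delta B2.L_delta B1.L_delta lmul_def)
  then show ?thesis
    using assms by (simp add: funpow_transfer[of X1 "delta 0", OF U_delta] funpow_transfer[of t2 "delta 0", OF t2]
        funpow_transfer[of X12 "delta 0", OF x12] S_delta B1.S_delta B2.S_delta)
qed

end

text \<open>With x1^2 = 0 and q11 = -1 the element [x1 x1 x2] vanishes, so \<open>x1\<close> and
  \<open>x12\<close> commute up to -p and form two plain levels. The hypothesis \<open>r\<close> is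
  the vanishing of the off-diagonal entry of the N-th power of \<open>x12\<close>.\<close>

locale case4 =
  fixes \<tau>1 \<tau>2 :: "'r::comm_ring_1 \<Rightarrow> 'r" and N :: nat and p u12 u2 p' :: 'r
  assumes endo1: "ring_endo \<tau>1" and endo2: "ring_endo \<tau>2" and comm: "\<And>k. \<tau>2 (\<tau>1 k) = \<tau>1 (\<tau>2 k)"
    and fixed: "\<tau>1 p = p" "\<tau>2 p = p" and unit: "p' * p = 1" and N: "N \<noteq> 1" and u_zero: "N = 0 \<Longrightarrow> u12 = 0"
    and u12: "\<tau>1 (\<tau>2 u12) = u12" "\<tau>2 u12 = (- p) ^ N * u12"
      "\<And>k. u12 * ((\<lambda>k. \<tau>1 (\<tau>2 k)) ^^ N) k = u12 * k"
    and u2: "\<tau>2 u2 = u2" "\<And>k. u2 * \<tau>2 (\<tau>2 k) = u2 * k"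
    and r: "N > 0 \<Longrightarrow> (\<Sum>i<N. (p ^ 2) ^ i * ((\<lambda>k. \<tau>1 (\<tau>2 k)) ^^ i) (u2 - p ^ 2 * \<tau>1 u2)) = 0"
begin

abbreviation "\<tau>12 \<equiv> \<lambda>k. \<tau>1 (\<tau>2 k)"

lemmas e1' = ring_endoD[OF endo1]
lemmas e2' = ring_endoD[OF endo2]

abbreviation "act1 \<equiv> lact lmul \<tau>1 2"
abbreviation "t1 \<equiv> shift lmul 2 (0 :: 'r)"

sublocale B1: line lmul \<tau>1 2 0
  by (rule line.intro[OF module_lmul]) (unfold_locales; (rule endo1 | simp add: e1')+)

abbreviation "act2 \<equiv> lact act1 \<tau>12 N"
abbreviation "y2 \<equiv> shift act1 N u12"
abbreviation "t2 \<equiv> down act1 N (- p) 0 t1"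

lemma endo12: "ring_endo \<tau>12"
  by (rule ring_endo_comp[OF endo1 endo2])

sublocale B2: line act1 \<tau>12 N u12
  by (rule line.intro[OF B1.L_module]) (unfold_locales; (rule endo12 N u12 | simp add: u_zero)+)

lemma t2_semilin: "semilin act2 \<tau>1 t2"
  by (rule B2.D_semilin[OF B1.S_semilin endo1]) (simp_all add: comm e1' e2' fixed)

lemma t2_y2: "t2 (y2 f) = act2 (- p) (y2 (t2 f))"
proof -
  interpret M: Modules.module act2 by (rule B2.L_module)
  have "(- p) ^ N * \<tau>1 u12 = \<tau>1 (\<tau>2 u12)" by (simp add: u12(2) e1' fixed)
  then have "t2 (y2 f) = act2 (- p) (y2 (t2 f)) + act2 0 f"
    by (intro B2.D_S[OF B1.S_semilin endo1]) (simp_all add: e1' e2' fixed u12(1))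
  then show ?thesis by simp
qed

lemma t2_t2: "t2 (t2 f) = 0"
proof -
  interpret M: Modules.module act2 by (rule B2.L_module)
  have "(t2 ^^ 2) f = act2 0 f"
  proof (rule B2.D_pow[OF B1.S_semilin endo1])
    show "(- p') * (- p) = 1" using unit by simp
  qed (use B1.S_pow in \<open>simp_all add: e1' e2' fixed\<close>)
  then show ?thesis by (simp add: funpow_2)
qed

sublocale ore_pair act2 \<tau>1 \<tau>2 t2 y2 p u2
proof (rule ore_pair.intro[OF B2.L_module])
  show "ore_pair_axioms act2 \<tau>1 \<tau>2 t2 y2 p u2"
    by (rule ore_pair_axioms.intro)
      (rule endo1 endo2 comm t2_semilin B2.S_semilin fixed t2_y2 t2_t2 u2)+
qed

lemma X12_pow: "N > 0 \<Longrightarrow> (Y ^^ N) f = pact u12 f"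
  using r by (intro Y_pow) (simp_all add: B2.S_pow u12 r_def)

definition v0 :: "(nat \<Rightarrow> nat \<Rightarrow> 'r) \<times> (nat \<Rightarrow> nat \<Rightarrow> 'r)" where "v0 = (delta 0 (delta 0 1), 0)"

lemma coords:
  assumes "a < 2" "N = 0 \<or> b < N" "c < 2"
  shows "(X2 ^^ a) ((Y ^^ b) ((X1 ^^ c) (pact k v0))) =
    (if a = 0 then (delta b (delta c k), 0) else (0, delta b (delta c k)))"
proof -
  have t2: "t2 (delta 0 v) = delta 0 (t1 v)" for v
    by (rule B2.D_delta) (simp add: semilinD(3)[OF B1.S_semilin])
  have X1: "X1 (v, 0) = (t2 v, 0)" for v by (simp add: X1_def tD yD)
  have Y: "Y (v, 0) = (y2 v, 0)" for v by (simp add: Y_def tD yD)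
  have p: "pact k v0 = (delta 0 (delta 0 k), 0)"
    by (simp add: pact_def v0_def B2.L_delta B1.L_delta lmul_def)
  have "(X1 ^^ c) (pact k v0) = (delta 0 (delta c k), 0)"
    unfolding p funpow_transfer[of X1 "\<lambda>v. (v, 0)", OF X1] funpow_transfer[of t2 "delta 0", OF t2]
    using assms by (simp add: B1.S_delta)
  then have "(Y ^^ b) ((X1 ^^ c) (pact k v0)) = (delta b (delta c k), 0)"
    using assms by (simp add: funpow_transfer[of Y "\<lambda>v. (v, 0)", OF Y] B2.S_delta)
  moreover have "a = 0 \<or> a = 1" using assms by auto
  ultimately show ?thesis by (auto simp: X2_def)
qed

end

locale case2 = quad_scalars \<tau>1 \<tau>2 p q u l b e r s
  for \<tau>1 \<tau>2 :: "'r::comm_ring_1 \<Rightarrow> 'r" and p q u l b e r s +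
  fixes N :: nat and u1 :: 'r
  assumes N: "N \<noteq> 1" and u_zero: "N = 0 \<Longrightarrow> u1 = 0"
    and u1: "\<tau>1 u1 = u1" "\<tau>2 u1 = p ^ N * u1" "\<And>k. u1 * (\<tau>1 ^^ N) k = u1 * k"
begin

abbreviation "act1 \<equiv> lact lmul \<tau>1 N"
abbreviation "t1 \<equiv> shift lmul N u1"

sublocale B1: line lmul \<tau>1 N u1
  by (rule line.intro[OF module_lmul]) (unfold_locales; (rule endo1 N u1 | simp add: u_zero)+)

sublocale ore_quad act1 \<tau>1 \<tau>2 p q u l b e r s t1
  by (intro ore_quad.intro ore_quad_axioms.intro B1.L_module quad_scalars_axioms B1.S_semilin)

definition v0 :: "(nat \<Rightarrow> 'r) quad" where "v0 = (delta 0 1, 0, 0, 0)"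

lemma X1_power:
  assumes "N > 0" "qn q N = 0" "q ^ N = 1" "(\<Sum>i<N. (q * p) ^ i * (\<tau>1 ^^ i) l) = 0"
      "(\<Sum>j<N. p ^ (j - 1) * qn q j * (\<tau>1 ^^ (j - 1)) l) = 0"
    shows "(X1 ^^ N) v = qact u1 v"
  using assms by (intro X1_pow) (simp_all add: B1.S_pow u1)

lemma coords:
  assumes "a < 2" "b' < 2" "N = 0 \<or> c < N"
  shows "(X2 ^^ a) ((Y ^^ b') ((X1 ^^ c) (qact k v0))) =
    (if b' = 0 then if a = 0 then (delta c k, 0, 0, 0) else (0, delta c k, 0, 0)
     else if a = 0 then (0, 0, delta c k, 0) else (0, 0, 0, delta c k))"
proof -
  have p: "qact k v0 = (delta 0 k, 0, 0, 0)"
    by (simp add: qact_def v0_def B1.L_delta lmul_def)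
  have 1: "(X1 ^^ c) (qact k v0) = (delta c k, 0, 0, 0)"
    unfolding p X1_embed using assms by (simp add: B1.S_delta)
  have "a = 0 \<or> a = 1" "b' = 0 \<or> b' = 1" using assms by auto
  then show ?thesis unfolding 1 by (auto simp: X2_def Y_def tD)
qed

end

section \<open>The relations and their models\<close>

context smash
begin

lemma x12_eq: "x12 g \<chi> = var L1 \<star> var L2 - \<chi> L2 (g L1) \<cdot> (var L2 \<star> var L1)"
  by (simp add: x12_def qcomm_def braiding_def)

lemma x112_eq: "x112 g \<chi> = var L1 \<star> x12 g \<chi> - (\<chi> L1 (g L1) * \<chi> L2 (g L1)) \<cdot> (x12 g \<chi> \<star> var L1)"
  by (simp add: x112_def qcomm_def braiding_def)

lemma x122_eq: "x122 g \<chi> = x12 g \<chi> \<star> var L2 - (\<chi> L2 (g L1) * \<chi> L2 (g L2)) \<cdot> (var L2 \<star> x12 g \<chi>)"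
  by (simp add: x122_def qcomm_def braiding_def)

text \<open>For q11 = -1 the terms x1 x2 x1 cancel, so a bound on x1^2 bounds \<open>x112\<close>
  without a cubic relation.\<close>

lemma x112_square:
  assumes "\<chi> L1 (g L1) = -1"
  shows "x112 g \<chi> = var L1 \<star> var L1 \<star> var L2 - (\<chi> L2 (g L1) ^ 2) \<cdot> (var L2 \<star> (var L1 \<star> var L1))"
  by (simp add: x112_eq x12_eq assms mul_diff mul_assoc scl_right scl_left power2_eq_square)

lemma x122_square:
  assumes "\<chi> L2 (g L2) = -1"
  shows "x122 g \<chi> = var L1 \<star> (var L2 \<star> var L2) - (\<chi> L2 (g L1) ^ 2) \<cdot> (var L2 \<star> var L2 \<star> var L1)"
  by (simp add: x122_eq x12_eq assms mul_diff mul_assoc scl_right scl_left power2_eq_square)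

text \<open>The two ways of bringing \<open>x\<^sub>1 x\<^sub>1\<^sub>2 x\<^sub>2\<close> into the order \<open>x\<^sub>2, x\<^sub>1\<^sub>2, x\<^sub>1\<close> differ by a multiple of \<open>x\<^sub>1\<^sub>2\<^sup>2\<close>.\<close>

lemma x12_square:
  fixes g :: "letter \<Rightarrow> 'g"
  defines "p \<equiv> \<chi> L2 (g L1)" and "q1 \<equiv> \<chi> L1 (g L1)" and "q2 \<equiv> \<chi> L2 (g L2)"
  shows "(p * (q1 - q2)) \<cdot> (x12 g \<chi> \<star> x12 g \<chi>) = var L1 \<star> x122 g \<chi> - x112 g \<chi> \<star> var L2
    + (p ^ 2 * q2) \<cdot> (var L2 \<star> x112 g \<chi>) - (q1 * p ^ 2) \<cdot> (x122 g \<chi> \<star> var L1)"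
proof -
  define y where "y = x12 g \<chi>"
  have y: "var L1 \<star> var L2 = p \<cdot> (var L2 \<star> var L1) + y"
    by (simp add: y_def x12_eq p_def)
  have y': "var L1 \<star> (var L2 \<star> a) = p \<cdot> (var L2 \<star> (var L1 \<star> a)) + y \<star> a" for a
    using arg_cong[OF y, of "\<lambda>b. b \<star> a"] by (simp add: mul_assoc mul_add)
  show ?thesis
    unfolding x112_eq x122_eq y_def[symmetric] p_def[symmetric] q1_def[symmetric] q2_def[symmetric]
    by (simp add: mul_add mul_diff mul_assoc y y' scl_left scl_right power2_eq_square algebra_simps)
qed

end

context smash_ideal
begin

lemma Fil_dpow: "dpow g \<chi> \<omega> m \<in> Fil n"
  unfolding dpow_def by (simp add: Fil_diff Fil_sc Fil_grp)

lemma Fil_gen: "a - b \<in> I \<Longrightarrow> b \<in> Fil n \<Longrightarrow> a \<in> Fil n"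
  by (rule Fil_cong[OF Fil_I])

lemma Fil_x12: "2 \<le> n \<Longrightarrow> x12 g \<chi> \<in> Fil n"
  unfolding x12_eq
  by (intro Fil_diff Fil_sc_mul Fil_mul_le[OF Fil_var[OF order_refl] Fil_var[OF order_refl]]) simp_all

lemma x112_Fil:
  assumes "\<chi> L1 (g L1) = -1" "var L1 \<star> var L1 \<in> Fil 1"
  shows "x112 g \<chi> \<in> Fil 2"
  unfolding x112_square[of g, OF assms(1)]
  by (intro Fil_diff Fil_sc_mul Fil_mul_le[OF assms(2) Fil_var[OF order_refl]]
      Fil_mul_le[OF Fil_var[OF order_refl] assms(2)]) simp_all

lemma x122_Fil:
  assumes "\<chi> L2 (g L2) = -1" "var L2 \<star> var L2 \<in> Fil 1"
  shows "x122 g \<chi> \<in> Fil 2"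
  unfolding x122_square[of g, OF assms(1)]
  by (intro Fil_diff Fil_sc_mul Fil_mul_le[OF assms(2) Fil_var[OF order_refl]]
      Fil_mul_le[OF Fil_var[OF order_refl] assms(2)]) simp_all

text \<open>If q11 and q22 differ, the coefficient of \<open>x12^2\<close> in the overlap identity
  is invertible, and every other term there has degree at most 3.\<close>

lemma x12_square_Fil:
  assumes "\<chi> L1 (g L1) \<noteq> \<chi> L2 (g L2)" "x112 g \<chi> \<in> Fil 2" "x122 g \<chi> \<in> Fil 2"
  shows "x12 g \<chi> \<star> x12 g \<chi> \<in> Fil 3"
proof -
  define c where "c = \<chi> L2 (g L1) * (\<chi> L1 (g L1) - \<chi> L2 (g L2))"
  have "c \<cdot> (x12 g \<chi> \<star> x12 g \<chi>) \<in> Fil 3"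
    unfolding c_def x12_square
    by (intro Fil_diff Fil_add Fil_sc_mul Fil_mul_le[OF assms(2) Fil_var[OF order_refl]]
      Fil_mul_le[OF Fil_var[OF order_refl] assms(2)] Fil_mul_le[OF assms(3) Fil_var[OF order_refl]]
      Fil_mul_le[OF Fil_var[OF order_refl] assms(3)]) simp_all
  then have "inverse c \<cdot> c \<cdot> (x12 g \<chi> \<star> x12 g \<chi>) \<in> Fil 3" by (rule Fil_sc_mul)
  moreover have "c \<noteq> 0" using assms(1) by (simp add: c_def chi_nonzero)
  ultimately show ?thesis by simp
qed

lemma pbw_orderI:
  assumes "x112 g \<chi> \<in> Fil 2" "x122 g \<chi> \<in> Fil 2"
    and "\<And>n. N1 = enat n \<Longrightarrow> 0 < n \<and> var L1 \<up> n \<in> Fil (n - 1)"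
    and "\<And>n. N12 = enat n \<Longrightarrow> 0 < n \<and> x12 g \<chi> \<up> n \<in> Fil (2 * n - 1)"
    and "\<And>n. N2 = enat n \<Longrightarrow> 0 < n \<and> var L2 \<up> n \<in> Fil (n - 1)"
  shows "pbw_order \<chi> I (x12 g \<chi>) (\<chi> L2 (g L1)) (\<chi> L1 (g L1) * \<chi> L2 (g L1)) (\<chi> L2 (g L1) * \<chi> L2 (g L2))
    N1 N12 N2"
proof
  show "var L1 \<star> var L2 = \<chi> L2 (g L1) \<cdot> (var L2 \<star> var L1) + x12 g \<chi>"
    by (simp add: x12_eq)
qed (use assms(1)[unfolded x112_eq] assms(2)[unfolded x122_eq] assms(3-5) Fil_x12[of 2] in blast)+

end

section \<open>Multiplicative orders and the elements \<mu>(1 - h)\<close>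

lemma gpow_Suc: "gpow h (Suc n) = gpow h n + h"
  by (simp add: gpow_def)

lemma gpow_1: "gpow h 1 = h"
  by (simp add: gpow_def)

lemma chi_gpow: "character c \<Longrightarrow> c (gpow h n) = c h ^ n"
proof (induction n)
  case 0
  then show ?case by (simp add: gpow_def character_zero)
next
  case (Suc n)
  then show ?case by (simp add: gpow_Suc character_def mult.commute)
qed

lemma mult_order_enat:
  assumes "mult_order q = enat n"
  shows "0 < n" "q ^ n = 1" "\<And>m. 0 < m \<Longrightarrow> m < n \<Longrightarrow> q ^ m \<noteq> 1"
proof -
  have ex: "\<exists>n>0. q ^ n = 1" and n: "n = (LEAST n. 0 < n \<and> q ^ n = 1)"
    using assms by (auto simp: mult_order_def split: if_splits)
  have "0 < n \<and> q ^ n = 1" unfolding n using ex by (rule LeastI_ex)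
  then show "0 < n" "q ^ n = 1" by auto
  show "q ^ m \<noteq> 1" if "0 < m" "m < n" for m
    using not_less_Least[of m "\<lambda>n. 0 < n \<and> q ^ n = 1"] that n by auto
qed

lemma mult_order_infinity: "mult_order q = \<infinity> \<Longrightarrow> 0 < m \<Longrightarrow> q ^ m \<noteq> 1"
  by (auto simp: mult_order_def split: if_splits dest: spec[of _ m])

lemma qn_telescope: "(q - 1) * qn q n = q ^ n - (1 :: 'a::comm_ring_1)"
  by (induction n) (simp_all add: qn_Suc' algebra_simps)

lemma qn_root: "q ^ n = 1 \<Longrightarrow> q \<noteq> 1 \<Longrightarrow> qn q n = (0 :: 'a::field)"
  using qn_telescope[of q n] by simp

lemma cst_simps:
  fixes a b :: "'k::field"
  shows "(cst (a * b) :: 'g::comm_monoid_add \<Rightarrow>\<^sub>0 'k) = cst a * cst b"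
    "(cst (a + b) :: 'g \<Rightarrow>\<^sub>0 'k) = cst a + cst b" "(cst (a - b) :: 'g \<Rightarrow>\<^sub>0 'k) = cst a - cst b"
    "(cst (- a) :: 'g \<Rightarrow>\<^sub>0 'k) = - cst a" "(cst 1 :: 'g \<Rightarrow>\<^sub>0 'k) = 1" "(cst 0 :: 'g \<Rightarrow>\<^sub>0 'k) = 0"
    "(cst (a ^ n) :: 'g \<Rightarrow>\<^sub>0 'k) = cst a ^ n"
proof -
  have m: "(cst (c * d) :: 'g \<Rightarrow>\<^sub>0 'k) = cst c * cst d" for c d by (simp add: mult_single)
  show "(cst (a * b) :: 'g \<Rightarrow>\<^sub>0 'k) = cst a * cst b" by (rule m)
  show "(cst (a ^ n) :: 'g \<Rightarrow>\<^sub>0 'k) = cst a ^ n" by (induction n) (simp_all add: m)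
qed (simp_all add: single_add single_diff single_uminus)

lemma cst_qn: "qn (cst q) n = cst (qn q n :: 'k::field)"
  by (induction n) (simp_all add: qn_Suc cst_simps)

definition el :: "'k::field \<Rightarrow> 'g::ab_group_add \<Rightarrow> 'g \<Rightarrow>\<^sub>0 'k"
  where "el \<mu> h = cst \<mu> * (1 - single h 1)"

lemma el_0 [simp]: "el 0 h = 0"
  by (simp add: el_def)

lemma el_eq: "el \<mu> h = cst \<mu> - single h \<mu>"
  by (simp add: el_def algebra_simps mult_single)

lemma twist_diff: "twist \<psi> (a - b) = twist \<psi> a - twist \<psi> b"
  by (intro poly_mapping_eqI) (simp add: lookup_twist lookup_minus algebra_simps)

lemma twist_el_fixed: "\<psi> 0 = 1 \<Longrightarrow> (\<mu> \<noteq> 0 \<Longrightarrow> \<psi> h = 1) \<Longrightarrow> twist \<psi> (el \<mu> h) = el \<mu> h"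
  by (cases "\<mu> = 0") (simp_all add: el_eq twist_diff twist_single)

lemma cst_mul_el: "(\<mu> \<noteq> 0 \<Longrightarrow> c = 1) \<Longrightarrow> cst c * el \<mu> h = el \<mu> h"
  by (cases "\<mu> = 0") simp_all

text \<open>Admissibility at work: a nonzero coefficient forces the character to be trivial, and
  then the twist is the identity.\<close>

lemma el_mul_twist: "(\<mu> \<noteq> 0 \<Longrightarrow> (\<And>h. \<psi> h = 1)) \<Longrightarrow> el \<mu> h * twist \<psi> k = el \<mu> h * k"
  by (cases "\<mu> = 0") (simp_all add: twist_id)

lemma twist_diag: "((\<lambda>k. twist \<psi> (twist \<phi> k)) ^^ n) k = twist (\<lambda>h. (\<psi> h * \<phi> h) ^ n) k"
  unfolding twist_twist by (rule twist_pow)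

section \<open>Cartan type A_2\<close>

context smash
begin

abbreviation cg :: "'k \<Rightarrow> 'g \<Rightarrow>\<^sub>0 'k"
  where "cg \<equiv> single 0"

text \<open>One statement for orders 2, 3, at least 4 and infinite; \<open>M = 0\<close> encodes the
  last. \<open>c1\<close> and \<open>c2\<close> are the coefficients of \<open>x122\<close> and of
  the M-th power of x2 in the relation for \<open>x12\<close>. They are multiples of \<lambda>112
  and \<mu>1, and the implications in \<open>c\<close> make those terms central.\<close>

lemma case1_basis:
  fixes g :: "letter \<Rightarrow> 'g" and M :: nat
  defines "p \<equiv> \<chi> L2 (g L1)" and "q \<equiv> \<chi> L1 (g L1)" and "r \<equiv> \<chi> L1 (g L2)"
  assumes M: "M \<noteq> 1" and qM: "q ^ M = 1" "q \<noteq> 1"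
    and q2: "\<chi> L2 (g L2) = q" and prq: "p * r * q = 1"
    and mu1: "\<And>h. \<mu>1 \<noteq> 0 \<Longrightarrow> \<chi> L1 h ^ M = 1" and mu2: "\<And>h. \<mu>2 \<noteq> 0 \<Longrightarrow> \<chi> L2 h ^ M = 1"
    and mu12: "\<And>h. \<mu>12 \<noteq> 0 \<Longrightarrow> (\<chi> L1 h * \<chi> L2 h) ^ M = 1"
    and la: "la112 = 0 \<and> la122 = 0 \<or> M = 3"
    and la112: "\<And>h. la112 \<noteq> 0 \<Longrightarrow> \<chi> L1 h * \<chi> L1 h * \<chi> L2 h = 1"
    and la122: "\<And>h. la122 \<noteq> 0 \<Longrightarrow> \<chi> L1 h * \<chi> L2 h * \<chi> L2 h = 1"
    and c: "c1 \<noteq> 0 \<Longrightarrow> la112 \<noteq> 0" "c2 \<noteq> 0 \<Longrightarrow> \<mu>1 \<noteq> 0"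
    and N: "N = (if M = 0 then \<infinity> else enat M)"
    and order: "pbw_order \<chi> I (x12 g \<chi>) s1 s2 s3 N N N" and I: "I = Idl\<^bsub>A\<^esub> S"
    and S: "\<And>a. a \<in> S \<Longrightarrow> a = x112 g \<chi> - la112 \<cdot> dpow g \<chi> [L1, L1, L2] 1 \<or>
      a = x122 g \<chi> - la122 \<cdot> dpow g \<chi> [L1, L2, L2] 1 \<or>
      M > 0 \<and> (a = var L1 \<up> M - \<mu>1 \<cdot> dpow g \<chi> [L1] M \<or>
        a = x12 g \<chi> \<up> M - c1 \<cdot> x122 g \<chi> - c2 \<cdot> var L2 \<up> M - \<mu>12 \<cdot> dpow g \<chi> [L1, L2] M \<or>
        a = var L2 \<up> M - \<mu>2 \<cdot> dpow g \<chi> [L2] M)"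
  shows "pbw_basis I (x12 g \<chi>) N N N"
proof -
  have pq0: "p \<noteq> 0" "q \<noteq> 0" "r \<noteq> 0" by (simp_all add: p_def q_def r_def chi_nonzero)
  have prM: "p ^ M * r ^ M = 1" using arg_cong[OF prq, of "\<lambda>x. x ^ M"] qM by (simp add: power_mult_distrib)
  have r1: "r ^ M = 1" if "\<mu>1 \<noteq> 0" using mu1[OF that, of "g L2"] by (simp add: r_def)
  have p2: "p ^ M = 1" if "\<mu>2 \<noteq> 0" using mu2[OF that, of "g L1"] by (simp add: p_def)
  have p12: "p ^ M = 1" if "\<mu>12 \<noteq> 0"
    using mu12[OF that, of "g L1"] qM by (simp add: p_def[symmetric] q_def[symmetric] power_mult_distrib)
  have p1: "p ^ M = 1" if "\<mu>1 \<noteq> 0" using r1[OF that] prM by simp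
  have r2: "r ^ M = 1" if "\<mu>2 \<noteq> 0 \<or> \<mu>12 \<noteq> 0" using that p2 p12 prM by auto
  have q3: "q * q * q = 1" "1 + q + q * q = 0" if "M = 3"
  proof -
    show q3: "q * q * q = 1" using qM that by (simp add: power3_eq_cube)
    have "(q - 1) * (1 + q + q * q) = q * q * q - 1" by (simp add: algebra_simps)
    then show "1 + q + q * q = 0" using q3 qM by simp
  qed
  \<comment> \<open>Evaluating the trivial character \<chi>112 at g1, or \<chi>122 at g2, gives one
    of p, r as the inverse of q^2, which is q. The Cartan relation p r q = 1 then gives the
    other.\<close>
  have la_pq: "M = 3 \<and> p = q \<and> r = q" if "la112 \<noteq> 0 \<or> la122 \<noteq> 0"
  proof -
    have M3: "M = 3" using la that by auto
    note q3 = q3[OF M3]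
    have "p = q"
    proof (cases "la112 = 0")
      case False
      then have "q * q * p = 1" using la112[of "g L1"] by (simp add: p_def q_def)
      then have "q * (q * q * p) = q" by simp
      then show ?thesis using q3 by (simp add: mult.assoc[symmetric])
    next
      case True
      then have "r * q * q = 1" using la122[of "g L2"] that by (simp add: r_def q2)
      then have "r * (q * q * q) = q" by (simp add: mult.assoc[symmetric])
      then have "r = q" using q3 by simp
      then have "p * (q * q) = 1" using prq by (simp add: mult.assoc)
      then have "p * (q * q * q) = q" by (simp add: mult.assoc[symmetric])
      then show ?thesis using q3 by simp
    qed
    moreover have "r = q"
    proof -
      have "q * q * r = 1" using prq \<open>p = q\<close> by (simp add: mult_ac)
      then have "q * (q * q * r) = q" by simp
      then show ?thesis using q3 by (simp add: mult.assoc[symmetric])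
    qed
    ultimately show ?thesis using M3 by simp
  qed
  \<comment> \<open>For infinite order the power relations are absent, and the model needs zero
    powers there.\<close>
  define m1 where "m1 = (if M = 0 then 0 else \<mu>1)"
  define m2 where "m2 = (if M = 0 then 0 else \<mu>2)"
  define m12 where "m12 = (if M = 0 then 0 else \<mu>12)"
  define \<tau>1 where "\<tau>1 = twist (\<chi> L1)"
  define \<tau>2 where "\<tau>2 = twist (\<chi> L2)"
  define u1 where "u1 = el m1 (gpow (g L1) M)"
  define u2 where "u2 = el m2 (gpow (g L2) M)"
  define z where "z = el la112 (g L1 + g L1 + g L2)"
  define w where "w = el la122 (g L1 + g L2 + g L2)"
  \<comment> \<open>The relation for the M-th power of \<open>x12\<close>, with \<open>x122\<close>
    and the M-th power of x2 replaced by their values in the group algebra.\<close>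
  define u12 where "u12 = cg c1 * w + cg c2 * u2 + el m12 (gpow (g L1 + g L2) M)"
  note ch = chi_gpow[OF char1] chi_gpow[OF char2]
  have chars: "character (\<chi> i)" for i using char1 char2 by (cases i) auto
  have endo: "ring_endo \<tau>1" "ring_endo \<tau>2"
    unfolding \<tau>1_def \<tau>2_def by (rule ring_endo_twist[OF chars])+
  have comm: "\<tau>2 (\<tau>1 k) = \<tau>1 (\<tau>2 k)" for k by (simp add: \<tau>1_def \<tau>2_def twist_commute)
  have fix_cst: "\<tau>1 (cg x) = cg x" "\<tau>2 (cg x) = cg x" for x
    by (simp_all add: \<tau>1_def \<tau>2_def twist_single chi_zero)
  have m: "m1 \<noteq> 0 \<Longrightarrow> \<mu>1 \<noteq> 0" "m2 \<noteq> 0 \<Longrightarrow> \<mu>2 \<noteq> 0" "m12 \<noteq> 0 \<Longrightarrow> \<mu>12 \<noteq> 0"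
    by (auto simp: m1_def m2_def m12_def split: if_splits)
  have u1_fixed: "\<tau>1 u1 = u1" "\<tau>2 u1 = u1"
    unfolding u1_def \<tau>1_def \<tau>2_def using m p1 qM
    by (auto intro!: twist_el_fixed simp: chi_zero ch p_def[symmetric] q_def[symmetric])
  have u2_fixed: "\<tau>1 u2 = u2" "\<tau>2 u2 = u2"
    unfolding u2_def \<tau>1_def \<tau>2_def using m r2 qM q2
    by (auto intro!: twist_el_fixed simp: chi_zero ch r_def[symmetric])
  have z_fixed: "\<tau>1 z = z" "\<tau>2 z = z" and w_fixed: "\<tau>1 w = w" "\<tau>2 w = w"
    unfolding z_def w_def \<tau>1_def \<tau>2_def using la_pq q3
    by (auto intro!: twist_el_fixed simp: chi_zero chi_add q2 p_def[symmetric] q_def[symmetric] r_def[symmetric])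
  have el12_fixed: "\<tau>1 (el m12 (gpow (g L1 + g L2) M)) = el m12 (gpow (g L1 + g L2) M)"
      "\<tau>2 (el m12 (gpow (g L1 + g L2) M)) = el m12 (gpow (g L1 + g L2) M)"
    unfolding \<tau>1_def \<tau>2_def using m p12 r2 qM
    by (auto intro!: twist_el_fixed simp: chi_zero ch chi_add q2 p_def[symmetric] q_def[symmetric] r_def[symmetric]
        power_mult_distrib)
  note rr = ring_endoD[OF endo(1)] ring_endoD[OF endo(2)]
  have u12_fixed: "\<tau>1 u12 = u12" "\<tau>2 u12 = u12"
    by (simp_all add: u12_def rr fix_cst w_fixed u2_fixed el12_fixed)
  have pu1: "cg p ^ M * u1 = u1" and pu2: "cg p ^ M * u2 = u2"
    and p12': "cg p ^ M * el m12 (gpow (g L1 + g L2) M) = el m12 (gpow (g L1 + g L2) M)"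
    unfolding u1_def u2_def using m p1 p2 p12 by (auto intro!: cst_mul_el simp flip: cst_simps(7))
  have pw: "cg p ^ M * w = w"
    unfolding w_def using la_pq qM by (auto intro!: cst_mul_el simp flip: cst_simps(7))
  have pu12: "cg p ^ M * u12 = u12"
    using pu2 p12' pw by (simp add: u12_def distrib_left mult.left_commute)
  have tau12: "((\<lambda>k. \<tau>1 (\<tau>2 k)) ^^ n) k = twist (\<lambda>h. (\<chi> L1 h * \<chi> L2 h) ^ n) k" for n k
    unfolding \<tau>1_def \<tau>2_def by (rule twist_diag)
  have central12: "u12 * ((\<lambda>k. \<tau>1 (\<tau>2 k)) ^^ M) k = u12 * k" for k
  proof -
    let ?t = "twist (\<lambda>h. (\<chi> L1 h * \<chi> L2 h) ^ M) k"
    have 1: "cg c1 * w * ?t = cg c1 * w * k"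
    proof (cases "c1 = 0 \<or> la122 = 0")
      case False
      then have "M = 3" using c la by auto
      \<comment> \<open>The third power of \<chi>12 is \<chi>112 \<chi>122. Both factors are
        trivial, since a nonzero \<open>c1\<close> forces a nonzero \<lambda>112.\<close>
      have "(\<chi> L1 h * \<chi> L2 h) ^ M = (\<chi> L1 h * \<chi> L1 h * \<chi> L2 h) * (\<chi> L1 h * \<chi> L2 h * \<chi> L2 h)" for h
        by (simp add: \<open>M = 3\<close> power3_eq_cube mult_ac)
      also have "\<dots> h = 1" for h using False c la112 la122 by simp
      finally show ?thesis by (simp add: twist_id)
    qed (auto simp: cst_simps w_def)
    have 2: "cg c2 * u2 * ?t = cg c2 * u2 * k"
    proof (cases "c2 = 0 \<or> m2 = 0")
      case False
      then have "(\<chi> L1 h * \<chi> L2 h) ^ M = 1" for h using c m mu1 mu2 by (simp add: power_mult_distrib)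
      then show ?thesis by (simp add: twist_id)
    qed (auto simp: cst_simps u2_def)
    have 3: "el m12 h * ?t = el m12 h * k" for h
      using m mu12 by (intro el_mul_twist) auto
    show ?thesis unfolding tau12 u12_def by (simp add: distrib_right 1 2 3)
  qed
  have wz: "cubic_terms \<tau>1 \<tau>2 M (cg p) (cg q) z w"
  proof (cases "la112 \<noteq> 0 \<or> la122 \<noteq> 0")
    case True
    have "1 + (cg q :: 'g \<Rightarrow>\<^sub>0 'k) + cg q * cg q = (cg (1 + q + q * q) :: 'g \<Rightarrow>\<^sub>0 'k)" by (simp add: cst_simps)
    moreover have "z * \<tau>1 (\<tau>1 (\<tau>2 k)) = z * k" "w * \<tau>1 (\<tau>2 (\<tau>2 k)) = w * k" for k
      using la112 la122 unfolding z_def w_def \<tau>1_def \<tau>2_def twist_twist mult.assoc[symmetric]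
      by (auto intro!: el_mul_twist)
    ultimately show ?thesis using la_pq[OF True] q3 z_fixed w_fixed by (simp add: cst_simps cubic_terms_def)
  qed (simp add: z_def w_def cubic_terms_def)
  interpret C: case1 \<tau>1 \<tau>2 M "cg p" "cg q" z w u1 u12 u2 "cg (inverse p)" "cg (inverse q)"
  proof
    show "cg (inverse p) * cg p = 1" "cg (inverse q) * cg q = 1"
      using pq0 unfolding cst_simps(1)[symmetric] by simp_all
    show "qn (cg q) M = 0" "cg q ^ M = 1"
      using qn_root[OF qM] qM unfolding cst_qn cst_simps(7)[symmetric] by simp_all
    show "u1 = 0 \<and> u12 = 0 \<and> u2 = 0" if "M = 0"
      using that la by (auto simp: u1_def u2_def u12_def m1_def m2_def m12_def w_def)
    show "u1 * (\<tau>1 ^^ M) k = u1 * k" "u2 * (\<tau>2 ^^ M) k = u2 * k" for k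
      using m mu1 mu2 unfolding u1_def u2_def \<tau>1_def \<tau>2_def twist_pow by (auto intro!: el_mul_twist)
  qed (use M endo comm fix_cst u1_fixed u2_fixed u12_fixed pu1 pu2 pu12 central12 wz in \<open>simp_all\<close>)
  define X where "X = (\<lambda>i. case i of L1 \<Rightarrow> C.X1 | L2 \<Rightarrow> C.X2)"
  interpret V: letters_rep \<chi> C.act3 X
  proof (intro letters_rep.intro letters_rep_axioms.intro)
    show "Modules.module C.act3" by (rule C.L_module)
    show "semilin C.act3 (twist (\<chi> i)) (X i)" for i
      using C.U_semilin C.S_semilin by (cases i) (simp_all add: X_def \<tau>1_def \<tau>2_def)
  qed unfold_locales
  have XL [simp]: "X L1 = C.X1" "X L2 = C.X2" by (simp_all add: X_def)
  have r12: "V.rhoL (x12 g \<chi>) v = C.X12 v" for v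
    by (simp add: x12_eq V.rhoL_simps V.rhoL_mul V.rhoL_var C.U_S p_def[symmetric])
  have r112: "V.rhoL (x112 g \<chi>) v = C.act3 z v" for v
    by (simp add: x112_eq V.rhoL_simps V.rhoL_mul V.rhoL_var r12 C.U_Y p_def[symmetric] q_def[symmetric] cst_simps(1))
  have r122: "V.rhoL (x122 g \<chi>) v = C.act3 w v" for v
    by (simp add: x122_eq V.rhoL_simps V.rhoL_mul V.rhoL_var r12 C.Y_S p_def[symmetric] q2 cst_simps(1))
  have powr: "(V.rhoL (var L1) ^^ M) v = C.act3 u1 v" "(V.rhoL (x12 g \<chi>) ^^ M) v = C.act3 u12 v"
    "(V.rhoL (var L2) ^^ M) v = C.act3 u2 v" if "M > 0" for v
    using that C.X1_pow C.X12_pow C.S_pow by (simp_all add: V.rhoL_var[abs_def] r12[abs_def])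
  show ?thesis
  proof (rule V.basis_left[OF order I _ r12])
    fix a v assume "a \<in> S"
    from S[OF this] show "V.rhoL a v = 0"
    proof (elim disjE conjE)
      assume a: "a = x112 g \<chi> - la112 \<cdot> dpow g \<chi> [L1, L1, L2] 1"
      show ?thesis
        by (simp add: a V.rhoL_simps r112 el_def z_def wdeg_def gpow_1 add.assoc del: One_nat_def)
    next
      assume a: "a = x122 g \<chi> - la122 \<cdot> dpow g \<chi> [L1, L2, L2] 1"
      show ?thesis
        by (simp add: a V.rhoL_simps r122 el_def w_def wdeg_def gpow_1 add.assoc del: One_nat_def)
    next
      assume M: "M > 0" and a: "a = var L1 \<up> M - \<mu>1 \<cdot> dpow g \<chi> [L1] M"
      show ?thesis using M
        by (simp add: a V.rhoL_simps powr el_def u1_def m1_def wdeg_def)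
    next
      assume M: "M > 0" and a: "a = x12 g \<chi> \<up> M - c1 \<cdot> x122 g \<chi> - c2 \<cdot> var L2 \<up> M - \<mu>12 \<cdot> dpow g \<chi> [L1, L2] M"
      show ?thesis using M
        by (simp add: a V.rhoL_simps powr el_def r122 u12_def m12_def wdeg_def
            V.scale_left_distrib)
    next
      assume M: "M > 0" and a: "a = var L2 \<up> M - \<mu>2 \<cdot> dpow g \<chi> [L2] M"
      show ?thesis using M
        by (simp add: a V.rhoL_simps powr el_def u2_def m2_def wdeg_def)
    qed
  next
    show "pbw_coords C.act3 (X L1) (X L2) C.X12 (\<lambda>a b c. enat c < N \<and> enat b < N \<and> enat a < N) C.v0
        (\<lambda>(a, b, c) f. f a b c)"
      unfolding pbw_coords_def XL
    proof (intro conjI allI impI)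
      show "(case j of (a, b, c) \<Rightarrow> \<lambda>f. f a b c) (C.act3 (cg x) v) = cg x * (case j of (a, b, c) \<Rightarrow> \<lambda>f. f a b c) v"
        for j x and v :: "nat \<Rightarrow> nat \<Rightarrow> nat \<Rightarrow> 'g \<Rightarrow>\<^sub>0 'k"
        by (cases j) (simp add: C.L_fixed C.B2.L_fixed C.B1.L_fixed fix_cst lmul_def)
      show "(case (a', b', c') of (a, b, c) \<Rightarrow> \<lambda>f. f a b c) ((C.X2 ^^ a) ((C.X12 ^^ b) ((C.X1 ^^ c) (C.act3 k C.v0)))) =
          (if (a', b', c') = (a, b, c) then k else 0)"
        if "enat c < N \<and> enat b < N \<and> enat a < N" for a b c a' b' c' k
        using that C.coords[of a b c k] by (auto simp: N delta_def split: if_splits)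
    qed (auto split: prod.split)
  qed
qed

end

section \<open>Scalars of the group algebra for the remaining cases\<close>

lemma twist_character_single:
  "twist \<psi> (single h 1) = cst (\<psi> h) * single (h::'g::comm_monoid_add) (1::'k::field)"
  by (simp add: twist_single mult_single)

text \<open>\<open>b\<close> is read off from the coefficient of x12 in x1 x12^2, computed in two
  ways; \<open>e\<close> solves the overlap formula for x12^2, where 1 + q must be invertible. The
  alternatives in the last assumptions of \<open>u\<close> and \<open>l\<close> are the values met
  by left and by right multiplication.\<close>

lemma quad_scalars_twist:
  fixes c1 c2 :: "'g::ab_group_add \<Rightarrow> 'k::field" and p q \<mu> \<nu> :: 'k and d m :: 'g
  defines "P \<equiv> cst p :: 'g \<Rightarrow>\<^sub>0 'k" and "Q \<equiv> cst q :: 'g \<Rightarrow>\<^sub>0 'k" and "u \<equiv> el \<mu> d" and "l \<equiv> el \<nu> m"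
  defines "b \<equiv> twist c1 (twist c2 l) + Q * P * l" and "r \<equiv> u - P * P * twist c1 u"
  defines "s \<equiv> l * twist c1 u - P * P * u * l - P * u * b"
    and "e \<equiv> cst (inverse (p * (1 + q))) * (r - Q * P * P * twist c1 r)"
  assumes c: "character c1" "character c2" and p: "p \<noteq> 0" and q: "1 + q \<noteq> 0"
    and u: "\<mu> \<noteq> 0 \<Longrightarrow> c2 d = 1" "\<And>h. \<mu> \<noteq> 0 \<Longrightarrow> c2 h * c2 h = 1"
      "\<mu> \<noteq> 0 \<Longrightarrow> p * p = 1 \<and> q * q * c1 d = 1 \<or> p * p * (q * q) = 1 \<and> p * p * c1 d = 1"
    and l: "\<And>h. \<nu> \<noteq> 0 \<Longrightarrow> c1 h * c1 h * c2 h = 1" "\<nu> \<noteq> 0 \<Longrightarrow> q * q = -1 \<and> c2 m = -1"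
      "\<nu> \<noteq> 0 \<Longrightarrow> p = -1 \<and> c1 m = -q \<or> p = q \<and> c1 m = q"
  shows "quad_scalars (twist c1) (twist c2) P Q u l b e r s"
proof -
  define M where "M = (cst \<mu> :: 'g \<Rightarrow>\<^sub>0 'k)"
  define K where "K = (single d 1 :: 'g \<Rightarrow>\<^sub>0 'k)"
  define \<Lambda> where "\<Lambda> = (cst \<nu> :: 'g \<Rightarrow>\<^sub>0 'k)"
  define Y where "Y = (single m 1 :: 'g \<Rightarrow>\<^sub>0 'k)"
  have endo: "ring_endo (twist c1)" "ring_endo (twist c2)" using c by (auto intro: ring_endo_twist)
  note rr = ring_endoD[OF endo(1)] ring_endoD[OF endo(2)]
  have fx: "twist c1 (cst x) = cst x" "twist c2 (cst x) = cst x" for x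
    using c by (simp_all add: twist_single character_zero)
  have PQ: "twist c1 P = P" "twist c2 P = P" "twist c1 Q = Q" "twist c2 Q = Q"
    "twist c1 M = M" "twist c2 M = M" "twist c1 \<Lambda> = \<Lambda>" "twist c2 \<Lambda> = \<Lambda>"
    by (simp_all add: P_def Q_def M_def \<Lambda>_def fx)
  have uM: "u = M * (1 - K)" and lL: "l = \<Lambda> * (1 - Y)"
    by (simp_all add: u_def l_def el_def M_def K_def \<Lambda>_def Y_def)
  have u0: "u = 0 \<and> r = 0 \<and> e = 0" if "\<mu> = 0" using that by (simp add: e_def r_def u_def)
  have l0: "l = 0 \<and> b = 0" if "\<nu> = 0" using that by (simp add: b_def l_def)
  have e: "P * (1 + Q) * e = r - Q * P * P * twist c1 r"
  proof -
    have "P * (1 + Q) * cst (inverse (p * (1 + q))) = cst (p * (1 + q) * inverse (p * (1 + q)))"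
      by (simp only: P_def Q_def cst_simps)
    also have "p * (1 + q) * inverse (p * (1 + q)) = 1"
      using p q by (intro right_inverse) simp
    finally show ?thesis by (simp add: e_def cst_simps mult.assoc[symmetric])
  qed
  have e1: "Q * Q * P * P * twist c1 e = e"
  proof (cases "\<mu> = 0")
    case False
    have tK: "twist c1 K = cst (c1 d) * K" by (simp add: K_def twist_character_single)
    \<comment> \<open>\<open>r\<close> is an eigenvector of the twist: under the first alternative
      only its part along \<open>d\<close> survives, under the second only its constant part.
      \<open>e\<close> inherits the eigenvalue.\<close>
    have "\<exists>x. twist c1 r = cst x * r \<and> q * q * p * p * x = 1"
      using u(3)[OF False]
    proof (elim disjE conjE)
      assume *: "p * p = 1" "q * q * c1 d = 1"
      then have "P * P = 1" by (simp add: P_def cst_simps(1)[symmetric])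
      then have "r = M * ((cst (c1 d) - 1) * K)"
        by (simp add: r_def uM rr PQ tK algebra_simps)
      then have "twist c1 r = cst (c1 d) * r" by (simp add: rr PQ tK fx mult_ac)
      then show ?thesis using * by (intro exI[of _ "c1 d"]) (simp add: mult.assoc)
    next
      assume *: "p * p * (q * q) = 1" "p * p * c1 d = 1"
      then have "P * P * cst (c1 d) = 1" by (simp add: P_def cst_simps(1)[symmetric])
      then have "P * P * (cst (c1 d) * K) = K" by (simp add: mult.assoc[symmetric])
      then have "r = M * (1 - P * P)"
        by (simp add: r_def uM rr PQ tK right_diff_distrib mult.left_commute mult.assoc)
      then have "twist c1 r = cst 1 * r" by (simp add: rr PQ)
      then show ?thesis using * by (intro exI[of _ 1]) (simp add: mult_ac)
    qed
    then obtain x where x: "twist c1 r = cst x * r" "q * q * p * p * x = 1" by blast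
    have "twist c1 e = cst x * e" by (simp add: e_def rr PQ fx x(1) algebra_simps)
    moreover have "Q * Q * P * P * cst x = 1"
      unfolding P_def Q_def cst_simps(1)[symmetric] x(2) by simp
    ultimately show ?thesis by (simp add: mult.assoc[symmetric])
  qed (simp add: u0)
  have L: "Q * Q * P * twist c1 b = b \<and> twist c2 l = - (P * P * l) - P * (1 + Q) * b \<and>
     twist c1 (twist c2 (twist c2 l)) = Q * P * P * (P * l + b) \<and>
     s + Q * P * twist c1 l * twist c1 r - Q * P * P * r * l - Q * P * r * b - Q * Q * P * P * P * twist c1 s = 0"
  proof (cases "\<nu> = 0")
    case True
    then show ?thesis using l0 by (simp add: s_def)
  next
    case False
    have QQ: "Q * Q = -1" using l(2)[OF False] by (simp add: Q_def cst_simps(1)[symmetric] single_uminus)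
    have QQ': "Q * (Q * x) = - x" for x using QQ by (simp add: mult.assoc[symmetric])
    \<comment> \<open>With q^2 = -1 either alternative for a nonzero \<mu> gives c1(d) = -1, so the
      twist by \<open>c1\<close> only changes the sign of \<open>d\<close>.\<close>
    have tu: "twist c1 (twist c1 u) = u"
    proof (cases "\<mu> = 0")
      case False
      have qq: "q * q = -1" using l(2)[OF \<open>\<nu> \<noteq> 0\<close>] ..
      from u(3)[OF False] have "- c1 d = 1"
      proof (elim disjE conjE)
        assume *: "p * p * (q * q) = 1" "p * p * c1 d = 1"
        then have "p * p = - 1" unfolding qq by (metis minus_minus mult_minus_right mult.right_neutral)
        then show ?thesis using *(2) by simp
      qed (simp add: qq)
      then have "c1 d = -1" by (metis minus_minus)
      then have "twist c1 K = - K" by (simp add: K_def twist_single single_uminus)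
      then show ?thesis by (simp add: uM rr PQ)
    qed (simp add: u0)
    have tY: "twist c1 Y = cst (c1 m) * Y" "twist c2 Y = - Y"
      using l(2)[OF False] by (simp_all add: Y_def twist_character_single cst_simps)
    from l(3)[OF False] show ?thesis
    proof (elim disjE conjE)
      assume "p = -1" "c1 m = - q"
      then have *: "P = -1" "twist c1 Y = - (Q * Y)" using tY by (simp_all add: P_def Q_def cst_simps)
      show ?thesis by (simp add: s_def b_def r_def lL * tY(2) tu rr PQ QQ QQ' algebra_simps)
    next
      assume "p = q" "c1 m = q"
      then have *: "P = Q" "twist c1 Y = Q * Y" using tY by (simp_all add: P_def Q_def)
      show ?thesis by (simp add: s_def b_def r_def lL * tY(2) tu rr PQ QQ QQ' algebra_simps)
    qed
  qed
  show ?thesis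
  proof
    show "twist c2 (twist c1 k) = twist c1 (twist c2 k)" for k by (rule twist_commute)
    show "twist c2 u = u" unfolding u_def using c u by (intro twist_el_fixed) (auto simp: character_zero)
    show "u = 0 \<and> e = 0 \<or> (\<forall>k. twist c2 (twist c2 k) = k)"
      using u0 u(2) by (cases "\<mu> = 0") (auto simp: twist_twist twist_id)
    show "l = 0 \<and> b = 0 \<or> (\<forall>k. twist c1 (twist c1 (twist c2 k)) = k)"
      using l0 l(1) by (cases "\<nu> = 0") (auto simp: twist_twist mult.assoc intro!: twist_id)
    show "twist c1 (twist c2 l) = b - Q * P * l" by (simp add: b_def)
  qed (rule endo PQ e e1 L[THEN conjunct1] L[THEN conjunct2, THEN conjunct1]
      L[THEN conjunct2, THEN conjunct2, THEN conjunct1] L[THEN conjunct2, THEN conjunct2, THEN conjunct2]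
      | simp only: r_def s_def)+
qed

text \<open>The errors left when X1^M passes \<open>Y\<close> and \<open>X2\<close>. A nonzero
  coefficient forces M = 4 and q^2 = -1, and the terms then cancel.\<close>

lemma quad_power_sums:
  fixes c1 :: "'g::ab_group_add \<Rightarrow> 'k::field" and p q \<nu> :: 'k and m :: 'g
  defines "P \<equiv> cst p :: 'g \<Rightarrow>\<^sub>0 'k" and "Q \<equiv> cst q :: 'g \<Rightarrow>\<^sub>0 'k" and "l \<equiv> el \<nu> m"
  assumes c: "character c1" and l: "\<nu> \<noteq> 0 \<Longrightarrow> M = 4 \<and> q * q = -1"
      "\<nu> \<noteq> 0 \<Longrightarrow> p = -1 \<and> c1 m = -q \<or> p = q \<and> c1 m = q"
  shows "(\<Sum>i<M. (Q * P) ^ i * (twist c1 ^^ i) l) = 0"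
    "(\<Sum>j<M. P ^ (j - 1) * qn Q j * (twist c1 ^^ (j - 1)) l) = 0"
proof -
  have endo: "ring_endo (twist c1)" using c by (rule ring_endo_twist)
  note rr = ring_endoD[OF endo]
  have "(\<Sum>i<M. (Q * P) ^ i * (twist c1 ^^ i) l) = 0 \<and>
    (\<Sum>j<M. P ^ (j - 1) * qn Q j * (twist c1 ^^ (j - 1)) l) = 0"
  proof (cases "\<nu> = 0")
    case True
    then show ?thesis by (simp add: l_def ring_endoD[OF ring_endo_funpow[OF endo]])
  next
    case False
    define \<Lambda> where "\<Lambda> = (cst \<nu> :: 'g \<Rightarrow>\<^sub>0 'k)"
    define Y where "Y = (single m 1 :: 'g \<Rightarrow>\<^sub>0 'k)"
    have lL: "l = \<Lambda> * (1 - Y)" by (simp add: l_def el_def \<Lambda>_def Y_def)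
    have fx: "twist c1 Q = Q" "twist c1 \<Lambda> = \<Lambda>"
      using c by (simp_all add: Q_def \<Lambda>_def twist_single character_zero)
    have M: "M = Suc (Suc (Suc (Suc 0)))" and qq: "q * q = -1" using l(1)[OF False] by simp_all
    have QQ: "Q * Q = -1" using qq by (simp add: Q_def cst_simps(1)[symmetric] single_uminus)
    have QQ': "Q * (Q * x) = - x" for x using QQ by (simp add: mult.assoc[symmetric])
    have tY: "twist c1 Y = cst (c1 m) * Y" by (simp add: Y_def twist_character_single)
    from l(2)[OF False] show ?thesis
    proof (elim disjE conjE)
      assume "p = -1" "c1 m = - q"
      then have *: "P = -1" "twist c1 Y = - (Q * Y)" using tY by (simp_all add: P_def Q_def cst_simps)
      show ?thesis by (simp add: M lL * rr fx qn_Suc QQ QQ' algebra_simps)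
    next
      assume "p = q" "c1 m = q"
      then have *: "P = Q" "twist c1 Y = Q * Y" using tY by (simp_all add: P_def Q_def)
      show ?thesis by (simp add: M lL * rr fx qn_Suc QQ QQ' algebra_simps)
    qed
  qed
  then show "(\<Sum>i<M. (Q * P) ^ i * (twist c1 ^^ i) l) = 0"
    "(\<Sum>j<M. P ^ (j - 1) * qn Q j * (twist c1 ^^ (j - 1)) l) = 0" by auto
qed

lemma character_minus: "character c \<Longrightarrow> c (- h) = inverse (c h)"
  using character_zero[of c] by (metis add.right_inverse character_def inverse_unique)

text \<open>The scalar \<open>r\<close> of the pair model has a constant part and a part along
  \<open>d\<close>, on which the composite twist acts by 1 and by c1(d). The sum thus splits into
  geometric sums with ratios p^2 and p^2 c1(d), and both telescope to zero because these ratios have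
  M-th power 1.\<close>

lemma case4_twist:
  fixes c1 c2 :: "'g::ab_group_add \<Rightarrow> 'k::field" and p \<mu> \<mu>' :: 'k and d d' :: 'g
  assumes c: "character c1" "character c2" and p: "p \<noteq> 0" and M: "M \<noteq> 1" "M = 0 \<Longrightarrow> \<mu>' = 0"
    and \<mu>: "\<mu> \<noteq> 0 \<Longrightarrow> c2 d = 1" "\<And>h. \<mu> \<noteq> 0 \<Longrightarrow> c2 h * c2 h = 1"
      "\<mu> \<noteq> 0 \<Longrightarrow> (p ^ 2) ^ M = 1 \<and> (p ^ 2 * c1 d) ^ M = 1"
    and \<mu>': "\<mu>' \<noteq> 0 \<Longrightarrow> c1 d' = 1 \<and> c2 d' = 1 \<and> (- p) ^ M = 1" "\<And>h. \<mu>' \<noteq> 0 \<Longrightarrow> (c1 h * c2 h) ^ M = 1"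
  shows "case4 (twist c1) (twist c2) M (cst p) (el \<mu>' d') (el \<mu> d) (cst (inverse p))"
proof
  define P where "P = (single 0 p :: 'g \<Rightarrow>\<^sub>0 'k)"
  define K where "K = (single d 1 :: 'g \<Rightarrow>\<^sub>0 'k)"
  show endo: "ring_endo (twist c1)" "ring_endo (twist c2)" using c by (auto intro: ring_endo_twist)
  note rr = ring_endoD[OF endo(1)] ring_endoD[OF endo(2)]
  show "twist c2 (twist c1 k) = twist c1 (twist c2 k)" for k by (rule twist_commute)
  show fx: "twist c1 (cst x) = cst x" "twist c2 (cst x) = cst x" for x
    using c by (simp_all add: twist_single character_zero)
  have "cst (inverse p) * P = cst (inverse p * p)" unfolding P_def cst_simps(1) ..
  then show "cst (inverse p) * (cst p :: 'g \<Rightarrow>\<^sub>0 'k) = 1" using p by (simp add: P_def)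
  have \<mu>'_fixed: "twist c1 (el \<mu>' d') = el \<mu>' d'" "twist c2 (el \<mu>' d') = el \<mu>' d'"
    using c \<mu>' by (auto intro!: twist_el_fixed simp: character_zero)
  then show "twist c1 (twist c2 (el \<mu>' d')) = el \<mu>' d'" by simp
  have "- cst p = (cst (- p) :: 'g \<Rightarrow>\<^sub>0 'k)" by (simp add: single_uminus)
  then have "(- cst p) ^ M * el \<mu>' d' = el \<mu>' d'"
    using \<mu>' by (auto intro!: cst_mul_el simp flip: cst_simps(7))
  then show "twist c2 (el \<mu>' d') = (- cst p) ^ M * el \<mu>' d'" by (simp add: \<mu>'_fixed)
  show "el \<mu>' d' * ((\<lambda>k. twist c1 (twist c2 k)) ^^ M) k = el \<mu>' d' * k" for k
    unfolding twist_diag using \<mu>' by (intro el_mul_twist)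
  show "twist c2 (el \<mu> d) = el \<mu> d" using c \<mu> by (auto intro!: twist_el_fixed simp: character_zero)
  show "el \<mu> d * twist c2 (twist c2 k) = el \<mu> d * k" for k
    unfolding twist_twist using \<mu> by (intro el_mul_twist)
  show "(\<Sum>i<M. ((cst p)\<^sup>2) ^ i * ((\<lambda>k. twist c1 (twist c2 k)) ^^ i)
      (el \<mu> d - (cst p)\<^sup>2 * twist c1 (el \<mu> d))) = 0"
  proof (cases "\<mu> = 0")
    case True
    have "((\<lambda>k. twist c1 (twist c2 k)) ^^ i) 0 = 0" for i by (induction i) simp_all
    then show ?thesis by (simp add: True)
  next
    case False
    define C where "C = (single 0 (c1 d) :: 'g \<Rightarrow>\<^sub>0 'k)"
    define m where "m = (single 0 \<mu> :: 'g \<Rightarrow>\<^sub>0 'k)"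
    have tK: "twist c1 K = C * K" "twist c2 K = K"
      using \<mu> False by (simp_all add: K_def C_def twist_character_single)
    have fx': "twist c1 P = P" "twist c2 P = P" "twist c1 C = C" "twist c2 C = C" "twist c1 m = m" "twist c2 m = m"
      by (simp_all add: P_def C_def m_def fx)
    have eq: "el \<mu> d - P\<^sup>2 * twist c1 (el \<mu> d) = m * (1 - P\<^sup>2) - m * ((1 - P\<^sup>2 * C) * K)"
      by (simp add: el_def K_def[symmetric] m_def[symmetric] rr fx' tK algebra_simps)
    have "((\<lambda>k. twist c1 (twist c2 k)) ^^ i) (m * (1 - P\<^sup>2) - m * ((1 - P\<^sup>2 * C) * K))
        = m * (1 - P\<^sup>2) - m * ((1 - P\<^sup>2 * C) * (C ^ i * K))" for i
      by (induction i) (simp_all add: rr fx' tK mult_ac)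
    then have "(\<Sum>i<M. (P\<^sup>2) ^ i * ((\<lambda>k. twist c1 (twist c2 k)) ^^ i) (el \<mu> d - P\<^sup>2 * twist c1 (el \<mu> d)))
        = (\<Sum>i<M. (P\<^sup>2) ^ i * (m * (1 - P\<^sup>2)) - (P\<^sup>2 * C) ^ i * (m * ((1 - P\<^sup>2 * C) * K)))"
      unfolding eq by (intro sum.cong) (simp_all add: right_diff_distrib power_mult_distrib mult_ac)
    also have "\<dots> = - m * ((P\<^sup>2 - 1) * qn (P\<^sup>2) M) + m * K * ((P\<^sup>2 * C - 1) * qn (P\<^sup>2 * C) M)"
      unfolding sum_subtractf sum_distrib_right[symmetric] qn_def[symmetric] by (simp add: algebra_simps)
    also have "\<dots> = 0"
    proof -
      have "P\<^sup>2 * C = cst (p\<^sup>2 * c1 d)" "P\<^sup>2 = cst (p\<^sup>2)" by (simp_all add: P_def C_def cst_simps)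
      then have "(P\<^sup>2) ^ M = 1" "(P\<^sup>2 * C) ^ M = 1"
        using \<mu>(3)[OF False] by (simp_all only: cst_simps(7)[symmetric]) simp_all
      then show ?thesis unfolding qn_telescope by simp
    qed
    finally show ?thesis unfolding P_def .
  qed
qed (use M in auto)

fun other :: "letter \<Rightarrow> letter"
  where "other L1 = L2" | "other L2 = L1"

text \<open>
  The letter adjoined first selects left multiplication (\<open>L1\<close>) or right multiplication (\<open>L2\<close>), so that one model
  serves both a case and its mirror image.
\<close>

definition orient :: "letter \<Rightarrow> 'g::ab_group_add \<Rightarrow> 'g"
  where "orient i h = (if i = L1 then h else - h)"

lemma (in smash) chi_orient: "\<chi> k (orient i h) = (if i = L1 then \<chi> k h else inverse (\<chi> k h))"
  using character_minus[OF char1] character_minus[OF char2] by (cases k) (simp_all add: orient_def)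

context letters_rep
begin

definition rho :: "letter \<Rightarrow> ('g, 'k) smash \<Rightarrow> 'v \<Rightarrow> 'v"
  where "rho i = (if i = L1 then rhoL else rhoR)"

lemma rho_op: "algebra_op \<chi> act (rho i) (orient i)"
  using L.algebra_op_axioms R.algebra_op_axioms
  by (cases i) (simp_all add: rho_def orient_def[abs_def])

lemmas rho_simps = algebra_op.rho_diff[OF rho_op] algebra_op.rho_scl[OF rho_op]
  algebra_op.rho_dpow[OF rho_op] algebra_op.rho_pow[OF rho_op]

lemma rho_var: "rho i (var k) v = X k v"
  by (simp add: rho_def rhoL_var rhoR_var)

lemma rho_x12: "rho i (x12 g \<chi>) v = X i (X (other i) v) - cst (\<chi> L2 (g L1)) \<bullet> X (other i) (X i v)"
  by (cases i) (simp_all add: x12_eq rho_def rhoL_simps rhoR_simps rhoL_mul rhoR_mul rhoL_var rhoR_var)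

text \<open>Under reversed products \<open>x122\<close> takes the shape of \<open>x112\<close> with
  the letters exchanged, while q12 stays in place. One commutation rule therefore covers both
  orientations.\<close>

lemma rho_cubic:
  assumes "a = (if i = L1 then x112 g \<chi> else x122 g \<chi>)"
  shows "rho i a v = X i (rho i (x12 g \<chi>) v) - cst (\<chi> i (g i) * \<chi> L2 (g L1)) \<bullet> rho i (x12 g \<chi>) (X i v)"
  using assms by (cases i) (simp_all add: x112_eq x122_eq rho_def rhoL_simps rhoR_simps rhoL_mul rhoR_mul
      rhoL_var rhoR_var mult.commute[of "\<chi> L2 (g L2)"])

lemma rho_basis:
  assumes "pbw_order \<chi> I y p s s' N1 N12 N2" "I = Idl\<^bsub>A\<^esub> S"
    and "\<And>a v. a \<in> S \<Longrightarrow> rho i a v = 0" "\<And>v. rho i y v = Y v"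
    and "semilin act (\<lambda>k. twist (\<chi> i) (twist (\<chi> (other i)) k)) Y"
    and N: "N = (if i = L1 then N1 else N2)" "N' = (if i = L1 then N2 else N1)"
    and "pbw_coords act (X i) (X (other i)) Y (\<lambda>a b c. enat c < N \<and> enat b < N12 \<and> enat a < N') v0 \<pi>"
  shows "pbw_basis I y N1 N12 N2"
proof (cases i)
  case L1
  then show ?thesis using assms by (intro basis_left[where Y = Y]) (auto simp: rho_def)
next
  case L2
  have "(\<lambda>c b a. enat c < N1 \<and> enat b < N12 \<and> enat a < N2) = (\<lambda>c b a. enat a < N2 \<and> enat b < N12 \<and> enat c < N1)"
    by (auto simp: fun_eq_iff)
  then show ?thesis using L2 assms by (intro basis_right[where Y = Y]) (auto simp: rho_def)
qed

end

section \<open>The cases (2) to (4) in both orientations\<close>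

context smash
begin

text \<open>\<open>i = L1\<close> is case (2) and \<open>i = L2\<close> case (3). The letter
  \<open>i\<close> carries the parameter \<open>q\<close> with q^M = 1 and is adjoined first; the
  other letter has parameter -1. \<open>M = 0\<close> encodes infinite order.\<close>

lemma quad_basis:
  fixes g :: "letter \<Rightarrow> 'g" and M :: nat
  defines "p \<equiv> \<chi> L2 (g L1)" and "r \<equiv> \<chi> L1 (g L2)"
  assumes q_def: "q = \<chi> i (g i)" and M: "M \<noteq> 1" and qM: "q ^ M = 1" "q \<noteq> 1" "1 + q \<noteq> 0"
    and q': "\<chi> (other i) (g (other i)) = -1" and prq: "p * r * q = 1"
    and mu: "\<And>h. \<mu> \<noteq> 0 \<Longrightarrow> \<chi> i h ^ M = 1"
    and mu': "\<And>h. \<mu>' \<noteq> 0 \<Longrightarrow> \<chi> (other i) h * \<chi> (other i) h = 1"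
    and la: "la \<noteq> 0 \<Longrightarrow> M = 4 \<and> q * q = -1"
    and la': "\<And>h. la \<noteq> 0 \<Longrightarrow> \<chi> i h * \<chi> i h * \<chi> (other i) h = 1"
    and N: "N = (if M = 0 then \<infinity> else enat M)" "N = (if i = L1 then N1 else N2)" "2 = (if i = L1 then N2 else N1)"
    and order: "pbw_order \<chi> I (x12 g \<chi>) s1 s2 s3 N1 2 N2" and I: "I = Idl\<^bsub>A\<^esub> S"
    and xx: "xx = (if i = L1 then x112 g \<chi> else x122 g \<chi>)" and wd: "wdeg g \<omega> = g i + g i + g (other i)"
    and S: "\<And>a. a \<in> S \<Longrightarrow> a = xx - la \<cdot> dpow g \<chi> \<omega> 1 \<or> M > 0 \<and> a = var i \<up> M - \<mu> \<cdot> dpow g \<chi> [i] M \<or>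
      a = var (other i) \<up> 2 - \<mu>' \<cdot> dpow g \<chi> [other i] 2"
  shows "pbw_basis I (x12 g \<chi>) N1 2 N2"
proof -
  have p0: "p \<noteq> 0" by (simp add: p_def chi_nonzero)
  have chars: "character (\<chi> k)" for k using char1 char2 by (cases k) auto
  note ch = chi_orient chi_gpow[OF chars] chi_add q_def[symmetric] q'
  define m where "m = (if M = 0 then 0 else \<mu>)"
  define u1 where "u1 = el m (orient i (gpow (g i) M))"
  have m: "m \<noteq> 0 \<Longrightarrow> \<mu> \<noteq> 0" by (simp add: m_def split: if_splits)
  have pr: "p ^ M = 1 \<and> \<chi> (other i) (g i) ^ M = 1" if "\<mu> \<noteq> 0"
  proof -
    have "p ^ M * r ^ M * q ^ M = 1" using arg_cong[OF prq, of "\<lambda>x. x ^ M"] by (simp add: power_mult_distrib)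
    then show ?thesis using qM mu[OF that, of "g (other i)"] by (cases i) (simp_all add: p_def r_def)
  qed
  define w where "w = orient i (g i + g i + g (other i))"
  \<comment> \<open>With q^2 = -1, the trivial character of the cubic word evaluated at
    \<open>g i\<close> makes one of p, r equal to -1, and p r q = 1 makes the other q. Which of the
    two is -1 depends on the orientation.\<close>
  have pq: "(p = -1 \<and> \<chi> i w = - q \<or> p = q \<and> \<chi> i w = q) \<and> \<chi> (other i) w = -1" if "la \<noteq> 0"
  proof -
    have qq: "q * q = -1" using la[OF that] by simp
    have *: "x = -1 \<and> y = q" if "q * q * x = 1" "x * y * q = 1" for x y
    proof -
      have x: "x = -1" using that(1) qq by simp (metis minus_minus)
      have "q * (x * y * q) = q" using that(2) by simp
      then have "x * y * (q * q) = q" by (simp add: mult_ac)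
      then show ?thesis using x qq by simp
    qed
    have iq: "inverse (- q) = q" using qq by (intro inverse_unique) simp
    show ?thesis
    proof (cases i)
      case L1
      then have "p = -1 \<and> r = q" using la'[OF that, of "g L1"] prq by (intro *) (simp_all add: p_def q_def)
      then show ?thesis using L1 qq q' q_def[symmetric] by (simp add: w_def chi_orient chi_add p_def[symmetric] r_def[symmetric])
    next
      case L2
      then have "r = -1 \<and> p = q" using la'[OF that, of "g L2"] prq by (intro *) (simp_all add: r_def q_def mult_ac)
      then show ?thesis using L2 qq iq q' q_def[symmetric]
        by (simp add: w_def chi_orient chi_add p_def[symmetric] r_def[symmetric] mult.assoc)
    qed
  qed
  \<comment> \<open>The character of the other letter has square 1, which gives p^2 = 1 in one
    orientation and r^2 = 1 in the other. The rest is the square of p r q = 1.\<close>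
  have uq: "p * p = 1 \<and> q * q * \<chi> i (orient i (gpow (g (other i)) 2)) = 1 \<or>
      p * p * (q * q) = 1 \<and> p * p * \<chi> i (orient i (gpow (g (other i)) 2)) = 1" if "\<mu>' \<noteq> 0"
  proof -
    have eq: "(p * p) * (q * q * (r * r)) = 1" "(r * r) * (p * p * (q * q)) = 1"
      using arg_cong[OF prq, of "\<lambda>x. x * x"] by (simp_all add: mult_ac)
    show ?thesis
    proof (cases i)
      case L1
      then have "p * p = 1" using mu'[OF that, of "g L1"] by (simp add: p_def)
      then show ?thesis using L1 eq(1) by (simp add: ch r_def[symmetric] power2_eq_square)
    next
      case L2
      then have "r * r = 1" using mu'[OF that, of "g L2"] by (simp add: r_def)
      moreover have "p * p * (inverse p * inverse p) = 1" using p0 by (simp add: field_simps)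
      ultimately show ?thesis using L2 eq(2) by (simp add: ch p_def[symmetric] power2_eq_square)
    qed
  qed
  define P where "P = (cst p :: 'g \<Rightarrow>\<^sub>0 'k)"
  define Q where "Q = (cst q :: 'g \<Rightarrow>\<^sub>0 'k)"
  define u2 where "u2 = el \<mu>' (orient i (gpow (g (other i)) 2))"
  obtain b e r' s where "quad_scalars (twist (\<chi> i)) (twist (\<chi> (other i))) P Q u2 (el la w) b e r' s"
  proof -
    have 1: "\<chi> (other i) (orient i (gpow (g (other i)) 2)) = 1" unfolding ch by simp
    have "\<exists>b e r' s. quad_scalars (twist (\<chi> i)) (twist (\<chi> (other i))) P Q u2 (el la w) b e r' s"
      unfolding P_def Q_def u2_def
      by (intro exI, rule quad_scalars_twist[OF chars chars p0]) (use 1 qM mu' la' la pq uq in blast)+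
    then show ?thesis using that by blast
  qed
  then interpret C: case2 "twist (\<chi> i)" "twist (\<chi> (other i))" P Q u2 "el la w" b e r' s M u1
  proof (intro case2.intro case2_axioms.intro)
    have "\<chi> i (orient i (gpow (g i) M)) = 1" unfolding ch using qM by simp
    then show "twist (\<chi> i) u1 = u1"
      unfolding u1_def by (intro twist_el_fixed) (auto simp: chi_zero)
    have "\<chi> (other i) (orient i (gpow (g i) M)) = 1" if "m \<noteq> 0"
      unfolding ch using pr[OF m[OF that]] by (cases i) simp_all
    then have "twist (\<chi> (other i)) u1 = u1"
      unfolding u1_def by (intro twist_el_fixed) (auto simp: chi_zero)
    moreover have "P ^ M * u1 = u1"
      unfolding u1_def P_def using m pr by (auto intro!: cst_mul_el simp flip: cst_simps(7))
    ultimately show "twist (\<chi> (other i)) u1 = P ^ M * u1" by simp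
    show "u1 * (twist (\<chi> i) ^^ M) k = u1 * k" for k
      unfolding u1_def twist_pow using m mu by (auto intro!: el_mul_twist)
  qed (use M in \<open>auto simp: u1_def m_def\<close>)
  have X1_pow: "(C.X1 ^^ M) v = C.qact u1 v" if "M > 0" for v
  proof (rule C.X1_power[OF that])
    show "qn Q M = 0" "Q ^ M = 1"
      using qn_root[of q M] qM unfolding Q_def cst_qn cst_simps(7)[symmetric] by simp_all
    show "(\<Sum>j<M. (Q * P) ^ j * (twist (\<chi> i) ^^ j) (el la w)) = 0"
      "(\<Sum>j<M. P ^ (j - 1) * qn Q j * (twist (\<chi> i) ^^ (j - 1)) (el la w)) = 0"
      unfolding P_def Q_def using la pq by (intro quad_power_sums[OF chars]; blast)+
  qed
  define X where "X = (\<lambda>k. if k = i then C.X1 else C.X2)"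
  have oi: "other i \<noteq> i" "k \<noteq> i \<Longrightarrow> k = other i" for k by (cases i; cases k; simp)+
  interpret V: letters_rep \<chi> C.qact X
  proof (intro letters_rep.intro letters_rep_axioms.intro)
    show "Modules.module C.qact" by (rule C.qact_module)
    show "semilin C.qact (twist (\<chi> k)) (X k)" for k
      using C.X1_semilin C.X2_semilin oi(2)[of k] by (auto simp: X_def)
  qed unfold_locales
  have XL [simp]: "X i = C.X1" "X (other i) = C.X2" using oi(1) by (simp_all add: X_def)
  have r12: "V.rho i (x12 g \<chi>) v = C.Y v" for v
    by (simp add: V.rho_x12 C.X1_X2 p_def[symmetric] P_def[symmetric])
  have rxx: "V.rho i xx v = C.qact (el la w) v" for v
    by (simp add: V.rho_cubic[OF xx] r12 C.X1_Y cst_simps(1) q_def[symmetric] p_def[symmetric] P_def[symmetric] Q_def[symmetric])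
  show ?thesis
  proof (rule V.rho_basis[OF order I _ r12 C.Y_semilin N(2,3)])
    fix a v assume "a \<in> S"
    from S[OF this] show "V.rho i a v = 0"
    proof (elim disjE conjE)
      assume a: "a = xx - la \<cdot> dpow g \<chi> \<omega> 1"
      show ?thesis by (simp add: a V.rho_simps rxx el_def w_def wd gpow_1 del: One_nat_def)
    next
      assume M: "M > 0" and a: "a = var i \<up> M - \<mu> \<cdot> dpow g \<chi> [i] M"
      show ?thesis using M X1_pow
        by (simp add: a V.rho_simps V.rho_var[abs_def] el_def u1_def m_def wdeg_def)
    next
      assume a: "a = var (other i) \<up> 2 - \<mu>' \<cdot> dpow g \<chi> [other i] 2"
      show ?thesis
        by (simp add: a V.rho_simps V.rho_var[abs_def] funpow_2 C.X2_X2 u2_def[symmetric] el_def[symmetric] wdeg_def)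
    qed
  next
    show "pbw_coords C.qact (X i) (X (other i)) C.Y (\<lambda>a b c. enat c < N \<and> enat b < 2 \<and> enat a < 2) C.v0
        (\<lambda>(a, b, c) (v00, v10, v01, v11). (if b = 0 then if a = 0 then v00 else v10 else if a = 0 then v01 else v11) c)"
      unfolding pbw_coords_def XL
    proof (intro conjI allI impI, goal_cases)
      case (1 j v w)
      then show ?case by (auto split: prod.split)
    next
      case (2 j x v)
      then show ?case
        by (auto simp: C.qact_def C.B1.L_fixed twist_single chi_zero lmul_def split: prod.split)
    next
      case (3 a b c a' b' c' k)
      then have "a < 2" "b < 2" "a' < 2" "b' < 2" "M = 0 \<or> c < M"
        by (auto simp: N(1) numeral_eq_enat split: if_splits)
      then show ?case
        using C.coords[of a b c k] by (auto simp: delta_def less_2_cases_iff)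
    qed
  qed
qed

text \<open>\<open>i\<close> is the letter whose square is zero; it is adjoined first, so that the
  square of the other letter may be a nonzero element of the group algebra.\<close>

lemma pair_basis:
  fixes g :: "letter \<Rightarrow> 'g" and M :: nat
  defines "p \<equiv> \<chi> L2 (g L1)" and "r \<equiv> \<chi> L1 (g L2)"
  assumes M: "M \<noteq> 1" and prM: "(p * r) ^ M = 1" and q: "\<chi> L1 (g L1) = -1" "\<chi> L2 (g L2) = -1"
    and mu: "\<And>h. \<mu> \<noteq> 0 \<Longrightarrow> \<chi> (other i) h * \<chi> (other i) h = 1"
    and mu12: "\<And>h. \<mu>12 \<noteq> 0 \<Longrightarrow> (\<chi> L1 h * \<chi> L2 h) ^ M = 1"
    and N: "N = (if M = 0 then \<infinity> else enat M)"
    and order: "pbw_order \<chi> I (x12 g \<chi>) s1 s2 s3 2 N 2" and I: "I = Idl\<^bsub>A\<^esub> S"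
    and S: "\<And>a. a \<in> S \<Longrightarrow> a = var i \<up> 2 \<or>
      M > 0 \<and> a = x12 g \<chi> \<up> M - \<mu>12 \<cdot> dpow g \<chi> [L1, L2] M \<or>
      a = var (other i) \<up> 2 - \<mu> \<cdot> dpow g \<chi> [other i] 2"
  shows "pbw_basis I (x12 g \<chi>) 2 N 2"
proof -
  have p0: "p \<noteq> 0" by (simp add: p_def chi_nonzero)
  have chars: "character (\<chi> k)" for k using char1 char2 by (cases k) auto
  have q': "\<chi> k (g k) = -1" for k using q by (cases k) simp_all
  note ch = chi_orient chi_gpow[OF chars] chi_add q'
  define m12 where "m12 = (if M = 0 then 0 else \<mu>12)"
  have m12: "m12 \<noteq> 0 \<Longrightarrow> \<mu>12 \<noteq> 0" by (simp add: m12_def split: if_splits)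
  have pr: "(- p) ^ M = 1 \<and> (- r) ^ M = 1" if "\<mu>12 \<noteq> 0"
    using mu12[OF that, of "g L1"] mu12[OF that, of "g L2"] by (simp add: q p_def r_def)
  have pr2: "(p ^ 2 * r ^ 2) ^ M = 1"
    using arg_cong[OF prM, of "\<lambda>x. x ^ 2"] by (simp add: power_mult_distrib mult.commute flip: power_mult)
  \<comment> \<open>The two ratios are 1 and r^2, or p^2 and 1, according to the orientation; M-th
    powers are controlled by (p r)^M = 1.\<close>
  have pp: "(p\<^sup>2) ^ M = 1 \<and> (p\<^sup>2 * \<chi> i (orient i (gpow (g (other i)) 2))) ^ M = 1" if "\<mu> \<noteq> 0"
  proof (cases i)
    case L1
    then have "p ^ 2 = 1" using mu[OF that, of "g L1"] by (simp add: p_def power2_eq_square)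
    then show ?thesis using L1 pr2 by (simp add: ch r_def)
  next
    case L2
    then have "r ^ 2 = 1" using mu[OF that, of "g L2"] by (simp add: r_def power2_eq_square)
    then show ?thesis using L2 pr2 p0 by (simp add: ch p_def[symmetric])
  qed
  define P where "P = (cst p :: 'g \<Rightarrow>\<^sub>0 'k)"
  interpret C: case4 "twist (\<chi> i)" "twist (\<chi> (other i))" M P "el m12 (orient i (gpow (g L1 + g L2) M))"
    "el \<mu> (orient i (gpow (g (other i)) 2))" "cst (inverse p)"
    unfolding P_def
  proof (rule case4_twist[OF chars chars p0 M])
    show "\<chi> (other i) (orient i (gpow (g (other i)) 2)) = 1" unfolding ch by simp
    show "(\<chi> i h * \<chi> (other i) h) ^ M = 1" if "m12 \<noteq> 0" for h
      using mu12[OF m12[OF that], of h] by (cases i) (simp_all add: mult.commute)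
    have "\<chi> k (orient i (gpow (g L1 + g L2) M)) = 1" if "m12 \<noteq> 0" for k
      using pr[OF m12[OF that]] by (cases k) (simp_all add: ch q p_def r_def)
    then show "\<chi> i (orient i (gpow (g L1 + g L2) M)) = 1 \<and> \<chi> (other i) (orient i (gpow (g L1 + g L2) M)) = 1
        \<and> (- p) ^ M = 1" if "m12 \<noteq> 0"
      using that pr[OF m12[OF that]] by simp
  qed (use pp mu in \<open>auto simp: m12_def\<close>)
  define X where "X = (\<lambda>k. if k = i then C.X1 else C.X2)"
  have oi: "other i \<noteq> i" "k \<noteq> i \<Longrightarrow> k = other i" for k by (cases i; cases k; simp)+
  interpret V: letters_rep \<chi> C.pact X
  proof (intro letters_rep.intro letters_rep_axioms.intro)
    show "Modules.module C.pact" by (rule C.pact_module)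
    show "semilin C.pact (twist (\<chi> k)) (X k)" for k
      using C.X1_semilin C.X2_semilin oi(2)[of k] by (auto simp: X_def)
  qed unfold_locales
  have XL [simp]: "X i = C.X1" "X (other i) = C.X2" using oi(1) by (simp_all add: X_def)
  have r12: "V.rho i (x12 g \<chi>) v = C.Y v" for v
    by (simp add: V.rho_x12 C.X1_X2 p_def[symmetric] P_def[symmetric])
  show ?thesis
  proof (rule V.rho_basis[where i = i and N = 2 and N' = 2, OF order I _ r12 C.Y_semilin])
    fix a v assume "a \<in> S"
    from S[OF this] show "V.rho i a v = 0"
    proof (elim disjE conjE)
      assume a: "a = var i \<up> 2"
      show ?thesis by (simp add: a V.rho_simps V.rho_var[abs_def] funpow_2 C.X1_X1)
    next
      assume M: "M > 0" and a: "a = x12 g \<chi> \<up> M - \<mu>12 \<cdot> dpow g \<chi> [L1, L2] M"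
      show ?thesis using M C.X12_pow
        by (simp add: a V.rho_simps r12[abs_def] el_def[symmetric] m12_def wdeg_def)
    next
      assume a: "a = var (other i) \<up> 2 - \<mu> \<cdot> dpow g \<chi> [other i] 2"
      show ?thesis
        by (simp add: a V.rho_simps V.rho_var[abs_def] funpow_2 C.X2_X2 el_def[symmetric] wdeg_def)
    qed
  next
    show "pbw_coords C.pact (X i) (X (other i)) C.Y (\<lambda>a b c. enat c < 2 \<and> enat b < N \<and> enat a < 2) C.v0
        (\<lambda>(a, b, c) (f0, f1). (if a = 0 then f0 else f1) b c)"
      unfolding pbw_coords_def XL
    proof (intro conjI allI impI, goal_cases)
      case (1 j v w)
      then show ?case by (auto split: prod.split)
    next
      case (2 j x v)
      then show ?case
        by (auto simp: C.pact_def C.B2.L_fixed C.B1.L_fixed twist_single chi_zero lmul_def split: prod.split)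
    next
      case (3 a b c a' b' c' k)
      then have "a < 2" "c < 2" "a' < 2" "c' < 2" "M = 0 \<or> b < M"
        by (auto simp: N numeral_eq_enat split: if_splits)
      then show ?case
        using C.coords[of a b c k] by (auto simp: delta_def less_2_cases_iff)
    qed
  qed simp_all
qed

end

section \<open>Orders of roots of unity\<close>

lemma mult_order_eqI:
  assumes "0 < n" "q ^ n = 1" "\<And>m. 0 < m \<Longrightarrow> m < n \<Longrightarrow> q ^ m \<noteq> 1"
  shows "mult_order q = enat n"
proof -
  have "(LEAST n. 0 < n \<and> q ^ n = 1) = n"
    by (rule Least_equality) (use assms in \<open>auto simp: not_less[symmetric]\<close>)
  then show ?thesis using assms by (auto simp: mult_order_def)
qed

text \<open>The premise excludes characteristic 2, where -1 has order 1.\<close>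

lemma mult_order_minus_one: "(-1 :: 'a::comm_ring_1) \<noteq> 1 \<Longrightarrow> mult_order (-1 :: 'a) = enat 2"
proof (rule mult_order_eqI)
  fix m :: nat assume "(-1 :: 'a) \<noteq> 1" "0 < m" "m < 2"
  then show "(-1 :: 'a) ^ m \<noteq> 1" by (simp add: less_2_cases_iff)
qed simp_all

lemma mult_order_cases:
  obtains M where "mult_order q = (if M = 0 then \<infinity> else enat M)" "q ^ M = 1"
proof (cases "mult_order q")
  case (enat n)
  then show ?thesis using that[of n] mult_order_enat[OF enat] by simp
next
  case infinity
  then show ?thesis using that[of 0] by simp
qed

lemma mult_order_le: "0 < m \<Longrightarrow> q ^ m = 1 \<Longrightarrow> mult_order q \<le> enat m"
  using mult_order_enat(3)[of q _ m] mult_order_infinity[of q m] by (cases "mult_order q") (auto simp: not_less[symmetric])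

lemma mult_order_ge_2: "2 \<le> mult_order q \<Longrightarrow> q \<noteq> 1"
  using mult_order_le[of 1 q] by (auto simp: numeral_eq_enat dest: order_trans)

lemma mult_order_ge_3: "3 \<le> mult_order q \<Longrightarrow> q \<noteq> 1 \<and> 1 + q \<noteq> (0 :: 'a::comm_ring_1)"
proof -
  assume *: "3 \<le> mult_order q"
  have ge: "3 \<le> m" if "0 < m" "q ^ m = 1" for m
    using order_trans[OF * mult_order_le[OF that]] by (simp add: numeral_eq_enat)
  have "q \<noteq> 1" using ge[of 1] by auto
  moreover have "1 + q \<noteq> 0"
  proof
    assume "1 + q = 0"
    then have "q = -1" by (simp add: eq_neg_iff_add_eq_0 add.commute)
    then show False using ge[of 2] by simp
  qed
  ultimately show ?thesis ..
qed

lemma order_4_square: "mult_order q = 4 \<Longrightarrow> q * q = (-1 :: 'a::field)"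
proof -
  assume "mult_order q = 4"
  then have o: "mult_order q = enat 4" by (simp add: numeral_eq_enat)
  have "(q ^ 2 - 1) * (q ^ 2 + 1) = q ^ 4 - 1" by (simp add: algebra_simps power2_eq_square eval_nat_numeral)
  then have "q ^ 2 + 1 = 0" using mult_order_enat(2)[OF o] mult_order_enat(3)[OF o, of 2] by simp
  then show ?thesis by (simp add: eq_neg_iff_add_eq_0 power2_eq_square)
qed

theorem proposition9p3:
  fixes g :: "letter \<Rightarrow> 'g::ab_group_add"
    and \<chi> :: "letter \<Rightarrow> 'g \<Rightarrow> 'k::field"
    and \<mu>1 \<mu>2 \<mu>12 la112 la122 :: 'k
    and S I :: "('g, 'k) smash set"
  assumes "character (\<chi> L1)" and "character (\<chi> L2)"
    and "2 \<le> word_order g \<chi> [L1]"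
    and "2 \<le> word_order g \<chi> [L2]"
    and "2 \<le> word_order g \<chi> [L1, L2]"
    and "mu_admissible g \<chi> [L1] \<mu>1"
    and "mu_admissible g \<chi> [L2] \<mu>2"
    and "mu_admissible g \<chi> [L1, L2] \<mu>12"
    and "la_admissible g \<chi> [L1, L1, L2] la112"
    and "la_admissible g \<chi> [L1, L2, L2] la122"
    and "lifting_relations g \<chi> \<mu>1 \<mu>2 \<mu>12 la112 la122 S"
    and "I = Idl\<^bsub>smash_alg \<chi>\<^esub> S"
  shows "is_basis (quot_algebra (smash_alg \<chi>) I)
    {(r2, r12, r1, h :: 'g).
      enat r1 < word_order g \<chi> [L1] \<and>
      enat r12 < word_order g \<chi> [L1, L2] \<and>
      enat r2 < word_order g \<chi> [L2]}
    (\<lambda>(r2, r12, r1, h).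
      I +>\<^bsub>smash_alg \<chi>\<^esub>
        (var L2 [^]\<^bsub>smash_alg \<chi>\<^esub> r2 \<otimes>\<^bsub>smash_alg \<chi>\<^esub> x12 g \<chi> [^]\<^bsub>smash_alg \<chi>\<^esub> r12
          \<otimes>\<^bsub>smash_alg \<chi>\<^esub> var L1 [^]\<^bsub>smash_alg \<chi>\<^esub> r1 \<otimes>\<^bsub>smash_alg \<chi>\<^esub> grp h))"
proof -
  interpret smash \<chi> by (rule smash.intro) fact+
  define p where "p = \<chi> L2 (g L1)"
  define r where "r = \<chi> L1 (g L2)"
  define q1 where "q1 = \<chi> L1 (g L1)"
  define q2 where "q2 = \<chi> L2 (g L2)"
  note defs = p_def[symmetric] r_def[symmetric] q1_def[symmetric] q2_def[symmetric]
  have nz: "p \<noteq> 0" "r \<noteq> 0" "q1 \<noteq> 0" "q2 \<noteq> 0" by (simp_all add: p_def r_def q1_def q2_def chi_nonzero)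
  have w: "word_order g \<chi> [L1] = mult_order q1" "word_order g \<chi> [L2] = mult_order q2"
    "word_order g \<chi> [L1, L2] = mult_order (q1 * q2 * (p * r))"
    by (simp_all add: word_order_def wchar_def wdeg_def q1_def q2_def p_def r_def chi_add mult_ac)
  note ord = assms(3-5)[unfolded w]
  have mu1: "\<chi> L1 h ^ n = 1" if "\<mu>1 \<noteq> 0" "mult_order q1 = enat n" for n h
    using assms(6) that by (auto simp: mu_admissible_def w wchar_def)
  have mu2: "\<chi> L2 h ^ n = 1" if "\<mu>2 \<noteq> 0" "mult_order q2 = enat n" for n h
    using assms(7) that by (auto simp: mu_admissible_def w wchar_def)
  have mu12: "(\<chi> L1 h * \<chi> L2 h) ^ n = 1" if "\<mu>12 \<noteq> 0" "mult_order (q1 * q2 * (p * r)) = enat n" for n h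
    using assms(8) that by (auto simp: mu_admissible_def w wchar_def)
  have la112: "\<chi> L1 h * \<chi> L1 h * \<chi> L2 h = 1" if "la112 \<noteq> 0" for h
    using assms(9) that by (auto simp: la_admissible_def wchar_def mult.assoc)
  have la122: "\<chi> L1 h * \<chi> L2 h * \<chi> L2 h = 1" if "la122 \<noteq> 0" for h
    using assms(10) that by (auto simp: la_admissible_def wchar_def mult.assoc)
  note I = assms(12)
  interpret smash_ideal \<chi> I
    by (intro smash_ideal.intro smash_ideal_axioms.intro smash_axioms, unfold I)
      (rule ring.genideal_ideal[OF ring_A], simp)
  have gen: "a \<in> I" if "a \<in> S" for a
    using ring.genideal_self[OF ring_A, of S] that by (auto simp: I)
  have gen_Fil: "a \<in> Fil n" if "a - b \<in> S" "b \<in> Fil n" for a b n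
    using Fil_gen[OF gen[OF that(1)] that(2)] .
  have br: "braiding g \<chi> L1 L1 = q1" "braiding g \<chi> L1 L2 = p" "braiding g \<chi> L2 L1 = r" "braiding g \<chi> L2 L2 = q2"
    by (simp_all add: braiding_def p_def r_def q1_def q2_def)
  note d = Fil_sc_mul[OF Fil_dpow]
  have dpow_gen: "a \<in> Fil n" if "a - \<mu> \<cdot> dpow g \<chi> \<omega> m \<in> S" for a \<mu> \<omega> m n
    using gen_Fil[OF that d] .
  note sq = A_pow_numerals
  have two: "enat 2 = 2" "enat 3 = 3" "enat 4 = 4" by (simp_all add: numeral_eq_enat)
  have fin: "0 < n" if "mult_order x = enat n" for x :: 'k and n
    using mult_order_enat(1)[OF that] .
  have order_2: "mult_order q = enat 2" if "q = -1" "2 \<le> mult_order q" for q :: 'k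
    using mult_order_minus_one[where ?'a = 'k] mult_order_ge_2[OF that(2)] that(1) by auto
  \<comment> \<open>In (1) and (2) the parameter of \<open>x12\<close> is q22, so its order is that
    of the letter x2.\<close>
  have e12: "q1 * q2 * (p * r) = q2" if "p * r * q1 = 1"
    using that by (metis mult.assoc mult.commute mult_1)
  let ?ord = "pbw_order \<chi> I (x12 g \<chi>) (\<chi> L2 (g L1)) (\<chi> L1 (g L1) * \<chi> L2 (g L1)) (\<chi> L2 (g L1) * \<chi> L2 (g L2))"
  \<comment> \<open>Both subcases at once: \<open>la = 0\<close> when the order differs from 4, and
    the given \<lambda>112 when it is 4.\<close>
  have case2: ?thesis
    if q: "p * r * q1 = 1" "q2 = -1" and N: "mult_order q1 = N" "3 \<le> N"
      and la: "la \<noteq> 0 \<Longrightarrow> N = 4 \<and> la = la112"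
      and S: "\<And>a. a \<in> S \<longleftrightarrow> a = x112 g \<chi> - la \<cdot> dpow g \<chi> [L1, L1, L2] 1 \<or>
        (\<exists>n. N = enat n \<and> a = var L1 \<up> n - \<mu>1 \<cdot> dpow g \<chi> [L1] n) \<or> a = var L2 \<up> 2 - \<mu>2 \<cdot> dpow g \<chi> [L2] 2"
    for N la
  proof -
    have q2: "mult_order q2 = enat 2" using order_2[OF q(2) ord(2)] .
    have qb: "q1 \<noteq> 1" "1 + q1 \<noteq> 0" using mult_order_ge_3[of q1] N by auto
    obtain M where M: "N = (if M = 0 then \<infinity> else enat M)" "q1 ^ M = 1"
      using mult_order_cases[of q1] N by auto
    have x112: "x112 g \<chi> \<in> Fil n" for n using dpow_gen[of "x112 g \<chi>" la "[L1, L1, L2]" 1] by (simp add: S)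
    have v2: "var L2 \<star> var L2 \<in> Fil 1"
      using dpow_gen[of "var L2 \<up> 2" \<mu>2 "[L2]" 2 1] by (simp add: S sq)
    have v1: "var L1 \<up> m \<in> Fil n" if "N = enat m" for m n
      using dpow_gen[of "var L1 \<up> m" \<mu>1 "[L1]" m] that by (auto simp: S)
    have x122: "x122 g \<chi> \<in> Fil 2" using q v2 by (intro x122_Fil) (simp_all add: q2_def)
    have y2: "x12 g \<chi> \<star> x12 g \<chi> \<in> Fil 3"
      using qb q x112 x122 by (intro x12_square_Fil) (auto simp: q1_def q2_def)
    have order: "?ord N 2 2"
      using x112 x122 v1 v2 y2 fin[of q1] N by (intro pbw_orderI) (auto simp: sq numeral_eq_enat)
    have la4: "M = 4 \<and> q1 * q1 = -1 \<and> la = la112" if "la \<noteq> 0"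
      using la[OF that] M(1) order_4_square[of q1] N(1) by (auto simp flip: two split: if_splits)
    \<comment> \<open>For infinite order \<mu>1 is unconstrained and has no relation, so it is
      replaced by 0.\<close>
    show ?thesis unfolding A_simps(2) w e12[OF q(1)] q2[unfolded two] N(1)
      by (rule quad_basis[where i = L1 and q = q1 and M = M and N = N and la = la and \<mu> = "if M = 0 then 0 else \<mu>1"
            and \<mu>' = \<mu>2 and xx = "x112 g \<chi>" and \<omega> = "[L1, L1, L2]" and S = S, OF _ _ _ _ _ _ _ _ _ _ _ _ _ _ order I])
        (use q qb M la4 la112 mu1 mu2 N q2 S in \<open>auto simp: power2_eq_square wdeg_def defs split: if_splits\<close>)
  qed
  have case3: ?thesis
    if q: "p * r * q2 = 1" "q1 = -1" and N: "mult_order q2 = N" "3 \<le> N"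
      and la: "la \<noteq> 0 \<Longrightarrow> N = 4 \<and> la = la122"
      and S: "\<And>a. a \<in> S \<longleftrightarrow> a = x122 g \<chi> - la \<cdot> dpow g \<chi> [L1, L2, L2] 1 \<or>
        (\<exists>n. N = enat n \<and> a = var L2 \<up> n - \<mu>2 \<cdot> dpow g \<chi> [L2] n) \<or> a = var L1 \<up> 2 - \<mu>1 \<cdot> dpow g \<chi> [L1] 2"
    for N la
  proof -
    have q1: "mult_order q1 = enat 2" using order_2[OF q(2) ord(1)] .
    \<comment> \<open>Mirror image of the previous case: the parameter of \<open>x12\<close> is now
      q11 = -1, so \<open>x12\<close> has exponent bound 2 again.\<close>
    have e12: "q1 * q2 * (p * r) = q1" using q(1) by (metis mult.assoc mult.commute mult_1)
    have qb: "q2 \<noteq> 1" "1 + q2 \<noteq> 0" using mult_order_ge_3[of q2] N by auto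
    then have qne: "q1 \<noteq> q2" using q by auto
    obtain M where M: "N = (if M = 0 then \<infinity> else enat M)" "q2 ^ M = 1"
      using mult_order_cases[of q2] N by auto
    have x122: "x122 g \<chi> \<in> Fil n" for n using dpow_gen[of "x122 g \<chi>" la "[L1, L2, L2]" 1] by (simp add: S)
    have v1: "var L1 \<star> var L1 \<in> Fil 1"
      using dpow_gen[of "var L1 \<up> 2" \<mu>1 "[L1]" 2 1] by (simp add: S sq)
    have v2: "var L2 \<up> m \<in> Fil n" if "N = enat m" for m n
      using dpow_gen[of "var L2 \<up> m" \<mu>2 "[L2]" m] that by (auto simp: S)
    have x112: "x112 g \<chi> \<in> Fil 2" using q v1 by (intro x112_Fil) (simp_all add: q1_def)
    have y2: "x12 g \<chi> \<star> x12 g \<chi> \<in> Fil 3"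
      using qne x112 x122 by (intro x12_square_Fil) (simp_all add: q1_def q2_def)
    have order: "?ord 2 2 N"
      using x112 x122 v1 v2 y2 fin[of q2] N by (intro pbw_orderI) (auto simp: sq numeral_eq_enat)
    have la4: "M = 4 \<and> q2 * q2 = -1 \<and> la = la122" if "la \<noteq> 0"
      using la[OF that] M(1) order_4_square[of q2] N(1) by (auto simp flip: two split: if_splits)
    show ?thesis unfolding A_simps(2) w e12 q1[unfolded two] N(1)
      by (rule quad_basis[where i = L2 and q = q2 and M = M and N = N and la = la and \<mu> = "if M = 0 then 0 else \<mu>2"
            and \<mu>' = \<mu>1 and xx = "x122 g \<chi>" and \<omega> = "[L1, L2, L2]" and S = S, OF _ _ _ _ _ _ _ _ _ _ _ _ _ _ order I])
        (use q qb M la4 la122 mu1 mu2 N q1 S in \<open>auto simp: power2_eq_square wdeg_def mult_ac add_ac defs split: if_splits\<close>)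
  qed
  \<comment> \<open>\<open>i = L2\<close> serves (4a), where x2 has square zero, and
    \<open>i = L1\<close> serves (4b).\<close>
  have case4: ?thesis
    if q: "q1 = -1" "q2 = -1" and N: "mult_order (p * r) = N" "3 \<le> N"
      and mu: "\<And>h. \<mu> \<noteq> 0 \<Longrightarrow> \<chi> (other i) h ^ 2 = 1"
      and S: "\<And>a. a \<in> S \<longleftrightarrow> a = var i \<up> 2 \<or> (\<exists>n. N = enat n \<and> a = x12 g \<chi> \<up> n - \<mu>12 \<cdot> dpow g \<chi> [L1, L2] n) \<or>
        a = var (other i) \<up> 2 - \<mu> \<cdot> dpow g \<chi> [other i] 2"
    for N i \<mu>
  proof -
    have e12: "q1 * q2 * (p * r) = p * r" using q by simp
    note os = order_2[OF q(1) ord(1)] order_2[OF q(2) ord(2)]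
    obtain M where M: "N = (if M = 0 then \<infinity> else enat M)" "(p * r) ^ M = 1"
      using mult_order_cases[of "p * r"] N by auto
    have M1: "M \<noteq> 1" using M mult_order_ge_3[of "p * r"] N by auto
    have "var i \<up> 2 \<in> Fil 1" by (rule Fil_I, rule gen, simp add: S)
    moreover have "var (other i) \<up> 2 \<in> Fil 1"
      using dpow_gen[of "var (other i) \<up> 2" \<mu> "[other i]" 2 1] by (simp add: S)
    ultimately have v: "var k \<star> var k \<in> Fil 1" for k by (cases i; cases k) (simp_all add: sq)
    have y: "x12 g \<chi> \<up> m \<in> Fil n" if "N = enat m" for m n
      using dpow_gen[of "x12 g \<chi> \<up> m" \<mu>12 "[L1, L2]" m] that by (auto simp: S)
    have order: "?ord 2 N 2"
      using q v y fin[of "p * r"] N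
      by (intro pbw_orderI x112_Fil x122_Fil) (auto simp: q1_def q2_def sq numeral_eq_enat)
    show ?thesis unfolding A_simps(2) w e12 os N(1) two
      by (rule pair_basis[where i = i and M = M and \<mu> = \<mu> and ?\<mu>12.0 = "if M = 0 then 0 else \<mu>12" and S = S,
            OF _ _ _ _ _ _ _ order I])
        (use q M M1 mu mu12 N e12 S in \<open>auto simp: power2_eq_square defs split: if_splits\<close>)
  qed
  from assms(11) show ?thesis
  proof cases
    case case_1a
    then have q: "q1 = -1" "q2 = -1" "p * r * q1 = 1" using nz by (simp_all add: br field_simps)
    note o = order_2[OF q(1) ord(1)] order_2[OF q(2) ord(2)]
    have o12: "mult_order (q1 * q2 * (p * r)) = enat 2" using o unfolding e12[OF q(3)] by simp
    have ne: "(-1 :: 'k) \<noteq> 1" using mult_order_ge_2[OF ord(1)] q by simp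
    note S = case_1a(1)[unfolded br A_smult]
    have x1: "var L1 \<star> var L1 \<in> Fil 1" and x2: "var L2 \<star> var L2 \<in> Fil 1"
      using dpow_gen[of "var L1 \<up> 2" \<mu>1 "[L1]" 2 1] dpow_gen[of "var L2 \<up> 2" \<mu>2 "[L2]" 2 1]
      by (simp_all add: S sq)
    have "x12 g \<chi> \<up> 2 - ((4 * \<mu>1 * r) \<cdot> var L2 \<up> 2 + \<mu>12 \<cdot> dpow g \<chi> [L1, L2] 2) \<in> S"
      by (simp add: S diff_diff_eq)
    then have x12: "x12 g \<chi> \<up> 2 \<in> Fil 3"
      by (rule gen_Fil) (auto simp: sq intro!: Fil_add d Fil_sc_mul Fil_mono[OF x2])
    have order: "?ord (enat 2) (enat 2) (enat 2)"
      using x1 x2 x12 q by (intro pbw_orderI x112_Fil x122_Fil) (auto simp: sq q1_def q2_def)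
    \<comment> \<open>The coefficient 4 \<mu>1 q21 is \<mu>1 (q11 - 1)^2 q21 at q11 = -1, a multiple
      of \<mu>1 as \<open>c2\<close> has to be.\<close>
    show ?thesis unfolding A_simps(2) w o12 o
      by (rule case1_basis[where M = 2 and ?la112.0 = 0 and ?la122.0 = 0 and ?c1.0 = 0 and ?c2.0 = "4 * \<mu>1 * r"
            and ?\<mu>1.0 = \<mu>1 and ?\<mu>2.0 = \<mu>2 and ?\<mu>12.0 = \<mu>12 and S = S, OF _ _ _ _ _ _ _ _ _ _ _ _ _ _ order I])
        (use q ne mu1 mu2 mu12 o o12 S in \<open>auto simp: defs\<close>)
  next
    case case_1b
    then have q: "p * r * q1 = 1" "q2 = q1" and o: "mult_order q1 = enat 3" using nz by (simp_all add: br two field_simps)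
    have o2: "mult_order q2 = enat 3" "mult_order (q1 * q2 * (p * r)) = enat 3"
      using o unfolding e12[OF q(1)] unfolding q(2) by simp_all
    have q1: "q1 ^ 3 = 1" "q1 \<noteq> 1" using mult_order_enat(2)[OF o] mult_order_ge_2[OF ord(1)] by simp_all
    note S = case_1b(1)[unfolded br A_smult]
    have x112: "x112 g \<chi> \<in> Fil n" and x122: "x122 g \<chi> \<in> Fil n" for n
      using dpow_gen[of "x112 g \<chi>" la112 "[L1, L1, L2]" 1] dpow_gen[of "x122 g \<chi>" la122 "[L1, L2, L2]" 1]
      by (simp_all add: S)
    have x1: "var L1 \<up> 3 \<in> Fil n" and x2: "var L2 \<up> 3 \<in> Fil n" for n
      using dpow_gen[of "var L1 \<up> 3" \<mu>1 "[L1]" 3] dpow_gen[of "var L2 \<up> 3" \<mu>2 "[L2]" 3] by (simp_all add: S)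
    \<comment> \<open>The generator is regrouped as the cube minus terms that the other relations
      already place in low degree.\<close>
    have "x12 g \<chi> \<up> 3 - (- (((1 - q1) * q1 * la112) \<cdot> x122 g \<chi>) + (\<mu>1 * (1 - q1) ^ 3) \<cdot> var L2 \<up> 3
        + \<mu>12 \<cdot> dpow g \<chi> [L1, L2] 3) \<in> S"
      by (simp add: S algebra_simps)
    then have x12: "x12 g \<chi> \<up> 3 \<in> Fil n" for n
      by (rule gen_Fil) (intro Fil_add Fil_minus d Fil_sc_mul x2 x122)
    have order: "?ord (enat 3) (enat 3) (enat 3)"
      using x1 x2 x12 x112 x122 by (intro pbw_orderI) auto
    show ?thesis unfolding A_simps(2) w o2 o
      by (rule case1_basis[where M = 3 and ?la112.0 = la112 and ?la122.0 = la122 and ?c1.0 = "- ((1 - q1) * q1 * la112)"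
            and ?c2.0 = "\<mu>1 * (1 - q1) ^ 3"
            and ?\<mu>1.0 = \<mu>1 and ?\<mu>2.0 = \<mu>2 and ?\<mu>12.0 = \<mu>12 and S = S, OF _ _ _ _ _ _ _ _ _ _ _ _ _ _ order I])
        (use q q1 mu1 mu2 mu12 la112 la122 o o2 S in \<open>auto simp: scl_left defs\<close>)
  next
    case (case_1c N)
    then have q: "p * r * q1 = 1" "q2 = q1" and N: "mult_order q1 = N" using nz by (simp_all add: br field_simps)
    have o2: "mult_order q2 = N" "mult_order (q1 * q2 * (p * r)) = N"
      using N unfolding e12[OF q(1)] unfolding q(2) by simp_all
    obtain M where M: "N = (if M = 0 then \<infinity> else enat M)" "q1 ^ M = 1"
      using mult_order_cases[of q1] N by auto
    have q1: "q1 \<noteq> 1" using mult_order_ge_2[OF ord(1)] .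
    note S = case_1c(1)[unfolded br A_smult]
    have x112: "x112 g \<chi> \<in> Fil n" and x122: "x122 g \<chi> \<in> Fil n" for n
      by (rule Fil_I, rule gen, simp add: S)+
    have x1: "var L1 \<up> m \<in> Fil n" and x2: "var L2 \<up> m \<in> Fil n" if "N = enat m" for m n
      using dpow_gen[of "var L1 \<up> m" \<mu>1 "[L1]" m] dpow_gen[of "var L2 \<up> m" \<mu>2 "[L2]" m] that by (auto simp: S)
    have x12: "x12 g \<chi> \<up> m \<in> Fil n" if "N = enat m" for m n
    proof (rule gen_Fil)
      let ?b = "(\<mu>1 * (q1 - 1) ^ m * r ^ (m * (m - 1) div 2)) \<cdot> var L2 \<up> m + \<mu>12 \<cdot> dpow g \<chi> [L1, L2] m"
      show "x12 g \<chi> \<up> m - ?b \<in> S" using that by (auto simp: S diff_diff_eq)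
      show "?b \<in> Fil n" by (intro Fil_add d Fil_sc_mul x2 that)
    qed
    have order: "?ord N N N"
      using x1 x2 x12 x112 x122 fin[of q1] N by (intro pbw_orderI) auto
    show ?thesis unfolding A_simps(2) w o2 N
      by (rule case1_basis[where M = M and ?la112.0 = 0 and ?la122.0 = 0 and ?c1.0 = 0
            and ?c2.0 = "if M = 0 then 0 else \<mu>1 * (q1 - 1) ^ M * r ^ (M * (M - 1) div 2)"
            and ?\<mu>1.0 = "if M = 0 then 0 else \<mu>1" and ?\<mu>2.0 = "if M = 0 then 0 else \<mu>2"
            and ?\<mu>12.0 = "if M = 0 then 0 else \<mu>12" and S = S, OF _ _ _ _ _ _ _ _ _ _ _ _ _ _ order I])
        (use q q1 M mu1 mu2 mu12 N o2 S in \<open>auto simp: defs split: if_splits\<close>)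
  next
    case (case_2a N)
    then show ?thesis using nz by (intro case2[of N 0]) (auto simp: br field_simps)
  next
    case case_2b
    then show ?thesis using nz by (intro case2[of 4 la112]) (auto simp: br field_simps simp flip: two)
  next
    case (case_3a N)
    then show ?thesis using nz by (intro case3[of N 0]) (auto simp: br field_simps)
  next
    case case_3b
    then show ?thesis using nz by (intro case3[of 4 la122]) (auto simp: br field_simps simp flip: two)
  next
    case (case_4a N)
    then show ?thesis using mu1 order_2[of q1] ord(1)
      by (intro case4[of N \<mu>1 L2]) (auto simp: br A_smult power2_eq_square)
  next
    case (case_4b N)
    then show ?thesis using mu2 order_2[of q2] ord(2)
      by (intro case4[of N \<mu>2 L1]) (auto simp: br A_smult power2_eq_square)
  qed
qed

end
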